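(* The following decision problem (2-FLIP) is $\mathsf{NP}$-complete: given a finite graph $G$, decide whether $G$ admits a $2$-color flip coloring.
   Context: A $2$-color flip coloring of a simple graph $G$ is a coloring of each edge red or blue such that for every vertex $v$: $v$ has strictly fewer incident red edges than incident blue edges, and the closed neighborhood $N[v]=N(v)\cup\{v\}$ induces strictly more red edges than blue edges. *)

theory Defs
  imports Main "HOL-Computational_Algebra.Polynomial"
begin

section \<open>Turing machines\<close>

text \<open>
  Deterministic multi-tape machines. Tape symbols are the numbers below \<open>nsyms M\<close>: 0 is the blank,
  1 and 2 stand for the bits 0 and 1, and the remaining ones are auxiliary symbols.
  States are the numbers up to \<open>nstates M\<close>: 0 is the start state and \<open>nstates M\<close> itself is the
  halting state (in which no transition is made). All tapes are infinite in both directions and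
  may be read and written.
\<close>

datatype move = MoveLeft | Stay | MoveRight

record tm =
  ntapes :: nat
  nsyms :: nat
  nstates :: nat
  delta :: "nat \<Rightarrow> nat list \<Rightarrow> nat \<times> (nat \<times> move) list"

definition turing_machine :: "tm \<Rightarrow> bool" where
  "turing_machine M \<longleftrightarrow> 2 \<le> ntapes M \<and> 3 \<le> nsyms M \<and>
     (\<forall>q < nstates M. \<forall>gs. length gs = ntapes M \<and> (\<forall>g \<in> set gs. g < nsyms M) \<longrightarrow>
        fst (delta M q gs) \<le> nstates M \<and>
        length (snd (delta M q gs)) = ntapes M \<and>
        (\<forall>(w, m) \<in> set (snd (delta M q gs)). w < nsyms M))"

type_synonym tape = "(int \<Rightarrow> nat) \<times> int"  \<comment> \<open>contents and head position\<close>
type_synonym config = "nat \<times> tape list"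

fun read :: "tape \<Rightarrow> nat" where
  "read (c, h) = c h"

fun offset :: "move \<Rightarrow> int" where
  "offset MoveLeft = -1"
| "offset Stay = 0"
| "offset MoveRight = 1"

fun act :: "nat \<times> move \<Rightarrow> tape \<Rightarrow> tape" where
  "act (w, m) (c, h) = (c(h := w), h + offset m)"

fun step :: "tm \<Rightarrow> config \<Rightarrow> config" where
  "step M (q, ts) =
     (if q < nstates M
      then let (q', as) = delta M q (map read ts) in (q', map2 act as ts)
      else (q, ts))"

definition tape_of :: "bool list \<Rightarrow> int \<Rightarrow> nat" where
  "tape_of x i =
     (if 0 \<le> i \<and> i < int (length x) then (if x ! nat i then 2 else 1) else 0)"

text \<open>The input is on tape 0; the output is read from tape 1.\<close>

definition start_config :: "tm \<Rightarrow> bool list \<Rightarrow> config" where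
  "start_config M x = (0, (tape_of x, 0) # replicate (ntapes M - 1) (tape_of [], 0))"

definition computes_in_time :: "tm \<Rightarrow> (bool list \<Rightarrow> bool list) \<Rightarrow> (nat \<Rightarrow> nat) \<Rightarrow> bool" where
  "computes_in_time M f T \<longleftrightarrow>
     (\<forall>x. \<exists>t \<le> T (length x). \<exists>ts.
        (step M ^^ t) (start_config M x) = (nstates M, ts) \<and> fst (ts ! 1) = tape_of (f x))"


section \<open>The class NP and NP-completeness\<close>

definition polytime_computable :: "(bool list \<Rightarrow> bool list) \<Rightarrow> bool" where
  "polytime_computable f \<longleftrightarrow>
     (\<exists>M (p :: nat poly). turing_machine M \<and> computes_in_time M f (poly p))"

definition P_class :: "bool list set set" where
  "P_class = {L. polytime_computable (\<lambda>x. [x \<in> L])}"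

text \<open>Pairing of words: the bits of the first word are doubled, and 01 separates the two words.\<close>

definition pair_word :: "bool list \<Rightarrow> bool list \<Rightarrow> bool list" where
  "pair_word x y = concat (map (\<lambda>b. [b, b]) x) @ [False, True] @ y"

definition NP_class :: "bool list set set" where
  "NP_class = {L. \<exists>R \<in> P_class. \<exists>p :: nat poly.
     \<forall>x. x \<in> L \<longleftrightarrow> (\<exists>y. length y \<le> poly p (length x) \<and> pair_word x y \<in> R)}"

definition polytime_reducible :: "bool list set \<Rightarrow> bool list set \<Rightarrow> bool" (infix "\<le>\<^sub>p" 50) where
  "L \<le>\<^sub>p L' \<longleftrightarrow> (\<exists>f. polytime_computable f \<and> (\<forall>x. x \<in> L \<longleftrightarrow> f x \<in> L'))"

definition NP_complete :: "bool list set \<Rightarrow> bool" where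
  "NP_complete L \<longleftrightarrow> L \<in> NP_class \<and> (\<forall>L' \<in> NP_class. L' \<le>\<^sub>p L)"


section \<open>Flip colorings\<close>

definition finite_simple_graph :: "'a set \<Rightarrow> 'a set set \<Rightarrow> bool" where
  "finite_simple_graph V E \<longleftrightarrow> finite V \<and> (\<forall>e \<in> E. e \<subseteq> V \<and> card e = 2)"

datatype color = Red | Blue

definition closed_neighborhood :: "'a set set \<Rightarrow> 'a \<Rightarrow> 'a set" where
  "closed_neighborhood E v = {u. {u, v} \<in> E} \<union> {v}"

definition flip_coloring :: "'a set \<Rightarrow> 'a set set \<Rightarrow> ('a set \<Rightarrow> color) \<Rightarrow> bool" where
  "flip_coloring V E c \<longleftrightarrow> (\<forall>v \<in> V.
     card {e \<in> E. v \<in> e \<and> c e = Red} < card {e \<in> E. v \<in> e \<and> c e = Blue} \<and>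
     card {e \<in> E. e \<subseteq> closed_neighborhood E v \<and> c e = Red}
       > card {e \<in> E. e \<subseteq> closed_neighborhood E v \<and> c e = Blue})"


section \<open>The decision problem\<close>

text \<open>
  A graph with vertex set \<open>{..<n}\<close> is presented as \<open>n\<close> in unary, terminated by a 0, followed by
  the rows of its adjacency matrix.
\<close>

definition encode_graph :: "nat \<Rightarrow> nat set set \<Rightarrow> bool list" where
  "encode_graph n E =
     replicate n True @ [False] @ concat (map (\<lambda>i. map (\<lambda>j. {i, j} \<in> E) [0..<n]) [0..<n])"

definition two_FLIP :: "bool list set" where
  "two_FLIP =
     {encode_graph n E | n E. finite_simple_graph {..<n} E \<and> (\<exists>c. flip_coloring {..<n} E c)}"

lemma encode_graph_inject:
  assumes "finite_simple_graph {..<n} E" "finite_simple_graph {..<m} F"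
    and "encode_graph n E = encode_graph m F"
  shows "n = m \<and> E = F"
proof -
  have pre: "takeWhile id (replicate k True @ False # zs) = replicate k True" for k zs
    by (induction k) auto
  have "takeWhile id (encode_graph n E) = takeWhile id (encode_graph m F)"
    using assms(3) by simp
  then have nm: "n = m"
    unfolding encode_graph_def by (simp add: pre replicate_eq_replicate)
  have "concat (map (\<lambda>i. map (\<lambda>j. {i, j} \<in> E) [0..<n]) [0..<n])
      = concat (map (\<lambda>i. map (\<lambda>j. {i, j} \<in> F) [0..<n]) [0..<n])"
    using assms(3) nm by (simp add: encode_graph_def)
  then have "map (\<lambda>i. map (\<lambda>j. {i, j} \<in> E) [0..<n]) [0..<n]
      = map (\<lambda>i. map (\<lambda>j. {i, j} \<in> F) [0..<n]) [0..<n]"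
    by (subst (asm) concat_eq_concat_iff) (auto simp: set_zip)
  then have adj: "{i, j} \<in> E \<longleftrightarrow> {i, j} \<in> F" if "i < n" "j < n" for i j
    using that by (auto simp: map_eq_conv)
  have "e \<in> E \<longleftrightarrow> e \<in> F" if e: "e \<subseteq> {..<n}" "card e = 2" for e
  proof -
    obtain i j where "e = {i, j}" using e(2) by (auto simp: card_2_iff)
    then show ?thesis using adj[of i j] e(1) by auto
  qed
  then have "E = F" using assms(1,2) nm unfolding finite_simple_graph_def by blast
  then show ?thesis using nm by simp
qed

end

theory Submission
  imports Defs
begin

text \<open>
  Both halves only need functions whose bits are computed with numbers of polynomial size.
  Such functions are given by arithmetic expressions with bounded sums, which compile to machines that
  store a number as the position of a head, with a polynomial time bound by structural induction.

  For hardness, the computations of a verifier are first described by a formula in conjunctive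
  normal form. Since heads and tapes determine the next configuration, implications
  suffice: a satisfying valuation need not be consistent, but it contains all true facts about the computation on
  the witness that it guesses. The formula is then turned into a graph. A vertex of degree three with exactly two edges
  between its neighbors forces these two edges to be red and exactly one of its own edges to be
  red, and from such vertices one obtains gadgets for variables and clauses; all the other
  vertices are placed in cliques so large that their conditions hold for every coloring of the gadgets.
\<close>

text \<open>The two conditions at a vertex pull in opposite directions: its own edges must be mostly
  blue, the edges around it mostly red. Every vertex has to meet both, so auxiliary vertices of a
  gadget would need gadgets of their own, without end. A red clique alone does not stop this, since
  it spoils the first condition. Its product with a blue complete bipartite graph does: the blue
  edges inside a closed neighborhood are only those at the vertex itself, linearly many, while the
  red clique contributes quadratically many edges. Both sizes are chosen to beat the core graph
  however it is colored.

  The reduction has to be computed by an explicit machine. For this reason clauses, variables and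
  vertices are all tuples of digits below a polynomial bound, and adjacency is an arithmetic
  condition on two numbers; the arbitrary but finite transition function of the verifier enters as a
  constant table. Positions are taken relative to the heads so that the clauses for a step have the
  same shape everywhere: the symbols read are always those at offset 0, and a head movement becomes
  a shift of the whole tape.\<close>

section \<open>Counter programs\<close>

text \<open>A register is a tape that carries a single mark, at position 0; its value is the position
  of the head. Every instruction is then one step of the Turing machine.\<close>

datatype ins = Inc nat | Dec nat | HeadL | HeadR | Out bool

datatype test = Zero nat | Sym nat

datatype com = Do ins | Seq com com | If test com com | Until test com

type_synonym store = "int \<times> (nat \<Rightarrow> nat) \<times> bool list"

fun exec :: "ins \<Rightarrow> store \<Rightarrow> store" where
  "exec (Inc r) (h, R, out) = (h, R(r := Suc (R r)), out)"
| "exec (Dec r) (h, R, out) = (h, R(r := R r - 1), out)"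
| "exec HeadL (h, R, out) = (h - 1, R, out)"
| "exec HeadR (h, R, out) = (h + 1, R, out)"
| "exec (Out b) (h, R, out) = (h, R, out @ [b])"

fun holds :: "bool list \<Rightarrow> test \<Rightarrow> store \<Rightarrow> bool" where
  "holds x (Zero r) (h, R, out) = (R r = 0)"
| "holds x (Sym g) (h, R, out) = (tape_of x h = g)"

text \<open>The times count flowchart nodes: a taken \<open>If\<close> branch and every round of
  \<open>Until\<close> execute a test and a closing jump, whereas the second branch of
  \<open>If\<close> falls through.\<close>

inductive run :: "bool list \<Rightarrow> com \<Rightarrow> store \<Rightarrow> nat \<Rightarrow> store \<Rightarrow> bool" for x where
  Do: "run x (Do a) s 1 (exec a s)"
| Seq: "run x c s t s' \<Longrightarrow> run x c' s' t' s'' \<Longrightarrow> run x (Seq c c') s (t + t') s''"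
| IfT: "holds x b s \<Longrightarrow> run x c s t s' \<Longrightarrow> run x (If b c c') s (t + 2) s'"
| IfF: "\<not> holds x b s \<Longrightarrow> run x c' s t s' \<Longrightarrow> run x (If b c c') s (t + 1) s'"
| UntilT: "holds x b s \<Longrightarrow> run x (Until b c) s 1 s"
| UntilF: "\<not> holds x b s \<Longrightarrow> run x c s t s' \<Longrightarrow> run x (Until b c) s' t' s'' \<Longrightarrow>
    run x (Until b c) s (t + t' + 2) s''"

subsection \<open>Flowcharts\<close>

datatype node = Op ins | Br test nat nat

fun fstep :: "bool list \<Rightarrow> node list \<Rightarrow> nat \<times> store \<Rightarrow> nat \<times> store" where
  "fstep x P (pc, s) =
     (if pc < length P
      then case P ! pc of Op a \<Rightarrow> (Suc pc, exec a s)
         | Br b l l' \<Rightarrow> (if holds x b s then l else l', s)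
      else (pc, s))"

fun csize :: "com \<Rightarrow> nat" where
  "csize (Do a) = 1"
| "csize (Seq c c') = csize c + csize c'"
| "csize (If b c c') = csize c + csize c' + 2"
| "csize (Until b c) = csize c + 2"

text \<open>The first argument is the address of the first node, as jump targets are absolute.
  \<open>Br (Sym 0) e e\<close> is an unconditional jump, because both of its targets agree.\<close>

fun code :: "nat \<Rightarrow> com \<Rightarrow> node list" where
  "code i (Do a) = [Op a]"
| "code i (Seq c c') = code i c @ code (i + csize c) c'"
| "code i (If b c c') =
     (let e = i + csize c + csize c' + 2 in
      Br b (i + 1) (i + csize c + 2) # code (i + 1) c @
      Br (Sym 0) e e # code (i + csize c + 2) c')"
| "code i (Until b c) =
     Br b (i + csize c + 2) (i + 1) # code (i + 1) c @ [Br (Sym 0) i i]"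

lemma length_code [simp]: "length (code i c) = csize c"
  by (induction c arbitrary: i) (auto simp: Let_def)

lemma funpow_add_apply: "(f ^^ (m + n)) a = (f ^^ n) ((f ^^ m) a)"
  by (metis add.commute comp_apply funpow_add)

text \<open>Since addresses are absolute, a subprogram is not moved but seen inside the same list
  \<open>P\<close> with another prefix and suffix; hence these are arbitrary in the
  induction.\<close>

lemma run_code:
  "run x c s t s' \<Longrightarrow> P = pre @ code (length pre) c @ post \<Longrightarrow>
    (fstep x P ^^ t) (length pre, s) = (length pre + csize c, s')"
proof (induction arbitrary: pre post rule: run.induct)
  case (Do a s)
  then show ?case by (simp add: nth_append)
next
  case (Seq c s t s' c' t' s'')
  have "(fstep x P ^^ t) (length pre, s) = (length pre + csize c, s')"
    using Seq.prems by (intro Seq.IH(1)[where post = "code (length pre + csize c) c' @ post"]) simp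
  moreover have "(fstep x P ^^ t') (length (pre @ code (length pre) c), s')
      = (length (pre @ code (length pre) c) + csize c', s'')"
    using Seq.prems by (intro Seq.IH(2)[where post = post]) simp
  ultimately show ?case by (simp add: funpow_add_apply add.assoc)
next
  case (IfT b s c t s' c')
  let ?e = "length pre + csize c + csize c' + 2"
  define pre' where "pre' = pre @ [Br b (length pre + 1) (length pre + csize c + 2)]"
  have P: "P = pre' @ code (length pre') c @
      (Br (Sym 0) ?e ?e # code (length pre + csize c + 2) c' @ post)"
    using IfT.prems by (simp add: Let_def pre'_def)
  have "(fstep x P ^^ t) (length pre', s) = (length pre' + csize c, s')"
    using P by (rule IfT.IH)
  moreover have "fstep x P (length pre, s) = (length pre', s)"
    using IfT.prems IfT.hyps by (simp add: nth_append Let_def pre'_def)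
  moreover have "fstep x P (length pre' + csize c, s') = (?e, s')"
  proof -
    have "P ! (length pre' + csize c) = Br (Sym 0) ?e ?e"
      unfolding P by (simp add: nth_append)
    moreover have "length pre' + csize c < length P" unfolding P by simp
    ultimately show ?thesis by (cases s') auto
  qed
  moreover have "t + 2 = Suc 0 + (t + Suc 0)" by simp
  ultimately show ?case by (simp only: funpow_add_apply) simp
next
  case (IfF b s c' t s' c)
  let ?e = "length pre + csize c + csize c' + 2"
  define pre' where "pre' = pre @ Br b (length pre + 1) (length pre + csize c + 2) #
    code (length pre + 1) c @ [Br (Sym 0) ?e ?e]"
  have P: "P = pre' @ code (length pre') c' @ post"
    using IfF.prems by (simp add: Let_def pre'_def)
  have "(fstep x P ^^ t) (length pre', s) = (length pre' + csize c', s')"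
    using P by (rule IfF.IH)
  moreover have "fstep x P (length pre, s) = (length pre', s)"
    using IfF.prems IfF.hyps by (simp add: nth_append Let_def pre'_def)
  moreover have "t + 1 = Suc 0 + t" by simp
  ultimately show ?case by (simp only: funpow_add_apply) (simp add: pre'_def)
next
  case (UntilT b s c)
  then show ?case by (simp add: nth_append)
next
  case (UntilF b s c t s' t' s'')
  define pre' where "pre' = pre @ [Br b (length pre + csize c + 2) (length pre + 1)]"
  have P: "P = pre' @ code (length pre') c @ (Br (Sym 0) (length pre) (length pre) # post)"
    using UntilF.prems by (simp add: pre'_def)
  have "(fstep x P ^^ t) (length pre', s) = (length pre' + csize c, s')"
    using P by (rule UntilF.IH(1))
  moreover have "(fstep x P ^^ t') (length pre, s') = (length pre + csize (Until b c), s'')"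
    using UntilF.prems by (rule UntilF.IH(2))
  moreover have "fstep x P (length pre, s) = (length pre', s)"
    using UntilF.prems UntilF.hyps by (simp add: nth_append pre'_def)
  moreover have "fstep x P (length pre' + csize c, s') = (length pre, s')"
  proof -
    have "P ! (length pre' + csize c) = Br (Sym 0) (length pre) (length pre)"
      unfolding P by (simp add: nth_append)
    moreover have "length pre' + csize c < length P" unfolding P by simp
    ultimately show ?thesis by (cases s') auto
  qed
  moreover have "t + t' + 2 = Suc 0 + (t + (Suc 0 + t'))" by simp
  ultimately show ?case by (simp only: funpow_add_apply) simp
qed

fun ins_regs :: "ins \<Rightarrow> nat set" where
  "ins_regs (Inc r) = {r}"
| "ins_regs (Dec r) = {r}"
| "ins_regs a = {}"

fun test_regs :: "test \<Rightarrow> nat set" where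
  "test_regs (Zero r) = {r}"
| "test_regs (Sym g) = {}"

fun regs :: "com \<Rightarrow> nat set" where
  "regs (Do a) = ins_regs a"
| "regs (Seq c c') = regs c \<union> regs c'"
| "regs (If b c c') = test_regs b \<union> regs c \<union> regs c'"
| "regs (Until b c) = test_regs b \<union> regs c"

lemma finite_regs: "finite (regs c)"
proof -
  have 1: "finite (ins_regs a)" for a by (cases a) auto
  have 2: "finite (test_regs a)" for a by (cases a) auto
  show ?thesis by (induction c) (auto simp: 1 2)
qed

fun node_ok :: "nat \<Rightarrow> nat \<Rightarrow> node \<Rightarrow> bool" where
  "node_ok k n (Op a) \<longleftrightarrow> ins_regs a \<subseteq> {..<k}"
| "node_ok k n (Br b l l') \<longleftrightarrow> test_regs b \<subseteq> {..<k} \<and> l \<le> n \<and> l' \<le> n"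

lemma code_ok:
  "a \<in> set (code i c) \<Longrightarrow> regs c \<subseteq> {..<k} \<Longrightarrow> i + csize c \<le> n \<Longrightarrow> node_ok k n a"
  by (induction c arbitrary: i) (fastforce simp: Let_def)+

subsection \<open>Turing machines for flowcharts\<close>

text \<open>Register \<open>r\<close> is tape \<open>r + 2\<close>, behind the input and output
  tapes. Its head reads 1 exactly at value 0, so the guard \<open>g = 0\<close> makes
  \<open>Dec\<close> a truncated subtraction.\<close>

fun ins_act :: "ins \<Rightarrow> nat \<Rightarrow> nat \<Rightarrow> nat \<times> move" where
  "ins_act (Inc r) i g = (g, if i = r + 2 then MoveRight else Stay)"
| "ins_act (Dec r) i g = (g, if i = r + 2 \<and> g = 0 then MoveLeft else Stay)"
| "ins_act HeadL i g = (g, if i = 0 then MoveLeft else Stay)"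
| "ins_act HeadR i g = (g, if i = 0 then MoveRight else Stay)"
| "ins_act (Out b) i g = (if i = 1 then (if b then 2 else 1, MoveRight) else (g, Stay))"

fun test_syms :: "test \<Rightarrow> nat list \<Rightarrow> bool" where
  "test_syms (Zero r) gs = (gs ! (r + 2) = 1)"
| "test_syms (Sym g) gs = (gs ! 0 = g)"

text \<open>State 0 puts the marks on the register tapes; state \<open>q + 1\<close> executes node \<open>q\<close>.\<close>

definition flow_tm :: "nat \<Rightarrow> node list \<Rightarrow> tm" where
  "flow_tm k P = \<lparr>ntapes = k + 2, nsyms = 3, nstates = Suc (length P),
     delta = (\<lambda>q gs. case q of
         0 \<Rightarrow> (1, map (\<lambda>i. (if i < 2 then gs ! i else 1, Stay)) [0..<k + 2])
       | Suc pc \<Rightarrow> (case P ! pc of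
             Op a \<Rightarrow> (Suc (Suc pc), map (\<lambda>i. ins_act a i (gs ! i)) [0..<k + 2])
           | Br b l l' \<Rightarrow> (Suc (if test_syms b gs then l else l'),
               map (\<lambda>i. (gs ! i, Stay)) [0..<k + 2])))\<rparr>"

lemma flow_tm_sel [simp]:
  "ntapes (flow_tm k P) = k + 2" "nsyms (flow_tm k P) = 3" "nstates (flow_tm k P) = Suc (length P)"
  by (simp_all add: flow_tm_def)

lemma fst_ins_act: "g < 3 \<Longrightarrow> fst (ins_act a i g) < 3"
  by (cases a) auto

lemma turing_machine_flow_tm:
  assumes "\<forall>a \<in> set P. node_ok k (length P) a"
  shows "turing_machine (flow_tm k P)"
  unfolding turing_machine_def
proof (intro conjI allI impI)
  fix q gs
  assume q: "q < nstates (flow_tm k P)"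
    and gs: "length gs = ntapes (flow_tm k P) \<and> (\<forall>g\<in>set gs. g < nsyms (flow_tm k P))"
  have g3: "gs ! i < 3" if "i < k + 2" for i
    using gs that by (metis flow_tm_sel(1,2) nth_mem)
  have "fst (delta (flow_tm k P) q gs) \<le> nstates (flow_tm k P)
    \<and> length (snd (delta (flow_tm k P) q gs)) = ntapes (flow_tm k P)
    \<and> (\<forall>wm\<in>set (snd (delta (flow_tm k P) q gs)). fst wm < 3)"
  proof (cases q)
    case 0
    then show ?thesis using g3 by (auto simp: flow_tm_def)
  next
    case (Suc pc)
    then have "P ! pc \<in> set P" using q by simp
    then have ok: "node_ok k (length P) (P ! pc)" using assms by blast
    show ?thesis
    proof (cases "P ! pc")
      case (Op a)
      then show ?thesis using Suc q g3 fst_ins_act by (auto simp: flow_tm_def)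
    next
      case (Br b l l')
      then show ?thesis using Suc q g3 ok by (auto simp: flow_tm_def)
    qed
  qed
  then show "fst (delta (flow_tm k P) q gs) \<le> nstates (flow_tm k P)"
    "length (snd (delta (flow_tm k P) q gs)) = ntapes (flow_tm k P)"
    "\<forall>(w, m)\<in>set (snd (delta (flow_tm k P) q gs)). w < nsyms (flow_tm k P)"
    by (auto simp: case_prod_beta)
qed auto

definition marked :: "int \<Rightarrow> nat" where
  "marked = (\<lambda>_. 0)(0 := 1)"

fun config_of :: "nat \<Rightarrow> bool list \<Rightarrow> nat \<times> store \<Rightarrow> config" where
  "config_of k x (pc, (h, R, out)) =
     (Suc pc, (tape_of x, h) # (tape_of out, int (length out)) #
        map (\<lambda>r. (marked, int (R r))) [0..<k])"

lemma tape_of_snoc: "(tape_of out)(int (length out) := if b then 2 else 1) = tape_of (out @ [b])"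
  by (rule ext) (auto simp: tape_of_def nth_append nat_less_iff)

lemma tape_of_end: "tape_of out (int (length out)) = 0"
  by (simp add: tape_of_def)

lemma step_flow_tm:
  assumes "pc < length P" "node_ok k (length P) (P ! pc)"
  shows "step (flow_tm k P) (config_of k x (pc, s)) = config_of k x (fstep x P (pc, s))"
proof -
  obtain h R out where s: "s = (h, R, out)" by (cases s)
  define ts where "ts = snd (config_of k x (pc, s))"
  have ts: "config_of k x (pc, s) = (Suc pc, ts)" by (simp add: ts_def s)
  have len: "length ts = k + 2" by (simp add: ts_def s)
  have rd0: "read (ts ! 0) = tape_of x h" and rd1: "read (ts ! 1) = 0"
    by (simp_all add: ts_def s tape_of_end)
  have rd: "read (ts ! (r + 2)) = (if R r = 0 then 1 else 0)" if "r < k" for r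
    using that by (simp add: ts_def s marked_def)
  have tests: "test_syms b (map read ts) = holds x b s" if "test_regs b \<subseteq> {..<k}" for b
  proof (cases b)
    case (Zero r)
    then have "map read ts ! (r + 2) = read (ts ! (r + 2))" using that len by simp
    then show ?thesis using rd[of r] that Zero by (simp add: s)
  next
    case (Sym g)
    have "map read ts ! 0 = read (ts ! 0)" using len by (subst nth_map) auto
    then show ?thesis using rd0 Sym by (simp add: s)
  qed
  have act_stay: "act (read p, Stay) p = p" for p :: tape by (cases p) auto
  show ?thesis
  proof (cases "P ! pc")
    case (Br b l l')
    have "map2 act (map (\<lambda>i. (map read ts ! i, Stay)) [0..<k + 2]) ts = ts"
      by (rule nth_equalityI) (auto simp: len act_stay simp del: upt_Suc)
    then show ?thesis
      using Br assms tests[of b] unfolding ts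
      by (auto simp: flow_tm_def s ts_def)
  next
    case (Op a)
    let ?new = "config_of k x (Suc pc, exec a s)"
    have "map2 act (map (\<lambda>i. ins_act a i (map read ts ! i)) [0..<k + 2]) ts = snd ?new"
    proof (rule nth_equalityI)
      show "length (map2 act (map (\<lambda>i. ins_act a i (map read ts ! i)) [0..<k + 2]) ts)
        = length (snd ?new)"
        using len by (cases a) (auto simp: s simp del: upt_Suc)
      fix i assume "i < length (map2 act (map (\<lambda>i. ins_act a i (map read ts ! i)) [0..<k + 2]) ts)"
      then have i: "i < k + 2" by (simp add: len del: upt_Suc)
      have L: "map2 act (map (\<lambda>i. ins_act a i (map read ts ! i)) [0..<k + 2]) ts ! i
        = act (ins_act a i (read (ts ! i))) (ts ! i)"
        using i len by (simp del: upt_Suc)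
      consider "i = 0" | "i = 1" | r where "i = r + 2" "r < k"
        using i by (metis One_nat_def add_2_eq_Suc' add_less_cancel_right not0_implies_Suc)
      then have "act (ins_act a i (read (ts ! i))) (ts ! i) = snd ?new ! i"
      proof cases
        case 1
        then show ?thesis by (cases a) (auto simp: ts_def s)
      next
        case 2
        then show ?thesis
          by (cases a) (auto simp: ts_def s tape_of_end tape_of_snoc fun_upd_idem_iff
            simp flip: tape_of_snoc)
      next
        case 3
        then show ?thesis
          by (cases a) (auto simp: ts_def s marked_def)
      qed
      then show "map2 act (map (\<lambda>i. ins_act a i (map read ts ! i)) [0..<k + 2]) ts ! i
        = snd ?new ! i" using L by simp
    qed
    moreover have "fst ?new = Suc (Suc pc)" by (cases a) (auto simp: s)
    ultimately have "step (flow_tm k P) (Suc pc, ts) = ?new"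
      using Op assms by (simp add: flow_tm_def prod_eq_iff del: upt_Suc)
    then show ?thesis using Op ts assms(1) by simp
  qed
qed


lemma polytime_computable_run:
  fixes p :: "nat poly"
  assumes "\<And>x. \<exists>t h R. t \<le> poly p (length x) \<and> run x c (0, \<lambda>_. 0, []) t (h, R, f x)"
  shows "polytime_computable f"
proof -
  define k where "k = Suc (Max (regs c))"
  have k: "regs c \<subseteq> {..<k}"
    using finite_regs by (auto simp: k_def less_Suc_eq_le)
  define P where "P = code 0 c"
  have P: "P = [] @ code (length ([] :: node list)) c @ []" by (simp add: P_def)
  have ok: "node_ok k (length P) a" if "a \<in> set P" for a
    using that k by (auto simp: P_def intro: code_ok)
  let ?M = "flow_tm k P"
  have sim: "pc \<le> length P \<Longrightarrow>
      (step ?M ^^ t) (config_of k x (pc, s)) = config_of k x ((fstep x P ^^ t) (pc, s))" for x t pc s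
  proof (induction t arbitrary: pc s)
    case 0
    then show ?case by simp
  next
    case (Suc t)
    obtain pc1 s1 where 1: "fstep x P (pc, s) = (pc1, s1)" by (cases "fstep x P (pc, s)")
    have "step ?M (config_of k x (pc, s)) = config_of k x (pc1, s1) \<and> pc1 \<le> length P"
    proof (cases "pc < length P")
      case True
      then have "node_ok k (length P) (P ! pc)" using ok by simp
      then show ?thesis using step_flow_tm[OF True, of k x s] 1 True
        by (cases "P ! pc") (auto split: if_splits)
    next
      case False
      then show ?thesis using 1 Suc.prems by (cases s) auto
    qed
    then show ?case using Suc.IH[of pc1 s1] 1
      by (simp add: funpow_swap1 del: fstep.simps step.simps config_of.simps)
  qed
  have start: "step ?M (start_config ?M x) = config_of k x (0, (0, \<lambda>_. 0, []))" for x
  proof -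
    have tapes: "map2 act (map (\<lambda>i. (if i < 2 then map read ts ! i else 1, Stay)) [0..<k + 2]) ts
        = (tape_of x, 0) # (tape_of [], 0) # map (\<lambda>_. (marked, 0)) [0..<k]" (is "_ = ?ts'")
      if ts: "ts = (tape_of x, 0) # replicate (Suc k) (tape_of [], 0)" for ts
    proof (rule nth_equalityI, goal_cases)
      case 1
      then show ?case by (simp add: ts del: upt_Suc)
    next
      case (2 i)
      then have i: "i < k + 2" by (simp del: upt_Suc)
      have blank: "(tape_of [])(0 := Suc 0) = marked" "(tape_of [])(0 := 0) = tape_of []"
        by (auto simp: tape_of_def marked_def)
      have "length ts = k + 2" by (simp add: ts)
      then have *: "map2 act (map (\<lambda>i. (if i < 2 then map read ts ! i else 1, Stay)) [0..<k + 2]) ts ! i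
        = act (if i < 2 then read (ts ! i) else 1, Stay) (ts ! i)"
        using i by (simp del: upt_Suc)
      consider "i = 0" | "i = 1" | r where "i = r + 2" "r < k"
        using i by (metis One_nat_def add_2_eq_Suc' add_less_cancel_right not0_implies_Suc)
      then show ?case unfolding *
      proof cases
        case 1
        then show "act (if i < 2 then read (ts ! i) else 1, Stay) (ts ! i) = ?ts' ! i"
          by (simp add: ts)
      next
        case 2
        then show "act (if i < 2 then read (ts ! i) else 1, Stay) (ts ! i) = ?ts' ! i"
          by (simp add: ts)
      next
        case 3
        then show "act (if i < 2 then read (ts ! i) else 1, Stay) (ts ! i) = ?ts' ! i"
          by (simp add: ts blank)
      qed
    qed
    define ts where "ts = (tape_of x, 0) # replicate (Suc k) (tape_of [], 0 :: int)"
    have "start_config ?M x = (0, ts)" by (simp add: start_config_def ts_def)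
    moreover have "step ?M (0, ts) = (1, (tape_of x, 0) # (tape_of [], 0) # map (\<lambda>_. (marked, 0)) [0..<k])"
      using tapes[OF ts_def] by (simp add: flow_tm_def del: upt_Suc)
    ultimately show ?thesis by simp
  qed
  \<comment> \<open>The additional step is the one in state 0 that writes the marks.\<close>
  have "computes_in_time ?M f (poly (p + [:1:]))"
    unfolding computes_in_time_def
  proof
    fix x
    obtain t h R where t: "t \<le> poly p (length x)" and run: "run x c (0, \<lambda>_. 0, []) t (h, R, f x)"
      using assms by blast
    have "(fstep x P ^^ t) (0, (0, \<lambda>_. 0, [])) = (length P, (h, R, f x))"
      using run_code[OF run P] by (simp add: P_def)
    then have "(step ?M ^^ t) (config_of k x (0, (0, \<lambda>_. 0, []))) = config_of k x (length P, (h, R, f x))"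
      using sim[of 0 t x "(0, \<lambda>_. 0, [])"] by simp
    then have "(step ?M ^^ Suc t) (start_config ?M x) = config_of k x (length P, (h, R, f x))"
      by (simp add: funpow_swap1 start del: step.simps config_of.simps)
    then have "(step ?M ^^ Suc t) (start_config ?M x) = (nstates ?M,
        snd (config_of k x (length P, (h, R, f x))))"
      "fst (snd (config_of k x (length P, (h, R, f x))) ! 1) = tape_of (f x)" by simp_all
    moreover have "Suc t \<le> poly (p + [:1:]) (length x)" using t by simp
    ultimately show "\<exists>t\<le>poly (p + [:1:]) (length x). \<exists>ts.
      (step ?M ^^ t) (start_config ?M x) = (nstates ?M, ts) \<and> fst (ts ! 1) = tape_of (f x)"
      by blast
  qed
  then show ?thesis
    using turing_machine_flow_tm ok unfolding polytime_computable_def by blast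
qed

subsection \<open>Loops\<close>

definition runs :: "bool list \<Rightarrow> com \<Rightarrow> store \<Rightarrow> nat \<Rightarrow> store \<Rightarrow> bool" where
  "runs x c s b s' \<longleftrightarrow> (\<exists>t \<le> b. run x c s t s')"

lemma runs_mono: "runs x c s b s' \<Longrightarrow> b \<le> b' \<Longrightarrow> runs x c s b' s'"
  unfolding runs_def by (meson le_trans)

lemma runs_Do: "exec a s = s' \<Longrightarrow> runs x (Do a) s 1 s'"
  unfolding runs_def using run.Do by blast

lemma runs_Seq: "runs x c s b s' \<Longrightarrow> runs x c' s' b' s'' \<Longrightarrow> runs x (Seq c c') s (b + b') s''"
  unfolding runs_def by (meson add_le_mono run.Seq)

lemma runs_If:
  "(holds x b s \<Longrightarrow> runs x c s t s') \<Longrightarrow> (\<not> holds x b s \<Longrightarrow> runs x c' s t s') \<Longrightarrow>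
    runs x (If b c c') s (t + 2) s'"
  unfolding runs_def using run.IfT[of x b s c _ s' c'] run.IfF[of x b s c' _ s' c]
  by (metis add_le_mono1 add_le_mono le_numeral_extra(4) one_le_numeral)

text \<open>The sequence \<open>S\<close> of states at the loop head plays the role of an invariant;
  the induction is on the number of rounds still to come.\<close>

lemma runs_Until:
  assumes "\<And>k. k < n \<Longrightarrow> \<not> holds x b (S k)" "holds x b (S n)"
    and "\<And>k. k < n \<Longrightarrow> runs x c (S k) t (S (Suc k))"
  shows "runs x (Until b c) (S 0) (n * (t + 2) + 1) (S n)"
proof -
  have "j \<le> n \<Longrightarrow> runs x (Until b c) (S (n - j)) (j * (t + 2) + 1) (S n)" for j
  proof (induction j)
    case 0
    then show ?case using run.UntilT[OF assms(2)] by (auto simp: runs_def)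
  next
    case (Suc j)
    then obtain t1 where t1: "t1 \<le> j * (t + 2) + 1" "run x (Until b c) (S (n - j)) t1 (S n)"
      by (auto simp: runs_def)
    have "Suc (n - Suc j) = n - j" "n - Suc j < n" using Suc.prems by simp_all
    then obtain t2 where t2: "t2 \<le> t" "run x c (S (n - Suc j)) t2 (S (n - j))"
      using assms(3)[of "n - Suc j"] by (auto simp: runs_def)
    have "run x (Until b c) (S (n - Suc j)) (t2 + t1 + 2) (S n)"
      using assms(1) Suc.prems by (intro run.UntilF[OF _ t2(2) t1(2)]) simp
    moreover have "t2 + t1 + 2 \<le> Suc j * (t + 2) + 1" using t1(1) t2(1) by simp
    ultimately show ?case unfolding runs_def by blast
  qed
  from this[of n] show ?thesis by simp
qed

definition drain :: "nat \<Rightarrow> com \<Rightarrow> com" where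
  "drain r c = Until (Zero r) (Seq (Do (Dec r)) c)"

lemma runs_drain:
  assumes "\<And>k. k \<le> n \<Longrightarrow> R k r = n - k"
    and "\<And>k. k < n \<Longrightarrow> runs x c (h k, (R k)(r := n - Suc k), out k) t (h (Suc k), R (Suc k), out (Suc k))"
    and "s = (h 0, R 0, out 0)" "s' = (h n, R n, out n)"
  shows "runs x (drain r c) s (n * (t + 3) + 1) s'"
proof -
  have "runs x (Until (Zero r) (Seq (Do (Dec r)) c)) (h 0, R 0, out 0) (n * (1 + t + 2) + 1) (h n, R n, out n)"
  proof (rule runs_Until[where S = "\<lambda>k. (h k, R k, out k)"], goal_cases)
    case (3 k)
    then have "exec (Dec r) (h k, R k, out k) = (h k, (R k)(r := n - Suc k), out k)"
      using assms(1)[of k] by (simp add: fun_upd_def)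
    from runs_Seq[OF runs_Do[OF this] assms(2)[OF 3]] show ?case by simp
  qed (use assms(1) in auto)
  then show ?thesis unfolding drain_def assms(3,4) by (rule runs_mono) (simp add: algebra_simps)
qed

text \<open>There is no empty program, so a program without effect is written as an
  \<open>Inc\<close> followed by a \<open>Dec\<close> of the same register.\<close>

fun block :: "ins list \<Rightarrow> com" where
  "block [a] = Do a"
| "block (a # as) = Seq (Do a) (block as)"

lemma runs_block: "as \<noteq> [] \<Longrightarrow> runs x (block as) s (length as) (fold exec as s)"
proof (induction as arbitrary: s rule: block.induct)
  case (2 a b as)
  then show ?case using runs_Seq[OF runs_Do[OF refl] "2.IH", of a s] by simp
qed (use runs_Do in auto)

lemma runs_blockI:
  "as \<noteq> [] \<Longrightarrow> fold exec as s = s' \<Longrightarrow> length as \<le> n \<Longrightarrow> runs x (block as) s n s'"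
  using runs_block runs_mono by blast

section \<open>Arithmetic expressions\<close>

datatype exp = Var nat | Const nat | Len | Bit exp | Add exp exp | Sub exp exp | Sum exp exp

text \<open>Variables are de Bruijn indices; \<open>Sum e e'\<close> binds a variable that runs below \<open>e\<close>.\<close>

fun val :: "bool list \<Rightarrow> (nat \<Rightarrow> nat) \<Rightarrow> exp \<Rightarrow> nat" where
  "val x v (Var i) = v i"
| "val x v (Const n) = n"
| "val x v Len = length x"
| "val x v (Bit e) = tape_of x (int (val x v e))"
| "val x v (Add e e') = val x v e + val x v e'"
| "val x v (Sub e e') = val x v e - val x v e'"
| "val x v (Sum e e') = (\<Sum>i < val x v e. val x (case_nat i v) e')"

text \<open>\<open>comp rs d e\<close> leaves the value of \<open>e\<close> in register \<open>d\<close>, where the registers from \<open>d\<close> on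
  are initially 0 and \<open>rs\<close> lists the registers of the variables.\<close>

fun comp :: "nat list \<Rightarrow> nat \<Rightarrow> exp \<Rightarrow> com" where
  "comp rs d (Var i) = (if i < length rs
     then Seq (drain (rs ! i) (block [Inc d, Inc (d + 1)])) (drain (d + 1) (block [Inc (rs ! i)]))
     else block [Inc d, Dec d])"
| "comp rs d (Const n) = block (replicate n (Inc d) @ [Inc d, Dec d])"
| "comp rs d Len = Seq (Until (Sym 0) (block [Inc d, Inc (d + 1), HeadR])) (drain (d + 1) (block [HeadL]))"
| "comp rs d (Bit e) = Seq (comp rs (d + 1) e) (Seq (drain (d + 1) (block [Inc (d + 2), HeadR]))
     (Seq (If (Sym 1) (block [Inc d]) (If (Sym 2) (block [Inc d, Inc d]) (block [Inc d, Dec d])))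
       (drain (d + 2) (block [HeadL]))))"
| "comp rs d (Add e e') = Seq (comp rs d e) (Seq (comp rs (d + 1) e') (drain (d + 1) (block [Inc d])))"
| "comp rs d (Sub e e') = Seq (comp rs d e) (Seq (comp rs (d + 1) e') (drain (d + 1) (block [Dec d])))"
| "comp rs d (Sum e e') = Seq (comp rs (d + 1) e) (Seq (drain (d + 1)
     (Seq (comp ((d + 2) # rs) (d + 3) e') (Seq (drain (d + 3) (block [Inc d])) (block [Inc (d + 2)]))))
     (drain (d + 2) (block [Inc d, Dec d])))"

text \<open>As the base is at least 2, sums and constant factors are absorbed by a larger exponent,
  which gives closure under all operations and under composition.\<close>

definition polybounded :: "(nat \<Rightarrow> nat) \<Rightarrow> bool" where
  "polybounded f \<longleftrightarrow> (\<exists>c. \<forall>n. f n \<le> (n + 2) ^ c)"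

lemma polybounded_mono: "polybounded f \<Longrightarrow> (\<And>n. g n \<le> f n) \<Longrightarrow> polybounded g"
  unfolding polybounded_def by (meson le_trans)

lemma polybounded_id: "polybounded (\<lambda>n. n)"
  unfolding polybounded_def by (intro exI[of _ 1]) simp

lemma polybounded_const: "polybounded (\<lambda>n. k)"
proof -
  have "k \<le> (n + 2) ^ k" for n
    by (metis less_exp less_imp_le_nat order_trans le_add2 power_mono zero_le_numeral)
  then show ?thesis unfolding polybounded_def by blast
qed

lemma polybounded_mult:
  assumes "polybounded f" "polybounded g"
  shows "polybounded (\<lambda>n. f n * g n)"
proof -
  obtain a b where "\<And>n. f n \<le> (n + 2) ^ a" "\<And>n. g n \<le> (n + 2) ^ b"
    using assms unfolding polybounded_def by blast
  then have "f n * g n \<le> (n + 2) ^ (a + b)" for n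
    by (simp add: power_add mult_le_mono)
  then show ?thesis unfolding polybounded_def by blast
qed

lemma polybounded_add:
  assumes "polybounded f" "polybounded g"
  shows "polybounded (\<lambda>n. f n + g n)"
proof -
  obtain a b where ab: "\<And>n. f n \<le> (n + 2) ^ a" "\<And>n. g n \<le> (n + 2) ^ b"
    using assms unfolding polybounded_def by blast
  have "f n + g n \<le> (n + 2) ^ (a + b + 1)" for n
  proof -
    have "f n \<le> (n + 2) ^ (a + b)" using ab(1)[of n] by (rule order_trans) (simp add: power_increasing)
    moreover have "g n \<le> (n + 2) ^ (a + b)" using ab(2)[of n] by (rule order_trans) (simp add: power_increasing)
    ultimately have "f n + g n \<le> 2 * (n + 2) ^ (a + b)" by simp
    also have "\<dots> \<le> (n + 2) ^ (a + b + 1)" by simp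
    finally show ?thesis .
  qed
  then show ?thesis unfolding polybounded_def by blast
qed

lemma polybounded_power: "polybounded f \<Longrightarrow> polybounded (\<lambda>n. f n ^ c)"
  by (induction c) (auto intro: polybounded_const polybounded_mult)

lemma polybounded_compose:
  assumes "polybounded f" "polybounded g"
  shows "polybounded (\<lambda>n. f (g n))"
proof -
  obtain a where "\<And>n. f n \<le> (n + 2) ^ a" using assms(1) unfolding polybounded_def by blast
  moreover have "polybounded (\<lambda>n. (g n + 2) ^ a)"
    by (intro polybounded_power polybounded_add assms polybounded_const)
  ultimately show ?thesis by (rule_tac polybounded_mono)
qed

section \<open>Correctness and cost of compiled expressions\<close>

definition env :: "nat list \<Rightarrow> (nat \<Rightarrow> nat) \<Rightarrow> nat \<Rightarrow> nat" where
  "env rs R i = (if i < length rs then R (rs ! i) else 0)"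

text \<open>A single function bounds value and running time, because the value of one expression is
  the number of rounds of a loop in another. The number \<open>n\<close> bounds the input length and
  the values of the variables. The final store differs from the initial one in register
  \<open>d\<close> only, so compiled expressions can be nested freely.\<close>

definition comp_ok :: "exp \<Rightarrow> (nat \<Rightarrow> nat) \<Rightarrow> bool" where
  "comp_ok e f \<longleftrightarrow> (\<forall>x rs d R out n.
     (\<forall>r \<in> set rs. r < d \<and> R r \<le> n) \<longrightarrow> (\<forall>r \<ge> d. R r = 0) \<longrightarrow> length x \<le> n \<longrightarrow>
     val x (env rs R) e \<le> f n \<and>
     runs x (comp rs d e) (0, R, out) (f n) (0, R(d := val x (env rs R) e), out))"

lemma comp_okI:
  assumes "\<And>x rs d R out n. \<lbrakk>\<forall>r \<in> set rs. r < d \<and> R r \<le> n; \<forall>r \<ge> d. R r = 0; length x \<le> n\<rbrakk> \<Longrightarrow>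
     val x (env rs R) e \<le> f n \<and>
     runs x (comp rs d e) (0, R, out) (g n) (0, R(d := val x (env rs R) e), out)"
  shows "comp_ok e (\<lambda>n. f n + g n)"
  unfolding comp_ok_def
proof (intro allI impI, goal_cases)
  case (1 x rs d R out n)
  from assms[OF this, of out] show ?case by (auto elim: runs_mono)
qed

lemma comp_okD:
  assumes "comp_ok e f" "\<forall>r \<in> set rs. r < d \<and> R r \<le> n" "\<forall>r \<ge> d. R r = 0" "length x \<le> n"
  shows "val x (env rs R) e \<le> f n"
    "runs x (comp rs d e) (0, R, out) (f n) (0, R(d := val x (env rs R) e), out)"
  using assms unfolding comp_ok_def by blast+

lemma runs_drain_block:
  assumes "as \<noteq> []" "\<And>k. k \<le> n \<Longrightarrow> R k r = n - k"
    and "\<And>k. k < n \<Longrightarrow> fold exec as (h k, (R k)(r := n - Suc k), out) = (h (Suc k), R (Suc k), out)"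
    and "s = (h 0, R 0, out)" "s' = (h n, R n, out)"
  shows "runs x (drain r (block as)) s (n * (length as + 3) + 1) s'"
proof (rule runs_drain[where h = h and R = R and out = "\<lambda>_. out", OF assms(2) _ assms(4,5)])
  fix k assume "k < n"
  from runs_block[OF assms(1), of x "(h k, (R k)(r := n - Suc k), out)"] assms(3)[OF this]
  show "runs x (block as) (h k, (R k)(r := n - Suc k), out) (length as) (h (Suc k), R (Suc k), out)"
    by simp
qed

text \<open>A register can be read only by emptying it. Its value goes to \<open>d\<close> and to a
  spare copy in \<open>d + 1\<close>, from which the register is refilled.\<close>

lemma comp_ok_Var: "comp_ok (Var i) (\<lambda>n. n + (n * 5 + 1 + (n * 4 + 1) + 2))"
proof (rule comp_okI, goal_cases)
  case in0: (1 x rs d R out n)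
  show ?case
  proof (cases "i < length rs")
    case False
    have "fold exec [Inc d, Dec d] (0, R, out) = (0, R(d := 0), out)" using in0 by (auto simp: fun_eq_iff)
    then have "runs x (block [Inc d, Dec d]) (0, R, out) 2 (0, R(d := 0), out)"
      by (rule runs_blockI[rotated]) simp_all
    then have "runs x (comp rs d (Var i)) (0, R, out) 2 (0, R(d := 0), out)"
      using False by simp
    from runs_mono[OF this, of "n * 5 + 1 + (n * 4 + 1) + 2"] show ?thesis
      using False by (simp add: env_def)
  next
    case True
    define r where "r = rs ! i"
    have r: "r < d" "R r \<le> n" using in0 True by (simp_all add: r_def)
    have 1: "runs x (drain r (block [Inc d, Inc (d + 1)])) (0, R, out) (R r * 5 + 1)
        (0, R(d := R r, d + 1 := R r, r := 0), out)"
      by (rule runs_drain_block[where n = "R r" and h = "\<lambda>_. 0"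
            and R = "\<lambda>k. R(d := k, d + 1 := k, r := R r - k)", THEN runs_mono])
        (use r in0 in \<open>auto simp: fun_eq_iff\<close>)
    have 2: "runs x (drain (d + 1) (block [Inc r]))
        (0, R(d := R r, d + 1 := R r, r := 0), out) (R r * 4 + 1) (0, R(d := R r), out)"
      by (rule runs_drain_block[where n = "R r" and h = "\<lambda>_. 0"
            and R = "\<lambda>k. R(d := R r, d + 1 := R r - k, r := k)", THEN runs_mono])
        (use r in0 in \<open>auto simp: fun_eq_iff\<close>)
    have "runs x (comp rs d (Var i)) (0, R, out) (R r * 5 + 1 + (R r * 4 + 1)) (0, R(d := R r), out)"
      using runs_Seq[OF 1 2] True by (simp add: r_def)
    from runs_mono[OF this, of "n * 5 + 1 + (n * 4 + 1) + 2"] show ?thesis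
      using r(2) True by (simp add: env_def r_def)
  qed
qed

lemma comp_ok_Const: "comp_ok (Const k) (\<lambda>n. k + (k + 2))"
proof (rule comp_okI, goal_cases)
  case (1 x rs d R out n)
  have "fold exec (replicate j (Inc d)) (0, S, out) = (0, S(d := S d + j), out)" for j S
    by (induction j arbitrary: S) auto
  then have "fold exec (replicate k (Inc d) @ [Inc d, Dec d]) (0, R, out) = (0, R(d := k), out)"
    using 1 by simp
  then show ?case
    using runs_block[of "replicate k (Inc d) @ [Inc d, Dec d]" x "(0, R, out)"] by simp
qed

lemma comp_ok_Len: "comp_ok Len (\<lambda>n. n + (n * 5 + 1 + (n * 4 + 1)))"
proof (rule comp_okI, goal_cases)
  case in0: (1 x rs d R out n)
  let ?l = "length x"
  \<comment> \<open>Bits are stored as 1 and 2, so the first 0 that the head meets is at position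
    \<open>length x\<close>.\<close>
  have 1: "runs x (Until (Sym 0) (block [Inc d, Inc (d + 1), HeadR])) (int 0, R(d := 0, d + 1 := 0), out)
      (?l * (3 + 2) + 1) (int ?l, R(d := ?l, d + 1 := ?l), out)"
  proof (rule runs_Until[where S = "\<lambda>k. (int k, R(d := k, d + 1 := k), out)"], goal_cases)
    case (3 k)
    have "fold exec [Inc d, Inc (d + 1), HeadR] (int k, R(d := k, d + 1 := k), out)
      = (int (Suc k), R(d := Suc k, d + 1 := Suc k), out)" by (auto simp: fun_eq_iff)
    then show ?case by (rule runs_blockI[rotated]) simp_all
  qed (auto simp: tape_of_def)
  have R0: "R(d := 0, d + 1 := 0) = R" using in0 by auto
  have 2: "runs x (drain (d + 1) (block [HeadL])) (int ?l, R(d := ?l, d + 1 := ?l), out)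
     (?l * 4 + 1) (0, R(d := ?l), out)"
    by (rule runs_drain_block[where n = ?l and h = "\<lambda>k. int ?l - int k"
            and R = "\<lambda>k. R(d := ?l, d + 1 := ?l - k)", THEN runs_mono])
        (use in0 in \<open>auto simp: fun_eq_iff\<close>)
  have "runs x (comp rs d Len) (0, R, out) (?l * (3 + 2) + 1 + (?l * 4 + 1)) (0, R(d := ?l), out)"
    using runs_Seq[OF 1 2] unfolding R0 by simp
  from runs_mono[OF this, of "n * 5 + 1 + (n * 4 + 1)"] show ?case using in0 by simp
qed

lemma env_upd:
  assumes "\<forall>r \<in> set rs. r < d" "d \<le> d'"
  shows "env rs (R(d' := k)) = env rs R"
proof
  fix i
  show "env rs (R(d' := k)) i = env rs R i"
    using assms nth_mem[of i rs] by (fastforce simp: env_def)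
qed

lemma comp_ok_Add:
  assumes "comp_ok e f" "comp_ok e' g"
  shows "comp_ok (Add e e') (\<lambda>n. (f n + g n) + (f n + (g n + (g n * 4 + 1))))"
proof (rule comp_okI, goal_cases)
  case in0: (1 x rs d R out n)
  let ?a = "val x (env rs R) e" and ?b = "val x (env rs R) e'"
  note 1 = comp_okD[OF assms(1) in0]
  have env: "env rs (R(d := ?a)) = env rs R" using in0 by (intro env_upd) auto
  have "\<forall>r\<in>set rs. r < d + 1 \<and> (R(d := ?a)) r \<le> n" "\<forall>r\<ge>d + 1. (R(d := ?a)) r = 0"
    using in0 by (auto simp: less_Suc_eq)
  note 2 = comp_okD[OF assms(2) this in0(3), unfolded env]
  have 3: "runs x (drain (d + 1) (block [Inc d])) (0, R(d := ?a, d + 1 := ?b), out) (g n * 4 + 1)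
      (0, R(d := ?a + ?b), out)"
    by (rule runs_drain_block[where n = ?b and h = "\<lambda>_. 0"
          and R = "\<lambda>k. R(d := ?a + k, d + 1 := ?b - k)", THEN runs_mono])
      (use in0 2(1) in \<open>auto simp: fun_eq_iff\<close>)
  show ?case using runs_Seq[OF 1(2) runs_Seq[OF 2(2) 3]] 1(1) 2(1) by simp
qed

lemma comp_ok_Sub:
  assumes "comp_ok e f" "comp_ok e' g"
  shows "comp_ok (Sub e e') (\<lambda>n. (f n + g n) + (f n + (g n + (g n * 4 + 1))))"
proof (rule comp_okI, goal_cases)
  case in0: (1 x rs d R out n)
  let ?a = "val x (env rs R) e" and ?b = "val x (env rs R) e'"
  note 1 = comp_okD[OF assms(1) in0]
  have env: "env rs (R(d := ?a)) = env rs R" using in0 by (intro env_upd) auto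
  have "\<forall>r\<in>set rs. r < d + 1 \<and> (R(d := ?a)) r \<le> n" "\<forall>r\<ge>d + 1. (R(d := ?a)) r = 0"
    using in0 by (auto simp: less_Suc_eq)
  note 2 = comp_okD[OF assms(2) this in0(3), unfolded env]
  have 3: "runs x (drain (d + 1) (block [Dec d])) (0, R(d := ?a, d + 1 := ?b), out) (g n * 4 + 1)
      (0, R(d := ?a - ?b), out)"
    by (rule runs_drain_block[where n = ?b and h = "\<lambda>_. 0"
          and R = "\<lambda>k. R(d := ?a - k, d + 1 := ?b - k)", THEN runs_mono])
      (use in0 2(1) in \<open>auto simp: fun_eq_iff\<close>)
  show ?case using runs_Seq[OF 1(2) runs_Seq[OF 2(2) 3]] 1(1) 2(1) by simp
qed

lemma tape_of_le_2: "tape_of x i \<le> 2"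
  by (simp add: tape_of_def)

text \<open>While the head walks to the addressed cell, register \<open>d + 2\<close> records the
  distance, so that the head can return to position 0 after the symbol has been copied into
  \<open>d\<close>.\<close>

lemma comp_ok_Bit:
  assumes "comp_ok e f"
  shows "comp_ok (Bit e) (\<lambda>n. 2 + (f n + ((f n * 5 + 1) + (6 + (f n * 4 + 1)))))"
proof (rule comp_okI, goal_cases)
  case in0: (1 x rs d R out n)
  let ?a = "val x (env rs R) e"
  have "\<forall>r\<in>set rs. r < d + 1 \<and> R r \<le> n" "\<forall>r\<ge>d + 1. R r = 0"
    using in0 by (auto simp: less_Suc_eq)
  note 1 = comp_okD[OF assms this in0(3)]
  have 2: "runs x (drain (d + 1) (block [Inc (d + 2), HeadR])) (0, R(d + 1 := ?a), out) (f n * 5 + 1)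
      (int ?a, R(d + 2 := ?a), out)"
    by (rule runs_drain_block[where n = ?a and h = int
          and R = "\<lambda>k. R(d + 1 := ?a - k, d + 2 := k)", THEN runs_mono])
      (use in0 1(1) in \<open>auto simp: fun_eq_iff\<close>)
  let ?t = "tape_of x (int ?a)"
  have 3: "runs x (If (Sym 1) (block [Inc d]) (If (Sym 2) (block [Inc d, Inc d]) (block [Inc d, Dec d])))
      (int ?a, R(d + 2 := ?a), out) 6 (int ?a, R(d := ?t, d + 2 := ?a), out)"
  proof -
    have "runs x (block [Inc d]) (int ?a, R(d + 2 := ?a), out) 4 (int ?a, R(d := ?t, d + 2 := ?a), out)"
      if "?t = 1" using that in0 by (intro runs_blockI) (auto simp: fun_eq_iff)
    moreover have "runs x (block [Inc d, Inc d]) (int ?a, R(d + 2 := ?a), out) 2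
        (int ?a, R(d := ?t, d + 2 := ?a), out)"
      if "?t = 2" using that in0 by (intro runs_blockI) (auto simp: fun_eq_iff)
    moreover have "runs x (block [Inc d, Dec d]) (int ?a, R(d + 2 := ?a), out) 2
        (int ?a, R(d := ?t, d + 2 := ?a), out)"
      if "?t = 0" using that in0 by (intro runs_blockI) (auto simp: fun_eq_iff)
    moreover have "?t = 0 \<or> ?t = 1 \<or> ?t = 2" by (simp add: tape_of_def)
    ultimately have "runs x (If (Sym 1) (block [Inc d]) (If (Sym 2) (block [Inc d, Inc d]) (block [Inc d, Dec d])))
        (int ?a, R(d + 2 := ?a), out) (2 + 2 + 2) (int ?a, R(d := ?t, d + 2 := ?a), out)"
      by (intro runs_If) auto
    then show ?thesis by simp
  qed
  have 4: "runs x (drain (d + 2) (block [HeadL])) (int ?a, R(d := ?t, d + 2 := ?a), out) (f n * 4 + 1)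
      (0, R(d := ?t), out)"
    by (rule runs_drain_block[where n = ?a and h = "\<lambda>k. int (?a - k)"
          and R = "\<lambda>k. R(d := ?t, d + 2 := ?a - k)", THEN runs_mono])
      (use in0 1(1) in \<open>auto simp: fun_eq_iff\<close>)
  show ?case using runs_Seq[OF 1(2) runs_Seq[OF 2 runs_Seq[OF 3 4]]] tape_of_le_2 by simp
qed

lemma env_Cons: "env (r # rs) R = case_nat (R r) (env rs R)"
  by (rule ext) (simp add: env_def split: nat.split)

text \<open>Register \<open>d\<close> accumulates the sum, \<open>d + 1\<close> counts the remaining
  rounds, \<open>d + 2\<close> is the bound variable and \<open>d + 3\<close> holds a summand. The
  bound variable may be as large as \<open>f n\<close>, so the body is charged at size
  \<open>n + f n\<close>. Bounds are thus composed, which keeps them polynomial because the nesting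
  depth of an expression is fixed.\<close>

lemma comp_ok_Sum:
  assumes "comp_ok e f" "comp_ok e' g"
  shows "comp_ok (Sum e e') (\<lambda>n. f n * g (n + f n) +
    (f n + ((f n * ((g (n + f n) + ((g (n + f n) * 4 + 1) + 1)) + 3) + 1) + (f n * 5 + 1))))"
proof (rule comp_okI, goal_cases)
  case in0: (1 x rs d R out n)
  let ?b = "val x (env rs R) e"
  let ?s = "\<lambda>k. val x (case_nat k (env rs R)) e'"
  let ?S = "\<lambda>k. \<Sum>i<k. ?s i"
  have "\<forall>r\<in>set rs. r < d + 1 \<and> R r \<le> n" "\<forall>r\<ge>d + 1. R r = 0"
    using in0 by (auto simp: less_Suc_eq)
  note 1 = comp_okD[OF assms(1) this in0(3)]
  let ?R = "\<lambda>k. R(d := ?S k, d + 1 := ?b - k, d + 2 := k)"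
  have body: "?s k \<le> g (n + f n) \<and>
      runs x (Seq (comp ((d + 2) # rs) (d + 3) e') (Seq (drain (d + 3) (block [Inc d])) (block [Inc (d + 2)])))
      (0, (?R k)(d + 1 := ?b - Suc k), out)
      (g (n + f n) + ((g (n + f n) * 4 + 1) + 1)) (0, ?R (Suc k), out)" if k: "k < ?b" for k
  proof -
    let ?Q = "(?R k)(d + 1 := ?b - Suc k)"
    have rs: "\<forall>r \<in> set rs. r < d" using in0 by blast
    have "env rs ?Q = env rs R" by (simp add: env_upd[OF rs])
    then have env: "env ((d + 2) # rs) ?Q = case_nat k (env rs R)" by (simp add: env_Cons)
    have "\<forall>r\<in>set ((d + 2) # rs). r < d + 3 \<and> ?Q r \<le> n + f n" "\<forall>r\<ge>d + 3. ?Q r = 0" "length x \<le> n + f n"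
      using in0 k 1(1) by (auto simp: less_Suc_eq trans_le_add1)
    note 2 = comp_okD[OF assms(2) this, unfolded env]
    have 3: "runs x (drain (d + 3) (block [Inc d])) (0, ?Q(d + 3 := ?s k), out) (g (n + f n) * 4 + 1)
        (0, ?Q(d := ?S k + ?s k), out)"
      by (rule runs_drain_block[where n = "?s k" and h = "\<lambda>_. 0"
          and R = "\<lambda>j. ?Q(d := ?S k + j, d + 3 := ?s k - j)", THEN runs_mono])
        (use in0 2(1) in \<open>auto simp: fun_eq_iff\<close>)
    have 4: "runs x (block [Inc (d + 2)]) (0, ?Q(d := ?S k + ?s k), out) 1 (0, ?R (Suc k), out)"
      by (rule runs_blockI) (auto simp: fun_eq_iff)
    show ?thesis using runs_Seq[OF 2(2) runs_Seq[OF 3 4]] 2(1) by blast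
  qed
  have "runs x (drain (d + 1) (Seq (comp ((d + 2) # rs) (d + 3) e')
        (Seq (drain (d + 3) (block [Inc d])) (block [Inc (d + 2)]))))
      (0, R(d + 1 := ?b), out) (?b * ((g (n + f n) + ((g (n + f n) * 4 + 1) + 1)) + 3) + 1) (0, ?R ?b, out)"
    by (rule runs_drain[where n = ?b and h = "\<lambda>_. 0" and R = ?R and out = "\<lambda>_. out",
          OF _ body[THEN conjunct2]])
      (use in0 in \<open>auto simp: fun_eq_iff\<close>)
  moreover have "?b * ((g (n + f n) + ((g (n + f n) * 4 + 1) + 1)) + 3) + 1
     \<le> f n * ((g (n + f n) + ((g (n + f n) * 4 + 1) + 1)) + 3) + 1"
    using 1(1) by (intro add_mono mult_le_mono) auto
  ultimately have 2: "runs x (drain (d + 1) (Seq (comp ((d + 2) # rs) (d + 3) e')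
        (Seq (drain (d + 3) (block [Inc d])) (block [Inc (d + 2)]))))
      (0, R(d + 1 := ?b), out) (f n * ((g (n + f n) + ((g (n + f n) * 4 + 1) + 1)) + 3) + 1) (0, ?R ?b, out)"
    by (rule runs_mono)
  have 3: "runs x (drain (d + 2) (block [Inc d, Dec d])) (0, ?R ?b, out) (f n * 5 + 1) (0, R(d := ?S ?b), out)"
    by (rule runs_drain_block[where n = ?b and h = "\<lambda>_. 0"
          and R = "\<lambda>k. R(d := ?S ?b, d + 2 := ?b - k)", THEN runs_mono])
      (use in0 1(1) in \<open>auto simp: fun_eq_iff\<close>)
  have "?S ?b \<le> ?b * g (n + f n)"
    using sum_bounded_above[of "{..<?b}" ?s "g (n + f n)"] body by simp
  also have "\<dots> \<le> f n * g (n + f n)" using 1(1) by simp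
  finally have "?S ?b \<le> f n * g (n + f n)" .
  then show ?case using runs_Seq[OF 1(2) runs_Seq[OF 2 3]] by simp
qed

lemma comp_ok_polybounded: "\<exists>f. polybounded f \<and> comp_ok e f"
proof (induction e)
  case (Var i)
  show ?case by (rule exI, rule conjI[OF _ comp_ok_Var])
    (intro polybounded_add polybounded_mult polybounded_const polybounded_id)
next
  case (Const k)
  show ?case by (rule exI, rule conjI[OF _ comp_ok_Const])
    (intro polybounded_add polybounded_mult polybounded_const polybounded_id)
next
  case Len
  show ?case by (rule exI, rule conjI[OF _ comp_ok_Len])
    (intro polybounded_add polybounded_mult polybounded_const polybounded_id)
next
  case (Bit e)
  then obtain f where f: "polybounded f" "comp_ok e f" by blast
  show ?case by (rule exI, rule conjI[OF _ comp_ok_Bit[OF f(2)]])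
    (intro polybounded_add polybounded_mult polybounded_const f)
next
  case (Add e e')
  then obtain f g where fg: "polybounded f" "comp_ok e f" "polybounded g" "comp_ok e' g" by blast
  show ?case by (rule exI, rule conjI[OF _ comp_ok_Add[OF fg(2,4)]])
    (intro polybounded_add polybounded_mult polybounded_const fg)
next
  case (Sub e e')
  then obtain f g where fg: "polybounded f" "comp_ok e f" "polybounded g" "comp_ok e' g" by blast
  show ?case by (rule exI, rule conjI[OF _ comp_ok_Sub[OF fg(2,4)]])
    (intro polybounded_add polybounded_mult polybounded_const fg)
next
  case (Sum e e')
  then obtain f g where fg: "polybounded f" "comp_ok e f" "polybounded g" "comp_ok e' g" by blast
  have "polybounded (\<lambda>n. g (n + f n))"
    by (intro polybounded_compose[OF fg(3)] polybounded_add polybounded_id fg)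
  then show ?case by - (rule exI, rule conjI[OF _ comp_ok_Sum[OF fg(2,4)]],
    intro polybounded_add polybounded_mult polybounded_const fg)
qed

theorem polytime_computable_exp:
  "polytime_computable (\<lambda>x. map (\<lambda>k. val x (case_nat k (\<lambda>_. 0)) b \<noteq> 0) [0..<val x (\<lambda>_. 0) l])"
proof -
  obtain f where f: "polybounded f" "comp_ok l f" using comp_ok_polybounded by blast
  obtain g where g: "polybounded g" "comp_ok b g" using comp_ok_polybounded by blast
  \<comment> \<open>Register 0 counts the bits still to be written, register 1 is the index of the
    current bit and register 2 its value, which is drained to 0 after each round.\<close>
  let ?w = "If (Zero 2) (Do (Out False)) (Do (Out True))"
  let ?body = "Seq (comp [1] 2 b) (Seq ?w (Seq (drain 2 (block [Inc 3, Dec 3])) (block [Inc 1])))"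
  let ?c = "Seq (comp [] 0 l) (drain 0 ?body)"
  let ?tb = "\<lambda>n. g (n + f n) + (3 + ((g (n + f n) * 5 + 1) + 1))"
  let ?t = "\<lambda>n. f n + (f n * (?tb n + 3) + 1)"
  have "polybounded (\<lambda>n. g (n + f n))"
    by (intro polybounded_compose[OF g(1)] polybounded_add polybounded_id f)
  then have "polybounded ?t"
    by (intro polybounded_add polybounded_mult polybounded_const f)
  then obtain a where a: "\<And>n. ?t n \<le> (n + 2) ^ a" unfolding polybounded_def by blast
  show ?thesis
  proof (rule polytime_computable_run[where c = ?c and p = "[:2, 1:] ^ a"])
    fix x :: "bool list"
    let ?n = "length x"
    let ?l = "val x (\<lambda>_. 0) l" and ?b = "\<lambda>k. val x (case_nat k (\<lambda>_. 0)) b"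
    let ?o = "\<lambda>k. map (\<lambda>i. ?b i \<noteq> 0) [0..<k]"
    let ?R = "\<lambda>k. (\<lambda>_ :: nat. 0 :: nat)(0 := ?l - k, 1 := k)"
    have env0: "env [] R = (\<lambda>_. 0)" for R by (rule ext) (simp add: env_def)
    note 1 = comp_okD[OF f(2), of "[]" 0 "\<lambda>_. 0" ?n x, unfolded env0, simplified]
    have body: "runs x ?body (0, (?R k)(0 := ?l - Suc k), ?o k) (?tb ?n) (0, ?R (Suc k), ?o (Suc k))"
      if k: "k < ?l" for k
    proof -
      let ?Q = "(?R k)(0 := ?l - Suc k)"
      have env: "env [1] ?Q = case_nat k (\<lambda>_. 0)" by (simp add: env_Cons env0)
      have "\<forall>r\<in>set [1::nat]. r < 2 \<and> ?Q r \<le> ?n + f ?n" "\<forall>r\<ge>2. ?Q r = 0" "length x \<le> ?n + f ?n"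
        using k 1(1) by auto
      note 2 = comp_okD[OF g(2) this, unfolded env]
      have 3: "runs x ?w (0, ?Q(2 := ?b k), ?o k) (1 + 2) (0, ?Q(2 := ?b k), ?o (Suc k))"
        by (intro runs_If runs_Do) auto
      have 4: "runs x (drain 2 (block [Inc 3, Dec 3])) (0, ?Q(2 := ?b k), ?o (Suc k))
          (g (?n + f ?n) * 5 + 1) (0, ?Q, ?o (Suc k))"
        by (rule runs_drain_block[where n = "?b k" and h = "\<lambda>_. 0"
            and R = "\<lambda>j. ?Q(2 := ?b k - j)", THEN runs_mono])
          (use 2(1) in \<open>auto simp: fun_eq_iff\<close>)
      have 5: "runs x (block [Inc 1]) (0, ?Q, ?o (Suc k)) 1 (0, ?R (Suc k), ?o (Suc k))"
        by (rule runs_blockI) (auto simp: fun_eq_iff)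
      show ?thesis
        by (rule runs_mono[OF runs_Seq[OF 2(2) runs_Seq[OF 3 runs_Seq[OF 4 5]]]]) simp
    qed
    have "runs x (drain 0 ?body) (0, (\<lambda>_. 0)(0 := ?l), []) (?l * (?tb ?n + 3) + 1) (0, ?R ?l, ?o ?l)"
      by (rule runs_drain[where n = ?l and h = "\<lambda>_. 0" and R = ?R and out = ?o, OF _ body])
        (auto simp: fun_eq_iff)
    moreover have "?l * (?tb ?n + 3) + 1 \<le> f ?n * (?tb ?n + 3) + 1"
      using 1(1) by (intro add_mono mult_le_mono) auto
    ultimately have 2: "runs x (drain 0 ?body) (0, (\<lambda>_. 0)(0 := ?l), []) (f ?n * (?tb ?n + 3) + 1) (0, ?R ?l, ?o ?l)"
      by (rule runs_mono)
    have "runs x ?c (0, \<lambda>_. 0, []) (?t ?n) (0, ?R ?l, ?o ?l)"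
      by (rule runs_Seq[OF 1(2) 2])
    moreover have "?t ?n \<le> poly ([:2, 1:] ^ a) ?n" using a[of ?n] by (simp add: add.commute)
    ultimately show "\<exists>t h R. t \<le> poly ([:2, 1:] ^ a) ?n \<and> run x ?c (0, \<lambda>_. 0, []) t (h, R, ?o ?l)"
      unfolding runs_def by (meson le_trans)
  qed
qed

section \<open>Expressible functions\<close>

text \<open>A semantic view of expressions: HOL definitions are recognized as expressible by
  introduction rules, without writing terms of type \<open>exp\<close>.\<close>

definition expressible :: "(bool list \<Rightarrow> (nat \<Rightarrow> nat) \<Rightarrow> nat) \<Rightarrow> bool" where
  "expressible F \<longleftrightarrow> (\<exists>e. \<forall>x v. val x v e = F x v)"

abbreviation decidable :: "(bool list \<Rightarrow> (nat \<Rightarrow> nat) \<Rightarrow> bool) \<Rightarrow> bool" where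
  "decidable P \<equiv> expressible (\<lambda>x v. of_bool (P x v))"

lemma expressibleI: "(\<And>x v. val x v e = F x v) \<Longrightarrow> expressible F"
  unfolding expressible_def by blast

lemma expressible_cong: "expressible F \<Longrightarrow> (\<And>x v. F x v = G x v) \<Longrightarrow> expressible G"
  unfolding expressible_def by simp

lemma expressible_var: "expressible (\<lambda>x v. v i)"
  by (rule expressibleI[of "Var i"]) simp

lemma expressible_const: "expressible (\<lambda>x v. n)"
  by (rule expressibleI[of "Const n"]) simp

lemma expressible_length: "expressible (\<lambda>x v. length x)"
  by (rule expressibleI[of Len]) simp

lemma expressible_bit: "expressible F \<Longrightarrow> expressible (\<lambda>x v. tape_of x (int (F x v)))"
  unfolding expressible_def by (metis val.simps(4))

lemma expressible_add: "expressible F \<Longrightarrow> expressible G \<Longrightarrow> expressible (\<lambda>x v. F x v + G x v)"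
  unfolding expressible_def by (metis val.simps(5))

lemma expressible_diff: "expressible F \<Longrightarrow> expressible G \<Longrightarrow> expressible (\<lambda>x v. F x v - G x v)"
  unfolding expressible_def by (metis val.simps(6))

lemma expressible_sum:
  assumes "expressible B" "expressible (\<lambda>x v. F x (\<lambda>i. v (Suc i)) (v 0))"
  shows "expressible (\<lambda>x v. \<Sum>i<B x v. F x v i)"
proof -
  obtain e e' where "\<And>x v. val x v e = B x v" "\<And>x v. val x v e' = F x (\<lambda>i. v (Suc i)) (v 0)"
    using assms unfolding expressible_def by blast
  then show ?thesis by (intro expressibleI[of "Sum e e'"]) simp
qed

subsection \<open>Substitution\<close>

fun rename :: "(nat \<Rightarrow> nat) \<Rightarrow> exp \<Rightarrow> exp" where
  "rename r (Var i) = Var (r i)"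
| "rename r (Const n) = Const n"
| "rename r Len = Len"
| "rename r (Bit e) = Bit (rename r e)"
| "rename r (Add e e') = Add (rename r e) (rename r e')"
| "rename r (Sub e e') = Sub (rename r e) (rename r e')"
| "rename r (Sum e e') = Sum (rename r e) (rename (case_nat 0 (\<lambda>i. Suc (r i))) e')"

fun subst :: "(nat \<Rightarrow> exp) \<Rightarrow> exp \<Rightarrow> exp" where
  "subst s (Var i) = s i"
| "subst s (Const n) = Const n"
| "subst s Len = Len"
| "subst s (Bit e) = Bit (subst s e)"
| "subst s (Add e e') = Add (subst s e) (subst s e')"
| "subst s (Sub e e') = Sub (subst s e) (subst s e')"
| "subst s (Sum e e') = Sum (subst s e) (subst (case_nat (Var 0) (\<lambda>i. rename Suc (s i))) e')"

lemma val_rename: "val x v (rename r e) = val x (\<lambda>i. v (r i)) e"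
proof (induction e arbitrary: r v)
  case (Sum e e')
  have "(\<lambda>i. case_nat k v (case_nat 0 (\<lambda>i. Suc (r i)) i)) = case_nat k (\<lambda>i. v (r i))" for k
    by (rule ext) (simp split: nat.split)
  then show ?case using Sum by simp
qed auto

lemma val_subst: "val x v (subst s e) = val x (\<lambda>i. val x v (s i)) e"
proof (induction e arbitrary: s v)
  case (Sum e e')
  have "(\<lambda>i. val x (case_nat k v) (case_nat (Var 0) (\<lambda>i. rename Suc (s i)) i))
      = case_nat k (\<lambda>i. val x v (s i))" for k
    by (rule ext) (simp add: val_rename split: nat.split)
  then show ?case using Sum by simp
qed auto

text \<open>Inside a sum the environment is shifted, and the rule for sums would ask for arguments
  in shifted form. It is therefore convenient to treat an operation on plain variables and to
  substitute the actual arguments afterwards; the two lemmas that follow do this for one and two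
  arguments.\<close>

lemma expressible_subst:
  assumes "expressible F" "\<And>i. expressible (\<lambda>x v. S x v i)"
  shows "expressible (\<lambda>x v. F x (S x v))"
proof -
  obtain e where e: "\<And>x v. val x v e = F x v" using assms(1) unfolding expressible_def by blast
  obtain s where "\<And>i x v. val x v (s i) = S x v i" using assms(2) unfolding expressible_def by metis
  then show ?thesis by (intro expressibleI[of "subst s e"]) (simp add: val_subst e)
qed

lemma expressible_comp1:
  assumes "expressible (\<lambda>x v. f x (v 0))" "expressible A"
  shows "expressible (\<lambda>x v. f x (A x v))"
  using expressible_subst[OF assms(1), of "\<lambda>x v i. A x v"] assms(2) by simp

lemma expressible_comp2:
  assumes "expressible (\<lambda>x v. f x (v 0) (v 1))" "expressible A" "expressible B"
  shows "expressible (\<lambda>x v. f x (A x v) (B x v))"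
proof -
  let ?S = "\<lambda>x v i :: nat. if i = 0 then A x v else B x v"
  have "expressible (\<lambda>x v. ?S x v i)" for i
    using assms(2,3) by (cases i) auto
  from expressible_subst[where S = ?S, OF assms(1) this] show ?thesis by simp
qed

subsection \<open>Arithmetic and logic\<close>

lemma expressible_mult:
  assumes "expressible F" "expressible G"
  shows "expressible (\<lambda>x v. F x v * G x v)"
proof -
  \<comment> \<open>Multiplication is repeated addition. Variables stand for the factors because an
    arbitrary factor would be shifted by the binder.\<close>
  have "expressible (\<lambda>x v. \<Sum>i<v 0. v 1)"
    by (intro expressible_sum expressible_var)
  then have "expressible (\<lambda>x v. v 0 * v 1)" by simp
  from expressible_comp2[OF this assms] show ?thesis .
qed

lemma decidable_less:
  "expressible F \<Longrightarrow> expressible G \<Longrightarrow> decidable (\<lambda>x v. F x v < G x v)"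
  by (rule expressible_cong[of "\<lambda>x v. 1 - (1 - (G x v - F x v))"])
    (intro expressible_diff expressible_const, auto)

lemma decidable_not: "decidable P \<Longrightarrow> decidable (\<lambda>x v. \<not> P x v)"
  by (rule expressible_cong[of "\<lambda>x v. 1 - of_bool (P x v)"])
    (intro expressible_diff expressible_const, auto)

lemma decidable_conj: "decidable P \<Longrightarrow> decidable Q \<Longrightarrow> decidable (\<lambda>x v. P x v \<and> Q x v)"
  by (drule (1) expressible_mult) (simp flip: of_bool_conj)

lemma decidable_disj: "decidable P \<Longrightarrow> decidable Q \<Longrightarrow> decidable (\<lambda>x v. P x v \<or> Q x v)"
  by (rule expressible_cong[of "\<lambda>x v. of_bool (\<not> (\<not> P x v \<and> \<not> Q x v))"])
    (intro decidable_not decidable_conj, auto)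

lemma decidable_imp: "decidable P \<Longrightarrow> decidable Q \<Longrightarrow> decidable (\<lambda>x v. P x v \<longrightarrow> Q x v)"
  by (rule expressible_cong[of "\<lambda>x v. of_bool (\<not> P x v \<or> Q x v)"])
    (intro decidable_not decidable_disj, auto)

lemma decidable_iff: "decidable P \<Longrightarrow> decidable Q \<Longrightarrow> decidable (\<lambda>x v. P x v \<longleftrightarrow> Q x v)"
  by (rule expressible_cong[of "\<lambda>x v. of_bool ((P x v \<longrightarrow> Q x v) \<and> (Q x v \<longrightarrow> P x v))"])
    (intro decidable_conj decidable_imp, auto)

lemma decidable_le: "expressible F \<Longrightarrow> expressible G \<Longrightarrow> decidable (\<lambda>x v. F x v \<le> G x v)"
  by (rule expressible_cong[of "\<lambda>x v. of_bool (\<not> G x v < F x v)"])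
    (intro decidable_not decidable_less, auto)

lemma decidable_eq: "expressible F \<Longrightarrow> expressible G \<Longrightarrow> decidable (\<lambda>x v. F x v = G x v)"
  by (rule expressible_cong[of "\<lambda>x v. of_bool (F x v \<le> G x v \<and> G x v \<le> F x v)"])
    (intro decidable_conj decidable_le, auto)

lemma expressible_if:
  "decidable P \<Longrightarrow> expressible F \<Longrightarrow> expressible G \<Longrightarrow> expressible (\<lambda>x v. if P x v then F x v else G x v)"
  by (rule expressible_cong[of "\<lambda>x v. of_bool (P x v) * F x v + (1 - of_bool (P x v)) * G x v"])
    (intro expressible_diff expressible_const expressible_add expressible_mult, auto)

lemma decidable_if:
  "decidable P \<Longrightarrow> decidable Q \<Longrightarrow> decidable Q' \<Longrightarrow> decidable (\<lambda>x v. if P x v then Q x v else Q' x v)"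
  by (rule expressible_cong[of "\<lambda>x v. if P x v then of_bool (Q x v) else of_bool (Q' x v)"])
    (intro expressible_if, auto)

lemma decidable_ex:
  assumes "expressible B" "decidable (\<lambda>x v. P x (\<lambda>i. v (Suc i)) (v 0))"
  shows "decidable (\<lambda>x v. \<exists>i<B x v. P x v i)"
  by (rule expressible_cong[OF decidable_less[OF expressible_const[of 0]
        expressible_sum[OF assms(1), of "\<lambda>x v i. of_bool (P x v i)"]]])
    (use assms in \<open>auto simp: sum_pos2 intro!: sum_pos2\<close>)

lemma decidable_all:
  assumes "expressible B" "decidable (\<lambda>x v. P x (\<lambda>i. v (Suc i)) (v 0))"
  shows "decidable (\<lambda>x v. \<forall>i<B x v. P x v i)"
  using decidable_not[OF decidable_ex[OF assms(1), of "\<lambda>x v i. \<not> P x v i"]] decidable_not[OF assms(2)]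
  by simp

lemma expressible_div:
  assumes "expressible F" "expressible G"
  shows "expressible (\<lambda>x v. F x v div G x v)"
proof -
  \<comment> \<open>The quotient counts the positive multiples of the divisor up to the dividend;
    the case distinction reproduces the convention that division by 0 yields 0.\<close>
  have "expressible (\<lambda>x v. if v 1 = 0 then 0 else \<Sum>i<v 0. of_bool ((i + 1) * v 1 \<le> v 0))"
    by (intro expressible_if expressible_sum decidable_eq decidable_le expressible_mult
        expressible_add expressible_var expressible_const)
  moreover have div: "(if b = 0 then 0 else \<Sum>i<a. of_bool ((i + 1) * b \<le> a)) = a div b" for a b :: nat
  proof (cases "b = 0")
    case False
    have "(\<Sum>i<a. of_bool ((i + 1) * b \<le> a)) = card ({..<a} \<inter> {i. (i + 1) * b \<le> a})"
      by (simp only: sum_of_bool_eq finite_lessThan of_nat_id)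
    also have "{..<a} \<inter> {i. (i + 1) * b \<le> a} = {..<a div b}"
    proof -
      have "i < a \<and> (i + 1) * b \<le> a \<longleftrightarrow> i < a div b" for i
        using False less_eq_div_iff_mult_less_eq[of b "i + 1" a] div_le_dividend[of a b] by linarith
      then show ?thesis by blast
    qed
    finally show ?thesis using False by (simp only: if_False card_lessThan)
  qed simp
  ultimately have "expressible (\<lambda>x v. v 0 div v 1)" by (rule expressible_cong)
  from expressible_comp2[OF this assms] show ?thesis .
qed

lemma expressible_mod:
  assumes "expressible F" "expressible G"
  shows "expressible (\<lambda>x v. F x v mod G x v)"
proof -
  have "expressible (\<lambda>x v. F x v - F x v div G x v * G x v)"
    by (intro expressible_diff expressible_div expressible_mult assms)
  then show ?thesis by (simp add: minus_div_mult_eq_mod)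
qed

lemma expressible_power: "expressible F \<Longrightarrow> expressible (\<lambda>x v. F x v ^ k)"
  by (induction k) (auto intro: expressible_const expressible_mult)

lemma expressible_poly: "expressible F \<Longrightarrow> expressible (\<lambda>x v. poly p (F x v))"
  by (induction p) (auto intro: expressible_const expressible_add expressible_mult)

text \<open>The function \<open>T\<close> is arbitrary: its finitely many values become constants in
  nested conditionals. This is how a transition function enters an arithmetic expression.\<close>

lemma expressible_table:
  assumes "expressible F"
  shows "expressible (\<lambda>x v. if F x v < m then T (F x v) else 0)"
proof (induction m)
  case 0
  then show ?case by (simp add: expressible_const)
next
  case (Suc m)
  have "expressible (\<lambda>x v. if F x v = m then T m else if F x v < m then T (F x v) else 0)"
    by (intro expressible_if decidable_eq expressible_const assms Suc)
  then show ?case by (rule expressible_cong) auto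
qed

lemma expressible_table2:
  assumes "expressible F" "expressible G"
  shows "expressible (\<lambda>x v. if F x v < m \<and> G x v < n then T (F x v) (G x v) else 0)"
proof -
  have *: "expressible (\<lambda>x v. if G x v < n then
      (if F x v * n + G x v < m * n then T ((F x v * n + G x v) div n) ((F x v * n + G x v) mod n) else 0) else 0)"
    by (intro expressible_if decidable_less expressible_const assms expressible_add expressible_mult
        expressible_table[where T = "\<lambda>k. T (k div n) (k mod n)"])
  have less: "a * n + b < m * n \<longleftrightarrow> a < m" if "b < n" for a b
  proof
    assume "a * n + b < m * n"
    then have "a * n < m * n" by linarith
    then show "a < m" by simp
  next
    assume "a < m"
    then have "Suc a * n \<le> m * n" by (intro mult_le_mono1) simp
    then show "a * n + b < m * n" using that by simp
  qed
  have div: "(a * n + b) div n = a" "(a * n + b) mod n = b" if "b < n" for a b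
    using that by simp_all
  show ?thesis by (rule expressible_cong[OF *]) (simp add: less div)
qed

lemmas expressible_intros = expressible_var expressible_const expressible_length expressible_bit
  expressible_add expressible_diff expressible_mult expressible_div expressible_mod expressible_sum
  expressible_if decidable_if expressible_power expressible_poly decidable_less decidable_not decidable_conj
  decidable_disj decidable_imp decidable_iff decidable_le decidable_eq decidable_ex decidable_all

theorem polytime_computable_expressible:
  assumes "expressible (\<lambda>x v. l x)" "decidable (\<lambda>x v. b x (v 0))"
  shows "polytime_computable (\<lambda>x. map (b x) [0..<l x])"
proof -
  obtain e e' where "\<And>x v. val x v e = l x" "\<And>x v. val x v e' = of_bool (b x (v 0))"
    using assms unfolding expressible_def by blast
  then show ?thesis using polytime_computable_exp[of e' e] by simp
qed

lemma P_classI: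
  assumes "decidable (\<lambda>x v. P x)"
  shows "{x. P x} \<in> P_class"
  using polytime_computable_expressible[OF expressible_const[of 1] assms] by (simp add: P_class_def)

section \<open>Graphs with slack vertices\<close>

definition flips_at :: "'a set set \<Rightarrow> ('a set \<Rightarrow> color) \<Rightarrow> 'a \<Rightarrow> bool" where
  "flips_at E c v \<longleftrightarrow>
     card {e \<in> E. v \<in> e \<and> c e = Red} < card {e \<in> E. v \<in> e \<and> c e = Blue} \<and>
     card {e \<in> E. e \<subseteq> closed_neighborhood E v \<and> c e = Red}
       > card {e \<in> E. e \<subseteq> closed_neighborhood E v \<and> c e = Blue}"

lemma flip_coloring_iff: "flip_coloring V E c \<longleftrightarrow> (\<forall>v \<in> V. flips_at E c v)"
  by (simp add: flip_coloring_def flips_at_def)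

text \<open>A vertex of the core graph \<open>(Z, F)\<close> outside \<open>T\<close> is made part of a gadget: the Cartesian
  product of a clique on \<open>s\<close> vertices, all red, with a complete bipartite graph with sides of size
  \<open>b\<close>, all blue. For \<open>s\<close> and \<open>b\<close> large its conditions then hold whatever the colors of the core
  edges are. The vertices in \<open>T\<close> leave their gadget.\<close>

locale slack =
  fixes Z :: "'a set" and F :: "'a set set" and T :: "'a set" and N s b :: nat
  assumes graph: "finite_simple_graph Z F"
    and T: "T \<subseteq> Z"
    and N: "card Z \<le> N"
    and s: "s = 2 * N + 7" and b: "b = 3 * N + 8"
begin

definition V :: "('a \<times> nat \<times> nat) set" where
  "V = Z \<times> {..<s} \<times> {..<2 * b}"

definition base :: "'a \<Rightarrow> 'a \<times> nat \<times> nat" where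
  "base z = (z, 0, 0)"

definition reds :: "('a \<times> nat \<times> nat) set set" where
  "reds = {{(z, i, k), (z, j, k)} | z i j k.
     {(z, i, k), (z, j, k)} \<subseteq> V - base ` T \<and> i \<noteq> j}"

definition blues :: "('a \<times> nat \<times> nat) set set" where
  "blues = {{(z, i, k), (z, i, l)} | z i k l.
     {(z, i, k), (z, i, l)} \<subseteq> V - base ` T \<and> k < b \<and> b \<le> l}"

definition E :: "('a \<times> nat \<times> nat) set set" where
  "E = (`) base ` F \<union> reds \<union> blues"

lemma E_iff: "e \<in> E \<longleftrightarrow> e \<in> (`) base ` F \<or> e \<in> reds \<or> e \<in> blues"
  by (simp only: E_def Un_iff disj_assoc)

lemma redsI:
  assumes "(z, i, k) \<in> V" "(z, j, k) \<in> V" "(z, i, k) \<notin> base ` T" "(z, j, k) \<notin> base ` T" "i \<noteq> j"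
  shows "{(z, i, k), (z, j, k)} \<in> reds"
  unfolding reds_def mem_Collect_eq using assms by (intro exI conjI) auto

lemma inj_base: "inj base"
  by (auto simp: inj_def base_def)

lemma finite_Z: "finite Z" and finite_F: "finite F"
proof -
  show "finite Z" using graph by (simp add: finite_simple_graph_def)
  moreover have "F \<subseteq> Pow Z" using graph by (auto simp: finite_simple_graph_def)
  ultimately show "finite F" using finite_subset by blast
qed

lemma finite_V: "finite V"
  by (simp add: V_def finite_Z)

lemma card_F: "card F \<le> N * N"
proof -
  have "F \<subseteq> (\<lambda>(u, v). {u, v}) ` (Z \<times> Z)"
    using graph by (fastforce simp: finite_simple_graph_def card_2_iff image_iff)
  then have "card F \<le> card (Z \<times> Z)"
    using finite_Z by (meson card_image_le card_mono finite_SigmaI finite_imageI order_trans)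
  also have "\<dots> \<le> N * N" using N by (simp add: card_cartesian_product mult_le_mono)
  finally show ?thesis .
qed

lemma base_V: "z \<in> Z \<Longrightarrow> base z \<in> V"
proof -
  have "0 < s" "0 < b" using s b by simp_all
  then show "z \<in> Z \<Longrightarrow> base z \<in> V" by (simp add: V_def base_def)
qed

lemma graph_E: "finite_simple_graph V E"
  unfolding finite_simple_graph_def
proof (intro conjI ballI finite_V)
  fix e assume "e \<in> E"
  then consider f where "f \<in> F" "e = base ` f" | "e \<in> reds" | "e \<in> blues"
    by (auto simp: E_def)
  then have "e \<subseteq> V \<and> card e = 2"
  proof cases
    case 1
    then have "f \<subseteq> Z" "card f = 2" using graph by (auto simp: finite_simple_graph_def)
    then show ?thesis using 1 base_V card_image[OF inj_on_subset[OF inj_base], of f] by auto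
  next
    case 2
    then show ?thesis by (auto simp: reds_def)
  next
    case 3
    then show ?thesis by (auto simp: blues_def)
  qed
  then show "e \<subseteq> V" "card e = 2" by auto
qed

lemma finite_E: "finite E"
proof -
  have "E \<subseteq> Pow V" using graph_E by (auto simp: finite_simple_graph_def)
  then show ?thesis using finite_V finite_subset by blast
qed

text \<open>The ends of a gadget edge differ in the second or the third component, whereas both
  components are 0 in all base vertices.\<close>

lemma not_subset_base: "e \<in> reds \<union> blues \<Longrightarrow> \<not> e \<subseteq> range base"
  by (auto simp: reds_def blues_def base_def)

lemma not_core: "e \<in> reds \<union> blues \<Longrightarrow> e \<notin> (`) base ` F"
  using not_subset_base by blast

lemma reds_not_blues: "e \<in> reds \<Longrightarrow> e \<notin> blues"
  by (auto simp: reds_def blues_def doubleton_eq_iff)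

lemma not_tight_gadget: "e \<in> reds \<union> blues \<Longrightarrow> v \<in> T \<Longrightarrow> base v \<notin> e"
proof -
  assume "e \<in> reds \<union> blues"
  then have "e \<subseteq> V - base ` T" unfolding reds_def blues_def by blast
  then show "v \<in> T \<Longrightarrow> base v \<notin> e" by blast
qed

lemma E_at_tight:
  assumes "v \<in> T"
  shows "{e \<in> E. base v \<in> e \<and> P e} = (`) base ` {f \<in> F. v \<in> f \<and> P (base ` f)}"
proof -
  have "{e \<in> E. base v \<in> e \<and> P e} = {e \<in> (`) base ` F. base v \<in> e \<and> P e}"
    using not_tight_gadget[OF _ assms] unfolding E_def by blast
  also have "\<dots> = (`) base ` {f \<in> F. base v \<in> base ` f \<and> P (base ` f)}" by blast
  finally show ?thesis by (simp only: inj_image_mem_iff[OF inj_base])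
qed

lemma nbhd_tight:
  assumes "v \<in> T"
  shows "closed_neighborhood E (base v) = base ` closed_neighborhood F v"
proof -
  have "{u, base v} \<in> E \<longleftrightarrow> (\<exists>w. u = base w \<and> {w, v} \<in> F)" for u
  proof
    assume "{u, base v} \<in> E"
    then have "{u, base v} \<in> (`) base ` F"
      using not_tight_gadget[OF _ assms, of "{u, base v}"] unfolding E_def by blast
    then obtain f where f: "f \<in> F" "{u, base v} = base ` f" by (rule imageE)
    have "u \<in> base ` f" by (simp flip: f(2))
    then obtain w where w: "u = base w" "w \<in> f" by auto
    then have "base ` {w, v} = base ` f" using f by simp
    then have "{w, v} = f" by (simp only: inj_image_eq_iff[OF inj_base])
    then have "u = base w \<and> {w, v} \<in> F" using w(1) f(1) by simp
    then show "\<exists>w. u = base w \<and> {w, v} \<in> F" ..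
  next
    assume "\<exists>w. u = base w \<and> {w, v} \<in> F"
    then obtain w where "u = base w" "{w, v} \<in> F" by blast
    then have "{u, base v} = base ` {w, v}" "base ` {w, v} \<in> (`) base ` F" by (simp, blast)
    then show "{u, base v} \<in> E" unfolding E_def by simp
  qed
  then have "closed_neighborhood E (base v) = {u. \<exists>w. u = base w \<and> {w, v} \<in> F} \<union> {base v}"
    by (simp add: closed_neighborhood_def)
  then show ?thesis by (auto simp: closed_neighborhood_def)
qed

text \<open>The closed neighborhood of a tight base vertex consists of base vertices, and no gadget
  edge joins two of these; thus the second condition at a tight vertex sees the core graph
  only.\<close>

lemma E_within_tight:
  assumes "v \<in> T"
  shows "{e \<in> E. e \<subseteq> closed_neighborhood E (base v) \<and> P e}
    = (`) base ` {f \<in> F. f \<subseteq> closed_neighborhood F v \<and> P (base ` f)}"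
proof -
  let ?A = "closed_neighborhood F v"
  have "{e \<in> E. e \<subseteq> base ` ?A \<and> P e} = {e \<in> (`) base ` F. e \<subseteq> base ` ?A \<and> P e}"
    using not_subset_base unfolding E_def by blast
  also have "\<dots> = (`) base ` {f \<in> F. base ` f \<subseteq> base ` ?A \<and> P (base ` f)}" by blast
  finally show ?thesis by (simp only: inj_image_subset_iff[OF inj_base] nbhd_tight[OF assms])
qed

lemma flips_at_tight:
  assumes "v \<in> T"
  shows "flips_at E c (base v) \<longleftrightarrow> flips_at F (\<lambda>f. c (base ` f)) v"
proof -
  have "card ((`) base ` A) = card A" for A
    by (rule card_image) (metis inj_base inj_image_eq_iff inj_onI)
  then show ?thesis
    by (simp add: flips_at_def E_at_tight[OF assms] E_within_tight[OF assms])
qed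

text \<open>On a core edge, \<open>fst\<close> undoes \<open>base\<close>.\<close>

definition extend :: "('a set \<Rightarrow> color) \<Rightarrow> ('a \<times> nat \<times> nat) set \<Rightarrow> color" where
  "extend c e = (if e \<in> reds then Red else if e \<in> blues then Blue else c (fst ` e))"

lemma extend_base: "f \<in> F \<Longrightarrow> extend c (base ` f) = c f"
  using not_core[of "base ` f"]
  by (auto simp: extend_def image_image base_def)

text \<open>The right-hand side is 2 N^2 + 11 N + 15, the left-hand side N^2 + 3 N + 8. The value of
  \<open>b\<close> is dictated by the other condition, \<open>s - 1 + N < b - 1\<close>, and
  \<open>s\<close> has to be large enough to outweigh it here.\<close>

lemma card_clique: "N * N + b < (s - 1) choose 2"
proof -
  have "(2 * N + 6) choose 2 = (N + 3) * (2 * N + 5)"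
    by (simp add: choose_two algebra_simps)
  then show ?thesis by (simp add: s b algebra_simps)
qed

text \<open>At \<open>v\<close> there are at most \<open>s - 1\<close> red gadget edges and
  \<open>N\<close> core edges, but at least \<open>b - 1\<close> blue gadget edges. Inside the
  closed neighborhood the only blue gadget edges are those at \<open>v\<close>, at most
  \<open>b\<close>; even if all core edges are blue as well, the red clique through \<open>v\<close>
  outnumbers them.\<close>

lemma flips_at_slack:
  assumes v: "v \<in> V" "v \<notin> base ` T"
  shows "flips_at E (extend c) v"
proof -
  obtain z i k where vz: "v = (z, i, k)" by (cases v)
  have zik: "z \<in> Z" "i < s" "k < 2 * b" using v by (auto simp: V_def vz)
  let ?core = "(`) base ` F"
  define opp where "opp = (if k < b then {b..<2 * b} else {..<b})"
  have card_opp: "card opp = b" "finite opp" by (simp_all add: opp_def)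
  have T0: "z \<notin> T \<or> i \<noteq> 0 \<or> k \<noteq> 0" using v by (auto simp: vz base_def)
  have "card {e \<in> E. v \<in> e \<and> extend c e = Red} < card {e \<in> E. v \<in> e \<and> extend c e = Blue}"
  proof -
    have "{e \<in> E. v \<in> e \<and> extend c e = Red} \<subseteq> (\<lambda>j. {v, (z, j, k)}) ` ({..<s} - {i}) \<union> (\<lambda>w. {v, base w}) ` Z"
    proof
      fix e assume e: "e \<in> {e \<in> E. v \<in> e \<and> extend c e = Red}"
      then consider f where "f \<in> F" "e = base ` f" | "e \<in> reds"
        using reds_not_blues by (auto simp: E_def extend_def split: if_splits)
      then show "e \<in> (\<lambda>j. {v, (z, j, k)}) ` ({..<s} - {i}) \<union> (\<lambda>w. {v, base w}) ` Z"
      proof cases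
        case 1
        then obtain u w where "f = {u, w}" "u \<in> Z" "w \<in> Z"
          using graph by (fastforce simp: finite_simple_graph_def card_2_iff)
        then show ?thesis using 1 e by auto
      next
        case 2
        then show ?thesis using e by (fastforce simp: reds_def vz V_def image_iff doubleton_eq_iff)
      qed
    qed
    then have "card {e \<in> E. v \<in> e \<and> extend c e = Red}
        \<le> card ((\<lambda>j. {v, (z, j, k)}) ` ({..<s} - {i}) \<union> (\<lambda>w. {v, base w}) ` Z)"
      using finite_Z by (intro card_mono) auto
    also have "\<dots> \<le> card ({..<s} - {i}) + card Z"
      using finite_Z by (intro order_trans[OF card_Un_le] add_mono card_image_le) auto
    also have "\<dots> \<le> s - 1 + N" using zik N by simp
    also have "\<dots> < b - 1" by (simp add: s b)
    \<comment> \<open>Side position 0 is given up because the base vertex is absent from its gadget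
      if it is tight.\<close>
    also have "\<dots> \<le> card (opp - {0})" using card_opp by (simp add: card_Diff_singleton_if)
    also have "\<dots> = card ((\<lambda>l. {v, (z, i, l)}) ` (opp - {0}))"
      by (intro card_image[symmetric]) (auto simp: inj_on_def doubleton_eq_iff)
    also have "\<dots> \<le> card {e \<in> E. v \<in> e \<and> extend c e = Blue}"
    proof (rule card_mono)
      show "(\<lambda>l. {v, (z, i, l)}) ` (opp - {0}) \<subseteq> {e \<in> E. v \<in> e \<and> extend c e = Blue}"
      proof (rule image_subsetI)
        fix l assume l: "l \<in> opp - {0}"
        have "{v, (z, i, l)} \<in> blues"
        proof (cases "k < b")
          case True
          then have "{(z, i, k), (z, i, l)} \<in> blues"
            unfolding blues_def using l zik v by (fastforce simp: opp_def V_def base_def vz)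
          then show ?thesis by (simp add: vz)
        next
          case False
          then have "{(z, i, l), (z, i, k)} \<in> blues"
            unfolding blues_def using l zik v by (fastforce simp: opp_def V_def base_def vz)
          then show ?thesis by (simp add: vz insert_commute)
        qed
        then show "{v, (z, i, l)} \<in> {e \<in> E. v \<in> e \<and> extend c e = Blue}"
          using reds_not_blues by (auto simp: E_def extend_def)
      qed
    qed (use finite_E in simp)
    finally show ?thesis .
  qed
  moreover have "card {e \<in> E. e \<subseteq> closed_neighborhood E v \<and> extend c e = Red}
       > card {e \<in> E. e \<subseteq> closed_neighborhood E v \<and> extend c e = Blue}"
  proof -
    \<comment> \<open>The alternatives are a core neighbor, which exists only if \<open>v\<close> is
      itself a base vertex, a vertex of the same clique (or \<open>v\<close>), and a vertex on the
      opposite side of the bipartite graph.\<close>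
    have nb: "(i' = 0 \<and> k' = 0 \<and> i = 0 \<and> k = 0) \<or> (z' = z \<and> k' = k) \<or> (z' = z \<and> i' = i \<and> k' \<in> opp)"
      if nbhd: "(z', i', k') \<in> closed_neighborhood E v" for z' i' k'
    proof -
      have "(z', i', k') = v \<or> {(z', i', k'), v} \<in> E"
        using nbhd unfolding closed_neighborhood_def by simp
      then consider "(z', i', k') = v" | "{(z', i', k'), v} \<in> ?core"
        | "{(z', i', k'), v} \<in> reds" | "{(z', i', k'), v} \<in> blues"
        unfolding E_iff by argo
      then show ?thesis
      proof cases
        case 1
        then show ?thesis by (simp add: vz)
      next
        case 2
        then have "(z', i', k') \<in> range base" "v \<in> range base" by blast+
        then show ?thesis by (auto simp: base_def vz)
      next
        case 3
        then show ?thesis by (auto simp: reds_def vz doubleton_eq_iff)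
      next
        case 4
        then show ?thesis by (auto simp: blues_def vz doubleton_eq_iff opp_def V_def)
      qed
    qed
    \<comment> \<open>A blue gadget edge changes the side but not the clique position. Two such ends
      can both be adjacent or equal to \<open>v\<close> only if one of them is \<open>v\<close>,
      since the bipartite graph has no triangles and clique mates of \<open>v\<close> all have its
      side position.\<close>
    have "{e \<in> E. e \<subseteq> closed_neighborhood E v \<and> extend c e = Blue} \<subseteq> ?core \<union> (\<lambda>l. {v, (z, i, l)}) ` opp"
    proof
      fix e assume e: "e \<in> {e \<in> E. e \<subseteq> closed_neighborhood E v \<and> extend c e = Blue}"
      then consider "e \<in> ?core" | "e \<in> blues" by (auto simp: E_def extend_def)
      then show "e \<in> ?core \<union> (\<lambda>l. {v, (z, i, l)}) ` opp"
      proof cases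
        case 2
        then obtain z' i' k1 k2 where e2: "e = {(z', i', k1), (z', i', k2)}" "k1 < b" "b \<le> k2"
          by (auto simp: blues_def)
        then have "(z', i', k1) \<in> closed_neighborhood E v" "(z', i', k2) \<in> closed_neighborhood E v"
          using e by simp_all
        note n1 = nb[OF this(1)] and n2 = nb[OF this(2)]
        have opp: "k1 \<in> opp \<Longrightarrow> b \<le> k" "k2 \<in> opp \<Longrightarrow> k < b"
          using e2(2,3) by (auto simp: opp_def split: if_splits)
        have "0 < b" by (simp add: b)
        then have "z' = z \<and> i' = i \<and> (k2 = k \<and> k1 \<in> opp \<or> k1 = k \<and> k2 \<in> opp)"
          using n1 n2
          by (elim disjE conjE) (use opp e2(2,3) in simp_all)
        then show ?thesis using e2(1) by (auto simp: vz insert_commute)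
      qed simp
    qed
    then have "card {e \<in> E. e \<subseteq> closed_neighborhood E v \<and> extend c e = Blue}
        \<le> card (?core \<union> (\<lambda>l. {v, (z, i, l)}) ` opp)"
      using finite_F card_opp by (intro card_mono) auto
    also have "\<dots> \<le> card F + card opp"
      using finite_F card_opp by (intro order_trans[OF card_Un_le] add_mono card_image_le) auto
    also have "\<dots> \<le> N * N + b" using card_F card_opp by simp
    also have "\<dots> < (s - 1) choose 2" by (rule card_clique)
    also have "\<dots> = card {B. B \<subseteq> {1..<s} \<and> card B = 2}"
      by (simp add: n_subsets)
    also have "\<dots> = card ((`) (\<lambda>j. (z, j, k)) ` {B. B \<subseteq> {1..<s} \<and> card B = 2})"
    proof (rule card_image[symmetric])
      have "inj (\<lambda>j. (z, j, k))" by (auto simp: inj_def)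
      then show "inj_on ((`) (\<lambda>j. (z, j, k))) {B. B \<subseteq> {1..<s} \<and> card B = 2}"
        by (simp add: inj_on_def inj_image_eq_iff)
    qed
    also have "\<dots> \<le> card {e \<in> E. e \<subseteq> closed_neighborhood E v \<and> extend c e = Red}"
    proof (rule card_mono)
      \<comment> \<open>Clique positions from 1 on are never base vertices, so these
        \<open>s - 1\<close> members of the clique are present for every \<open>T\<close>.\<close>
      have nb': "(z, j, k) \<in> closed_neighborhood E v" if "1 \<le> j" "j < s" for j
      proof (cases "j = i")
        case False
        then have "{(z, j, k), (z, i, k)} \<in> reds"
          using that zik T0 by (intro redsI) (auto simp: V_def base_def)
        then show ?thesis unfolding closed_neighborhood_def E_def vz by blast
      next
        case True
        then show ?thesis unfolding closed_neighborhood_def vz by blast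
      qed
      show "(`) (\<lambda>j. (z, j, k)) ` {B. B \<subseteq> {1..<s} \<and> card B = 2}
          \<subseteq> {e \<in> E. e \<subseteq> closed_neighborhood E v \<and> extend c e = Red}"
      proof (rule image_subsetI)
        fix B assume "B \<in> {B. B \<subseteq> {1..<s} \<and> card B = 2}"
        then obtain j l where B: "B = {j, l}" "j \<noteq> l" "1 \<le> j" "j < s" "1 \<le> l" "l < s"
          by (auto simp: card_2_iff)
        then have "{(z, j, k), (z, l, k)} \<in> reds"
          using zik by (intro redsI) (auto simp: V_def base_def)
        then show "(\<lambda>j. (z, j, k)) ` B \<in> {e \<in> E. e \<subseteq> closed_neighborhood E v \<and> extend c e = Red}"
          using B(1) nb'[OF B(3,4)] nb'[OF B(5,6)] unfolding E_def extend_def by simp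
      qed
    qed (use finite_E in simp)
    finally show ?thesis .
  qed
  ultimately show ?thesis by (simp add: flips_at_def)
qed

theorem flip_coloring_slack:
  "(\<exists>c. flip_coloring V E c) \<longleftrightarrow> (\<exists>c. \<forall>v \<in> T. flips_at F c v)"
proof
  assume "\<exists>c. flip_coloring V E c"
  then obtain c where "flip_coloring V E c" by blast
  then have "\<forall>v \<in> T. flips_at F (\<lambda>f. c (base ` f)) v"
    using T base_V flips_at_tight unfolding flip_coloring_iff by blast
  then show "\<exists>c. \<forall>v \<in> T. flips_at F c v" by blast
next
  assume "\<exists>c. \<forall>v \<in> T. flips_at F c v"
  then obtain c where c: "\<forall>v \<in> T. flips_at F c v" by blast
  have "flips_at F (\<lambda>f. extend c (base ` f)) v \<longleftrightarrow> flips_at F c v" for v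
    unfolding flips_at_def using extend_base by (auto cong: conj_cong)
  then have "flips_at E (extend c) v" if "v \<in> V" for v
    using flips_at_slack[OF that] flips_at_tight c by (cases "v \<in> base ` T") auto
  then show "\<exists>c. flip_coloring V E c" unfolding flip_coloring_iff by blast
qed

end

subsection \<open>Flip conditions as sums\<close>

definition weight :: "('a set \<Rightarrow> color) \<Rightarrow> 'a set \<Rightarrow> int" where
  "weight c e = (if c e = Red then 1 else -1)"

lemma weight_cases: "weight c e = 1 \<or> weight c e = -1"
  by (simp add: weight_def)

lemma sum_weight:
  assumes "finite S"
  shows "(\<Sum>e\<in>S. weight c e) = int (card {e \<in> S. c e = Red}) - int (card {e \<in> S. c e = Blue})"
proof -
  have "S = {e \<in> S. c e = Red} \<union> {e \<in> S. c e = Blue}"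
    using color.exhaust by auto
  then have "(\<Sum>e\<in>S. weight c e) = (\<Sum>e\<in>{e \<in> S. c e = Red} \<union> {e \<in> S. c e = Blue}. weight c e)"
    by simp
  also have "\<dots> = (\<Sum>e\<in>{e \<in> S. c e = Red}. weight c e) + (\<Sum>e\<in>{e \<in> S. c e = Blue}. weight c e)"
    using assms by (intro sum.union_disjoint) auto
  also have "\<dots> = (\<Sum>e\<in>{e \<in> S. c e = Red}. 1) + (\<Sum>e\<in>{e \<in> S. c e = Blue}. -1)"
    by (intro arg_cong2[of _ _ _ _ "(+)"] sum.cong) (auto simp: weight_def)
  finally show ?thesis by simp
qed

text \<open>With one arc per edge, neighbors and edges between neighbors can be listed as pairs, and
  sums over edges become sums over these lists without double counting.\<close>

locale oriented =
  fixes A :: "('a \<times> 'a) set"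
  assumes finite_A: "finite A"
    and asym: "(a, b) \<in> A \<Longrightarrow> (b, a) \<notin> A"
begin

definition edges :: "'a set set" where
  "edges = (\<lambda>(a, b). {a, b}) ` A"

definition nbs :: "'a \<Rightarrow> 'a set" where
  "nbs v = {u. (u, v) \<in> A \<or> (v, u) \<in> A}"

definition links :: "'a \<Rightarrow> ('a \<times> 'a) set" where
  "links v = {(a, b) \<in> A. a \<in> nbs v \<and> b \<in> nbs v}"

lemma irrefl: "(a, a) \<notin> A"
  using asym by blast

lemma edge_iff: "{a, b} \<in> edges \<longleftrightarrow> (a, b) \<in> A \<or> (b, a) \<in> A"
  by (auto simp: edges_def doubleton_eq_iff)

lemma nbs_not_self: "u \<in> nbs v \<Longrightarrow> u \<noteq> v"
  using irrefl by (auto simp: nbs_def)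

lemma sum_incident: "(\<Sum>e\<in>{e \<in> edges. v \<in> e}. f e) = (\<Sum>u\<in>nbs v. f {v, u})"
proof -
  have "{e \<in> edges. v \<in> e} = (\<lambda>u. {v, u}) ` nbs v"
    by (auto simp: edges_def nbs_def insert_commute)
  moreover have "inj_on (\<lambda>u. {v, u}) (nbs v)"
    by (auto simp: inj_on_def doubleton_eq_iff)
  ultimately show ?thesis by (simp add: sum.reindex)
qed

lemma sum_links:
  "(\<Sum>e\<in>{e \<in> edges. e \<subseteq> closed_neighborhood edges v \<and> v \<notin> e}. f e) = (\<Sum>(a, b)\<in>links v. f {a, b})"
proof -
  have N: "closed_neighborhood edges v = insert v (nbs v)"
    by (auto simp: closed_neighborhood_def edge_iff nbs_def)
  have "{e \<in> edges. e \<subseteq> closed_neighborhood edges v \<and> v \<notin> e} = (\<lambda>(a, b). {a, b}) ` links v"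
    using nbs_not_self[of v v] unfolding N by (auto simp: edges_def links_def)
  moreover have "inj_on (\<lambda>(a, b). {a, b}) (links v)"
    using asym by (auto simp: inj_on_def doubleton_eq_iff links_def)
  ultimately show ?thesis
    using sum.reindex[of "\<lambda>(a, b). {a, b}" "links v" f] by (simp add: case_prod_beta comp_def)
qed

text \<open>With red as 1 and blue as -1, majorities become signs of sums. The edges in the closed
  neighborhood are the incident ones together with the links among the neighbors, so the incident
  sum occurs in both conditions.\<close>

lemma flips_at_sums:
  "flips_at edges c v \<longleftrightarrow> (\<Sum>u\<in>nbs v. weight c {v, u}) < 0 \<and>
     (\<Sum>u\<in>nbs v. weight c {v, u}) + (\<Sum>(a, b)\<in>links v. weight c {a, b}) > 0"
proof -
  have fin: "finite edges" using finite_A by (simp add: edges_def)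
  have "{e \<in> edges. e \<subseteq> closed_neighborhood edges v} =
      {e \<in> edges. v \<in> e} \<union> {e \<in> edges. e \<subseteq> closed_neighborhood edges v \<and> v \<notin> e}"
    by (auto simp: edges_def closed_neighborhood_def insert_commute)
  then have "(\<Sum>e\<in>{e \<in> edges. e \<subseteq> closed_neighborhood edges v}. weight c e)
      = (\<Sum>e\<in>{e \<in> edges. v \<in> e}. weight c e)
      + (\<Sum>e\<in>{e \<in> edges. e \<subseteq> closed_neighborhood edges v \<and> v \<notin> e}. weight c e)"
    using fin by (simp only:) (intro sum.union_disjoint; auto)
  then show ?thesis
    using sum_weight[of "{e \<in> edges. e \<subseteq> closed_neighborhood edges v}" c]
      sum_weight[of "{e \<in> edges. v \<in> e}" c] fin
    by (auto simp: flips_at_def sum_incident sum_links)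
qed

end

section \<open>From satisfiability to flip colorings\<close>

text \<open>A formula in conjunctive normal form with \<open>K\<close> clauses in \<open>K\<close> variables: \<open>lit C x\<close> is 1 or 2
  if \<open>x\<close> occurs positively or negatively in the clause \<open>C\<close>, and any other number if it does
  not occur.\<close>

definition satisfiable :: "nat \<Rightarrow> (nat \<Rightarrow> nat \<Rightarrow> nat) \<Rightarrow> bool" where
  "satisfiable K lit \<longleftrightarrow>
     (\<exists>\<sigma>. \<forall>C<K. \<exists>x<K. lit C x = 1 \<and> \<sigma> x \<or> lit C x = 2 \<and> \<not> \<sigma> x)"

text \<open>The kinds of vertices are numbered. A variable \<open>x\<close> has a vertex of kind 0, which is joined to the
  literal vertices of kinds 1 and 2 and to a vertex of kind 3; a literal is true if the edge
  from kind 0 to it is red. A clause has a vertex of kind 4, which is joined to the edges of its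
  literals, and has auxiliary vertices of kinds 5, 6, 7. An occurrence has auxiliary vertices
  of kinds 8 and 9. The kinds 0, 4, 8 are tight:

  \<^item> an 8 has only two edges among its three neighbors, so that both, one of them from 4 to 0, must be
    red, and at most one of its own edges is red;
  \<^item> then 4 needs a red edge from kind 0 to one of its literals to have enough red edges around;
  \<^item> the red edges from the clauses to 0 balance the edges from the vertices of kind 8, and therefore 0 has at
    most one red edge to its literals.\<close>

fun red_arc :: "(nat \<Rightarrow> bool) \<Rightarrow> (nat \<times> nat \<times> nat) \<times> (nat \<times> nat \<times> nat) \<Rightarrow> bool" where
  "red_arc \<sigma> ((t, _, x), (t', _, _)) \<longleftrightarrow>
     (if t = 0 then (t' = 1 \<and> \<sigma> x \<or> t' = 2 \<and> \<not> \<sigma> x) else if t = 4 then t' \<in> {0, 1, 2, 5}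
      else if t = 8 then t' = 5 else True)"

locale cnf =
  fixes K :: nat and lit :: "nat \<Rightarrow> nat \<Rightarrow> nat"
begin

definition occ :: "(nat \<times> nat) set" where
  "occ = {(C, x). C < K \<and> x < K \<and> (lit C x = 1 \<or> lit C x = 2)}"

text \<open>Kinds 3, 6, 7, 9 adjust the sums of signs. Kind 3 gives 0 a third edge, meant to be
  blue, and completes a red triangle of links, so that one true literal leaves -1 at 0 and +3 among
  its neighbors. Kinds 6 and 7 are blue counterweights to the edge from 4 to 5, which an 8 forces to
  be red. Kind 9 brings the edges of an occurrence at 4 to an even number, two red and two blue, and
  adds a red link to 5.\<close>

definition arcs :: "((nat \<times> nat \<times> nat) \<times> (nat \<times> nat \<times> nat)) set" where
  "arcs = {((t, C, x), (t', C', x')).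
     t = 0 \<and> C = 0 \<and> C' = 0 \<and> x' = x \<and> x < K \<and> (t' = 1 \<or> t' = 2 \<or> t' = 3) \<or>
     (t = 1 \<and> t' = 2 \<or> t = 1 \<and> t' = 3 \<or> t = 2 \<and> t' = 3) \<and> C = 0 \<and> C' = 0 \<and> x' = x \<and> x < K \<or>
     t = 4 \<and> x = 0 \<and> C' = C \<and> x' = 0 \<and> C < K \<and> (t' = 5 \<or> t' = 6 \<or> t' = 7) \<or>
     t = 4 \<and> x = 0 \<and> C' = 0 \<and> (C, x') \<in> occ \<and> (t' = 0 \<or> t' = lit C x') \<or>
     t = 4 \<and> x = 0 \<and> C' = C \<and> (C, x') \<in> occ \<and> (t' = 8 \<or> t' = 9) \<or>
     t = 8 \<and> C' = 0 \<and> x' = x \<and> (C, x) \<in> occ \<and> t' = 0 \<or>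
     (t = 8 \<or> t = 9) \<and> C' = C \<and> x' = 0 \<and> (C, x) \<in> occ \<and> t' = 5}"

lemma arc_iff [simp]: "((t, C, x), (t', C', x')) \<in> arcs \<longleftrightarrow>
     t = 0 \<and> C = 0 \<and> C' = 0 \<and> x' = x \<and> x < K \<and> (t' = 1 \<or> t' = 2 \<or> t' = 3) \<or>
     (t = 1 \<and> t' = 2 \<or> t = 1 \<and> t' = 3 \<or> t = 2 \<and> t' = 3) \<and> C = 0 \<and> C' = 0 \<and> x' = x \<and> x < K \<or>
     t = 4 \<and> x = 0 \<and> C' = C \<and> x' = 0 \<and> C < K \<and> (t' = 5 \<or> t' = 6 \<or> t' = 7) \<or>
     t = 4 \<and> x = 0 \<and> C' = 0 \<and> (C, x') \<in> occ \<and> (t' = 0 \<or> t' = lit C x') \<or>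
     t = 4 \<and> x = 0 \<and> C' = C \<and> (C, x') \<in> occ \<and> (t' = 8 \<or> t' = 9) \<or>
     t = 8 \<and> C' = 0 \<and> x' = x \<and> (C, x) \<in> occ \<and> t' = 0 \<or>
     (t = 8 \<or> t = 9) \<and> C' = C \<and> x' = 0 \<and> (C, x) \<in> occ \<and> t' = 5"
  by (simp add: arcs_def)

definition tight :: "(nat \<times> nat \<times> nat) set" where
  "tight = (\<lambda>x. (0, 0, x)) ` {..<K} \<union> (\<lambda>C. (4, C, 0)) ` {..<K} \<union> (\<lambda>(C, x). (8, C, x)) ` occ"

lemma lit_cases: "(C, x) \<in> occ \<Longrightarrow> lit C x = 1 \<or> lit C x = 2"
  by (simp add: occ_def)

lemma lit_neq: "(C, x) \<in> occ \<Longrightarrow> lit C x \<noteq> 0" "(C, x) \<in> occ \<Longrightarrow> lit C x \<le> 2"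
  by (auto simp: occ_def)

lemma occ_less: "(C, x) \<in> occ \<Longrightarrow> C < K" "(C, x) \<in> occ \<Longrightarrow> x < K"
  by (auto simp: occ_def)

lemma arcs_subset: "arcs \<subseteq> ({..<10} \<times> {..<Suc K} \<times> {..<Suc K}) \<times> ({..<10} \<times> {..<Suc K} \<times> {..<Suc K})"
  using lit_neq(2) occ_less by (fastforce simp: arcs_def)

text \<open>The arcs increase along the order 4, then 8 and 9, then 0, 1, 2, 3, 5, 6, 7 of the
  kinds; this gives asymmetry.\<close>

lemma arc_rank:
  assumes "((t, C, x), (t', C', x')) \<in> arcs"
  shows "(if t = 4 then 0 else if 8 \<le> t then 1 else t + 2) < (if t' = 4 then 0 else if 8 \<le> t' then 1 else t' + 2)"
  using assms lit_cases[of C x'] by auto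

sublocale oriented arcs
proof
  show "finite arcs" by (rule finite_subset[OF arcs_subset]) simp
  show "(b, a) \<notin> arcs" if "(a, b) \<in> arcs" for a b
    using that arc_rank by (cases a; cases b) (metis less_asym)
qed

section \<open>Neighborhoods and signed sums at the tight vertices\<close>

lemma nbs_var: "x < K \<Longrightarrow> nbs (0, 0, x) = {(1, 0, x), (2, 0, x), (3, 0, x)} \<union>
    (\<lambda>C. (4, C, 0)) ` {C. (C, x) \<in> occ} \<union> (\<lambda>C. (8, C, x)) ` {C. (C, x) \<in> occ}"
  using lit_neq(1) by (auto simp: nbs_def)

lemma not_into_clause: "(p, (4, C, x)) \<notin> arcs"
  using arc_rank[of _ _ _ 4 C x] by (cases p) (auto simp del: arc_iff)

lemma mem_nbs_clause: "C < K \<Longrightarrow> (t, D, y) \<in> nbs (4, C, 0) \<longleftrightarrow>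
    (t = 5 \<or> t = 6 \<or> t = 7) \<and> D = C \<and> y = 0 \<or>
    (t = 0 \<or> t = lit C y) \<and> D = 0 \<and> (C, y) \<in> occ \<or> (t = 8 \<or> t = 9) \<and> D = C \<and> (C, y) \<in> occ"
  unfolding nbs_def mem_Collect_eq by (simp only: not_into_clause) auto

lemma nbs_clause: "C < K \<Longrightarrow> nbs (4, C, 0) = {(5, C, 0), (6, C, 0), (7, C, 0)} \<union>
    (\<lambda>x. (0, 0, x)) ` {x. (C, x) \<in> occ} \<union> (\<lambda>x. (lit C x, 0, x)) ` {x. (C, x) \<in> occ} \<union>
    (\<lambda>x. (8, C, x)) ` {x. (C, x) \<in> occ} \<union> (\<lambda>x. (9, C, x)) ` {x. (C, x) \<in> occ}"
  by (rule set_eqI, rename_tac p, case_tac p) (simp only: mem_nbs_clause, auto)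

text \<open>\<open>lit C x\<close> is a single number, so a clause is joined to at most one of the
  two literal vertices of a variable and the edges within the triangle of kinds 1, 2, 3 do not
  become links.\<close>

lemma links_clause: "C < K \<Longrightarrow> links (4, C, 0) =
    (\<lambda>x. ((0, 0, x), (lit C x, 0, x))) ` {x. (C, x) \<in> occ} \<union>
    (\<lambda>x. ((8, C, x), (0, 0, x))) ` {x. (C, x) \<in> occ} \<union>
    (\<lambda>x. ((8, C, x), (5, C, 0))) ` {x. (C, x) \<in> occ} \<union>
    (\<lambda>x. ((9, C, x), (5, C, 0))) ` {x. (C, x) \<in> occ}" (is "_ \<Longrightarrow> _ = ?R")
proof (intro equalityI subsetI)
  fix p assume C: "C < K" and "p \<in> links (4, C, 0)"
  then obtain t D y t' D' y' where p: "p = ((t, D, y), (t', D', y'))" "((t, D, y), (t', D', y')) \<in> arcs"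
    "(t, D, y) \<in> nbs (4, C, 0)" "(t', D', y') \<in> nbs (4, C, 0)"
    by (auto simp: links_def simp del: arc_iff)
  note n = p(3,4)[unfolded mem_nbs_clause[OF C]]
  have lit: "(C, y) \<in> occ \<Longrightarrow> lit C y = 1 \<or> lit C y = 2" "(C, y') \<in> occ \<Longrightarrow> lit C y' = 1 \<or> lit C y' = 2"
    using lit_cases by auto
  from n(1) consider "t = 5 \<or> t = 6 \<or> t = 7" | "t = 0" "(C, y) \<in> occ" "D = 0" | "t = lit C y" "(C, y) \<in> occ"
    | "t = 8" "(C, y) \<in> occ" "D = C" | "t = 9" "(C, y) \<in> occ" "D = C" by blast
  then show "p \<in> ?R"
  proof cases
    case 1
    then show ?thesis using p(2) by auto
  next
    case 2
    then have "y' = y" "D' = 0" "t' = 1 \<or> t' = 2 \<or> t' = 3" using p(2) by auto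
    then have "t' = lit C y" using n(2) by auto
    then show ?thesis using 2 \<open>y' = y\<close> \<open>D' = 0\<close> by (simp add: p(1) image_iff)
  next
    case 3
    then have "y' = y" "t' = 2 \<and> lit C y = 1 \<or> t' = 3" using p(2) lit(1) by auto
    then show ?thesis using n(2) lit(1) by auto
  next
    case 4
    then show ?thesis using p(2) by (auto simp: p(1))
  next
    case 5
    then show ?thesis using p(2) by (auto simp: p(1))
  qed
next
  fix p assume C: "C < K" and "p \<in> ?R"
  then consider x where "(C, x) \<in> occ" "p = ((0, 0, x), (lit C x, 0, x))"
    | x where "(C, x) \<in> occ" "p = ((8, C, x), (0, 0, x))"
    | x where "(C, x) \<in> occ" "p = ((8, C, x), (5, C, 0))"
    | x where "(C, x) \<in> occ" "p = ((9, C, x), (5, C, 0))" by blast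
  then show "p \<in> links (4, C, 0)"
  proof cases
    case (1 x)
    then show ?thesis using lit_cases[OF 1(1)] occ_less(2)[OF 1(1)]
      by (auto simp: links_def mem_nbs_clause[OF C])
  qed (simp_all add: links_def mem_nbs_clause[OF C])
qed

lemma mem_nbs_var: "x < K \<Longrightarrow> (t, D, y) \<in> nbs (0, 0, x) \<longleftrightarrow>
    (t = 1 \<or> t = 2 \<or> t = 3) \<and> D = 0 \<and> y = x \<or>
    t = 4 \<and> y = 0 \<and> (D, x) \<in> occ \<or> t = 8 \<and> y = x \<and> (D, x) \<in> occ"
  unfolding nbs_var by auto

lemma links_var: "x < K \<Longrightarrow> links (0, 0, x) =
    {((1, 0, x), (2, 0, x)), ((1, 0, x), (3, 0, x)), ((2, 0, x), (3, 0, x))} \<union>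
    (\<lambda>C. ((4, C, 0), (lit C x, 0, x))) ` {C. (C, x) \<in> occ} \<union>
    (\<lambda>C. ((4, C, 0), (8, C, x))) ` {C. (C, x) \<in> occ}" (is "_ \<Longrightarrow> _ = ?R")
proof (intro equalityI subsetI)
  fix p assume x: "x < K" and "p \<in> links (0, 0, x)"
  then obtain t D y t' D' y' where p: "p = ((t, D, y), (t', D', y'))" "((t, D, y), (t', D', y')) \<in> arcs"
    "(t, D, y) \<in> nbs (0, 0, x)" "(t', D', y') \<in> nbs (0, 0, x)"
    by (auto simp: links_def simp del: arc_iff)
  note n = p(3,4)[unfolded mem_nbs_var[OF x]]
  from n(1) consider "t = 1 \<or> t = 2 \<or> t = 3" "D = 0" "y = x" | "t = 4" "y = 0" "(D, x) \<in> occ"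
    | "t = 8" "(D, x) \<in> occ" by blast
  then show "p \<in> ?R"
  proof cases
    case 1
    then have "y' = x" "D' = 0" "t = 1 \<and> t' = 2 \<or> t = 1 \<and> t' = 3 \<or> t = 2 \<and> t' = 3" using p(2) by auto
    then show ?thesis using 1 by (auto simp: p(1))
  next
    case 2
    from n(2) consider "t' = 1 \<or> t' = 2 \<or> t' = 3" "D' = 0" "y' = x" | "t' = 4" | "t' = 8" "y' = x" by blast
    then show ?thesis
    proof cases
      case 1
      then have "t' = lit D x" using p(2) 2 by auto
      then show ?thesis using 1 2 by (auto simp: p(1))
    next
      case 2
      then show ?thesis using p(2) not_into_clause by (simp del: arc_iff)
    next
      case 3
      then have "D' = D" using p(2) 2 lit_neq(2)[of D x] by auto
      then show ?thesis using 2 3 by (auto simp: p(1))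
    qed
  next
    case 3
    then show ?thesis using p(2) n(2) by auto
  qed
next
  fix p assume x: "x < K" and "p \<in> ?R"
  then consider "p \<in> {((1, 0, x), (2, 0, x)), ((1, 0, x), (3, 0, x)), ((2, 0, x), (3, 0, x))}"
    | C where "(C, x) \<in> occ" "p = ((4, C, 0), (lit C x, 0, x))"
    | C where "(C, x) \<in> occ" "p = ((4, C, 0), (8, C, x))" by blast
  then show "p \<in> links (0, 0, x)"
  proof cases
    case 1
    then show ?thesis using x by (auto simp: links_def mem_nbs_var[OF x])
  next
    case (2 C)
    then show ?thesis using lit_cases[OF 2(1)] by (auto simp: links_def mem_nbs_var[OF x])
  next
    case (3 C)
    then show ?thesis by (simp add: links_def mem_nbs_var[OF x])
  qed
qed

lemma nbs_occ: "(C, x) \<in> occ \<Longrightarrow> nbs (8, C, x) = {(4, C, 0), (0, 0, x), (5, C, 0)}"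
  using lit_neq(2) by (fastforce simp: nbs_def)

lemma links_occ: "(C, x) \<in> occ \<Longrightarrow>
    links (8, C, x) = {((4, C, 0), (0, 0, x)), ((4, C, 0), (5, C, 0))}"
  using lit_neq(2) occ_less by (fastforce simp: links_def nbs_occ)

lemma sum_Un_image:
  assumes "finite B" "finite I" "inj_on f I" "B \<inter> f ` I = {}"
  shows "(\<Sum>u\<in>B \<union> f ` I. h u) = (\<Sum>u\<in>B. h u) + (\<Sum>i\<in>I. h (f i))"
  using assms by (simp add: sum.union_disjoint sum.reindex)

lemma finite_occs: "finite {C. (C, x) \<in> occ}" "finite {x. (C, x) \<in> occ}"
  using occ_less by (auto intro!: finite_subset[of _ "{..<K}"])

lemma incident_var:
  assumes "x < K"
  shows "(\<Sum>u\<in>nbs (0, 0, x). weight c {(0, 0, x), u}) =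
    weight c {(0, 0, x), (1, 0, x)} + weight c {(0, 0, x), (2, 0, x)} + weight c {(0, 0, x), (3, 0, x)} +
    (\<Sum>C\<in>{C. (C, x) \<in> occ}. weight c {(4, C, 0), (0, 0, x)} + weight c {(8, C, x), (0, 0, x)})"
  unfolding nbs_var[OF assms]
  by (subst sum_Un_image, use finite_occs in \<open>force simp: inj_on_def\<close>, use finite_occs in \<open>force simp: inj_on_def\<close>,
      force simp: inj_on_def, force)+
    (simp add: sum.distrib insert_commute algebra_simps)

lemma link_var:
  assumes "x < K"
  shows "(\<Sum>(a, b)\<in>links (0, 0, x). weight c {a, b}) =
    weight c {(1, 0, x), (2, 0, x)} + weight c {(1, 0, x), (3, 0, x)} + weight c {(2, 0, x), (3, 0, x)} +
    (\<Sum>C\<in>{C. (C, x) \<in> occ}. weight c {(4, C, 0), (lit C x, 0, x)} + weight c {(4, C, 0), (8, C, x)})"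
proof -
  have "lit C x \<noteq> 8" if "(C, x) \<in> occ" for C using lit_cases[OF that] by auto
  then show ?thesis
    unfolding links_var[OF assms]
    by (subst sum_Un_image, use finite_occs in force, use finite_occs in force,
        force simp: inj_on_def, force)+
      (simp add: sum.distrib insert_commute algebra_simps)
qed

lemma incident_clause:
  assumes "C < K"
  shows "(\<Sum>u\<in>nbs (4, C, 0). weight c {(4, C, 0), u}) =
    weight c {(4, C, 0), (5, C, 0)} + weight c {(4, C, 0), (6, C, 0)} + weight c {(4, C, 0), (7, C, 0)} +
    (\<Sum>x\<in>{x. (C, x) \<in> occ}. weight c {(4, C, 0), (0, 0, x)} + weight c {(4, C, 0), (lit C x, 0, x)}
      + weight c {(4, C, 0), (8, C, x)} + weight c {(4, C, 0), (9, C, x)})"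
proof -
  have "lit C x \<noteq> 0" "lit C x < 3" if "(C, x) \<in> occ" for x using lit_cases[OF that] by auto
  then show ?thesis
    unfolding nbs_clause[OF assms]
    by (subst sum_Un_image, use finite_occs in force, use finite_occs in force,
        force simp: inj_on_def, force)+
      (simp add: sum.distrib insert_commute algebra_simps)
qed

lemma link_clause:
  assumes "C < K"
  shows "(\<Sum>(a, b)\<in>links (4, C, 0). weight c {a, b}) =
    (\<Sum>x\<in>{x. (C, x) \<in> occ}. weight c {(0, 0, x), (lit C x, 0, x)} + weight c {(8, C, x), (0, 0, x)}
      + weight c {(8, C, x), (5, C, 0)} + weight c {(9, C, x), (5, C, 0)})"
  unfolding links_clause[OF assms]
  by (subst sum_Un_image, use finite_occs in force, use finite_occs in force,
      force simp: inj_on_def, force)+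
    (simp add: sum.distrib sum.reindex inj_on_def)

text \<open>Here \<open>d\<close> is a sum of three signs, so a negative \<open>d\<close> is -1 or
  -3, and the two links add at most 2. Both conditions together mean that \<open>d\<close> is -1 and
  both links are red.\<close>

lemma flips_at_occ:
  assumes "(C, x) \<in> occ"
  shows "flips_at edges c (8, C, x) \<longleftrightarrow>
    (let d = weight c {(4, C, 0), (8, C, x)} + weight c {(8, C, x), (0, 0, x)} + weight c {(8, C, x), (5, C, 0)} in
     d < 0 \<and> 0 < d + weight c {(4, C, 0), (0, 0, x)} + weight c {(4, C, 0), (5, C, 0)})"
  unfolding flips_at_sums nbs_occ[OF assms] links_occ[OF assms]
  by (simp add: Let_def insert_commute algebra_simps)

section \<open>Assignments and colorings of the core graph\<close>

definition red_edges :: "(nat \<Rightarrow> bool) \<Rightarrow> (nat \<times> nat \<times> nat) set \<Rightarrow> color" where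
  "red_edges \<sigma> e = (if \<exists>a b. (a, b) \<in> arcs \<and> e = {a, b} \<and> red_arc \<sigma> (a, b) then Red else Blue)"

lemma weight_red_edges:
  assumes "(a, b) \<in> arcs"
  shows "weight (red_edges \<sigma>) {a, b} = (if red_arc \<sigma> (a, b) then 1 else -1)"
proof -
  have "(\<exists>a' b'. (a', b') \<in> arcs \<and> {a, b} = {a', b'} \<and> red_arc \<sigma> (a', b')) \<longleftrightarrow> red_arc \<sigma> (a, b)"
    using assms asym[OF assms] by (metis doubleton_eq_iff)
  then show ?thesis unfolding weight_def red_edges_def by simp
qed

text \<open>In the incident sums each occurrence contributes 0 at a variable or a clause, so that
  the remaining fixed edges leave -1. The links add 3 at a variable, 2 at an 8, and at least 2 at a
  satisfied clause.\<close>

lemma flips_if_satisfied: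
  assumes sat: "\<And>C. C < K \<Longrightarrow> \<exists>x<K. lit C x = 1 \<and> \<sigma> x \<or> lit C x = 2 \<and> \<not> \<sigma> x"
    and v: "v \<in> tight"
  shows "flips_at edges (red_edges \<sigma>) v"
proof -
  let ?w = "weight (red_edges \<sigma>)"
  from v consider x where "x < K" "v = (0, 0, x)" | C where "C < K" "v = (4, C, 0)"
    | C x where "(C, x) \<in> occ" "v = (8, C, x)"
    by (auto simp: tight_def)
  then show ?thesis
  proof cases
    case (1 x)
    have "(\<Sum>C\<in>{C. (C, x) \<in> occ}. ?w {(4, C, 0), (0, 0, x)} + ?w {(8, C, x), (0, 0, x)}) = 0"
      by (rule sum.neutral) (simp add: weight_red_edges)
    moreover have "(\<Sum>C\<in>{C. (C, x) \<in> occ}. ?w {(4, C, 0), (lit C x, 0, x)} + ?w {(4, C, 0), (8, C, x)}) = 0"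
    proof (rule sum.neutral, rule ballI)
      fix C assume "C \<in> {C. (C, x) \<in> occ}"
      then show "?w {(4, C, 0), (lit C x, 0, x)} + ?w {(4, C, 0), (8, C, x)} = 0"
        using lit_cases[of C x] by (auto simp: weight_red_edges)
    qed
    ultimately show ?thesis using 1
      by (simp add: flips_at_sums incident_var link_var weight_red_edges)
  next
    case (2 C)
    let ?O = "{x. (C, x) \<in> occ}"
    have "(\<Sum>x\<in>?O. ?w {(4, C, 0), (0, 0, x)} + ?w {(4, C, 0), (lit C x, 0, x)}
      + ?w {(4, C, 0), (8, C, x)} + ?w {(4, C, 0), (9, C, x)}) = 0"
    proof (rule sum.neutral, rule ballI)
      fix x assume "x \<in> ?O"
      then show "?w {(4, C, 0), (0, 0, x)} + ?w {(4, C, 0), (lit C x, 0, x)}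
        + ?w {(4, C, 0), (8, C, x)} + ?w {(4, C, 0), (9, C, x)} = 0"
        using lit_cases[of C x] by (auto simp: weight_red_edges)
    qed
    \<comment> \<open>Three of the four links of an occurrence sum to 1, so an occurrence yields 2
      if its literal is true and 0 otherwise; one true literal is enough.\<close>
    moreover have "2 \<le> (\<Sum>x\<in>?O. ?w {(0, 0, x), (lit C x, 0, x)} + ?w {(8, C, x), (0, 0, x)}
      + ?w {(8, C, x), (5, C, 0)} + ?w {(9, C, x), (5, C, 0)})"
    proof -
      have true: "?w {(0, 0, x), (lit C x, 0, x)} = (if lit C x = 1 \<and> \<sigma> x \<or> lit C x = 2 \<and> \<not> \<sigma> x then 1 else -1)"
        if "x \<in> ?O" for x
        using that lit_cases[of C x] occ_less(2)[of C x] by (auto simp: weight_red_edges)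
      obtain x where x: "x \<in> ?O" "lit C x = 1 \<and> \<sigma> x \<or> lit C x = 2 \<and> \<not> \<sigma> x"
        using sat[OF 2(1)] 2(1) by (auto simp: occ_def)
      have others: "?w {(8, C, x), (0, 0, x)} + ?w {(8, C, x), (5, C, 0)} + ?w {(9, C, x), (5, C, 0)} = 1"
        if "x \<in> ?O" for x
        using that by (simp add: weight_red_edges)
      have "2 = ?w {(0, 0, x), (lit C x, 0, x)} + ?w {(8, C, x), (0, 0, x)}
        + ?w {(8, C, x), (5, C, 0)} + ?w {(9, C, x), (5, C, 0)}"
        using true[OF x(1)] x(2) others[OF x(1)] by simp
      also have "\<dots> \<le> (\<Sum>x\<in>?O. ?w {(0, 0, x), (lit C x, 0, x)} + ?w {(8, C, x), (0, 0, x)}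
        + ?w {(8, C, x), (5, C, 0)} + ?w {(9, C, x), (5, C, 0)})"
      proof (rule member_le_sum[OF x(1)])
        fix y assume "y \<in> ?O - {x}"
        then show "0 \<le> ?w {(0, 0, y), (lit C y, 0, y)} + ?w {(8, C, y), (0, 0, y)}
          + ?w {(8, C, y), (5, C, 0)} + ?w {(9, C, y), (5, C, 0)}"
          using true[of y] others[of y] by (simp split: if_splits)
      qed (rule finite_occs)
      finally show ?thesis .
    qed
    ultimately show ?thesis using 2
      by (simp add: flips_at_sums incident_clause link_clause weight_red_edges)
  next
    case (3 C x)
    then show ?thesis using occ_less[OF 3(1)]
      by (simp add: flips_at_occ weight_red_edges)
  qed
qed

lemma satisfied_if_flips:
  assumes flips: "\<And>v. v \<in> tight \<Longrightarrow> flips_at edges c v" and C: "C < K"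
  defines "\<sigma> \<equiv> \<lambda>x. weight c {(0, 0, x), (1, 0, x)} = 1"
  shows "\<exists>x<K. lit C x = 1 \<and> \<sigma> x \<or> lit C x = 2 \<and> \<not> \<sigma> x"
proof -
  let ?w = "weight c"
  have occ: "?w {(4, C, 0), (0, 0, x)} = 1 \<and> ?w {(4, C, 0), (5, C, 0)} = 1 \<and>
      ?w {(8, C, x), (0, 0, x)} + ?w {(8, C, x), (5, C, 0)} \<le> 0"
    if "(C, x) \<in> occ" for C x
  proof -
    have "flips_at edges c (8, C, x)" using that by (intro flips) (force simp: tight_def)
    then show ?thesis
      using weight_cases[of c "{(4, C, 0), (0, 0, x)}"] weight_cases[of c "{(4, C, 0), (5, C, 0)}"]
        weight_cases[of c "{(4, C, 0), (8, C, x)}"] weight_cases[of c "{(8, C, x), (0, 0, x)}"]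
        weight_cases[of c "{(8, C, x), (5, C, 0)}"]
      unfolding flips_at_occ[OF that] Let_def by linarith
  qed
  \<comment> \<open>The red edges from the clauses compensate the edges from the 8s whatever their
    colors, so the three private edges of 0 have a negative sum and at most one of them is
    red.\<close>
  have var: "\<not> (?w {(0, 0, x), (1, 0, x)} = 1 \<and> ?w {(0, 0, x), (2, 0, x)} = 1)" if "x < K" for x
  proof -
    have "flips_at edges c (0, 0, x)" using that by (intro flips) (simp add: tight_def)
    then have "?w {(0, 0, x), (1, 0, x)} + ?w {(0, 0, x), (2, 0, x)} + ?w {(0, 0, x), (3, 0, x)} +
      (\<Sum>C\<in>{C. (C, x) \<in> occ}. ?w {(4, C, 0), (0, 0, x)} + ?w {(8, C, x), (0, 0, x)}) < 0"
      by (simp only: flips_at_sums incident_var[OF that])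
    moreover have "0 \<le> (\<Sum>C\<in>{C. (C, x) \<in> occ}. ?w {(4, C, 0), (0, 0, x)} + ?w {(8, C, x), (0, 0, x)})"
    proof (rule sum_nonneg)
      fix C assume "C \<in> {C. (C, x) \<in> occ}"
      then show "0 \<le> ?w {(4, C, 0), (0, 0, x)} + ?w {(8, C, x), (0, 0, x)}"
        using occ[of C x] weight_cases[of c "{(8, C, x), (0, 0, x)}"] by auto
    qed
    ultimately show ?thesis using weight_cases[of c "{(0, 0, x), (3, 0, x)}"] by linarith
  qed
  have "flips_at edges c (4, C, 0)" using C by (intro flips) (simp add: tight_def)
  then have "2 \<le> (\<Sum>(a, b)\<in>links (4, C, 0). ?w {a, b})"
    by (simp add: flips_at_sums)
  \<comment> \<open>A positive sum has a positive summand, and that occurrence turns out to be a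
    true literal.\<close>
  then have "0 < (\<Sum>x\<in>{x. (C, x) \<in> occ}. ?w {(0, 0, x), (lit C x, 0, x)} + ?w {(8, C, x), (0, 0, x)}
      + ?w {(8, C, x), (5, C, 0)} + ?w {(9, C, x), (5, C, 0)})"
    by (simp only: link_clause[OF C])
  then obtain x where x: "(C, x) \<in> occ" "0 < ?w {(0, 0, x), (lit C x, 0, x)} + ?w {(8, C, x), (0, 0, x)}
      + ?w {(8, C, x), (5, C, 0)} + ?w {(9, C, x), (5, C, 0)}"
    by (metis (no_types, lifting) linorder_not_less mem_Collect_eq sum_nonpos)
  \<comment> \<open>The two edges at the 8 contribute at most 0 and the edge from 9 at most 1, so
    the summand would not be positive with a blue literal edge.\<close>
  then have "?w {(0, 0, x), (lit C x, 0, x)} = 1"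
    using occ[OF x(1)] weight_cases[of c "{(9, C, x), (5, C, 0)}"]
      weight_cases[of c "{(0, 0, x), (lit C x, 0, x)}"] by linarith
  then show ?thesis
    using lit_cases[OF x(1)] occ_less(2)[OF x(1)] var[of x] by (auto simp: \<sigma>_def)
qed

theorem flips_iff_satisfiable:
  "(\<exists>c. \<forall>v \<in> tight. flips_at edges c v) \<longleftrightarrow> satisfiable K lit"
proof
  assume "\<exists>c. \<forall>v \<in> tight. flips_at edges c v"
  then obtain c where "\<And>v. v \<in> tight \<Longrightarrow> flips_at edges c v" by blast
  from satisfied_if_flips[OF this] show "satisfiable K lit"
    unfolding satisfiable_def
    by (intro exI[of _ "\<lambda>x. weight c {(0, 0, x), (1, 0, x)} = 1"] allI impI) simp
next
  assume "satisfiable K lit"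
  then obtain \<sigma> where "\<forall>C<K. \<exists>x<K. lit C x = 1 \<and> \<sigma> x \<or> lit C x = 2 \<and> \<not> \<sigma> x"
    unfolding satisfiable_def ..
  then have "C < K \<Longrightarrow> \<exists>x<K. lit C x = 1 \<and> \<sigma> x \<or> lit C x = 2 \<and> \<not> \<sigma> x" for C by simp
  from flips_if_satisfied[OF this] show "\<exists>c. \<forall>v \<in> tight. flips_at edges c v"
    by (intro exI ballI)
qed

end

section \<open>Adjacency matrices\<close>

text \<open>Each bit is given directly in terms of its position, by division with remainder, which
  is the form that \<open>polytime_computable_expressible\<close> accepts.\<close>

definition encode_matrix :: "nat \<Rightarrow> (nat \<Rightarrow> nat \<Rightarrow> bool) \<Rightarrow> bool list" where
  "encode_matrix n adj = map (\<lambda>k. if k < n then True else if k = n then False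
     else adj ((k - n - 1) div n) ((k - n - 1) mod n)) [0..<n + 1 + n * n]"

definition matrix_edges :: "nat \<Rightarrow> (nat \<Rightarrow> nat \<Rightarrow> bool) \<Rightarrow> nat set set" where
  "matrix_edges n adj = {{i, j} | i j. i < n \<and> j < n \<and> adj i j}"

definition simple_matrix :: "nat \<Rightarrow> (nat \<Rightarrow> nat \<Rightarrow> bool) \<Rightarrow> bool" where
  "simple_matrix n adj \<longleftrightarrow> (\<forall>i<n. \<forall>j<n. adj i j \<longrightarrow> adj j i) \<and> (\<forall>i<n. \<not> adj i i)"

lemma concat_map_matrix:
  "concat (map (\<lambda>i. map (f i) [0..<n]) [0..<m]) = map (\<lambda>k. f (k div n) (k mod n)) [0..<m * n]"
proof (induction m)
  case (Suc m)
  have "[0..<Suc m * n] = [0..<m * n] @ [m * n..<m * n + n]"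
    using upt_add_eq_append[of 0 "m * n" n] by (simp add: add.commute)
  moreover have "[m * n..<m * n + n] = map (\<lambda>j. j + m * n) [0..<n]"
    by (simp add: map_add_upt add.commute)
  ultimately show ?case using Suc by simp
qed simp

lemma matrix_edges_iff:
  "simple_matrix n adj \<Longrightarrow> i < n \<Longrightarrow> j < n \<Longrightarrow> {i, j} \<in> matrix_edges n adj \<longleftrightarrow> adj i j"
  by (auto simp: matrix_edges_def simple_matrix_def doubleton_eq_iff)

lemma graph_matrix: "simple_matrix n adj \<Longrightarrow> finite_simple_graph {..<n} (matrix_edges n adj)"
proof -
  assume sm: "simple_matrix n adj"
  have "e \<subseteq> {..<n} \<and> card e = 2" if mem: "e \<in> matrix_edges n adj" for e
  proof -
    obtain i j where e: "e = {i, j}" "i < n" "j < n" "adj i j"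
      using mem unfolding matrix_edges_def by blast
    then have "i \<noteq> j" using sm unfolding simple_matrix_def by blast
    then show ?thesis using e by simp
  qed
  then show ?thesis unfolding finite_simple_graph_def by simp
qed

lemma encode_graph_matrix:
  assumes "simple_matrix n adj"
  shows "encode_graph n (matrix_edges n adj) = encode_matrix n adj"
proof (rule nth_equalityI)
  let ?E = "matrix_edges n adj"
  have enc: "encode_graph n ?E = replicate n True @ [False] @
      map (\<lambda>k. {k div n, k mod n} \<in> ?E) [0..<n * n]"
    unfolding encode_graph_def concat_map_matrix ..
  show "length (encode_graph n ?E) = length (encode_matrix n adj)"
    by (simp add: enc encode_matrix_def)
  fix k assume "k < length (encode_graph n ?E)"
  then have k: "k < n + 1 + n * n" by (simp add: enc)
  show "encode_graph n ?E ! k = encode_matrix n adj ! k"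
  proof (cases "k \<le> n")
    case True
    then show ?thesis using k by (auto simp: enc encode_matrix_def nth_append simp del: upt_Suc)
  next
    case False
    define l where "l = k - n - 1"
    have kl: "k = n + 1 + l" "l < n * n" using False k by (auto simp: l_def)
    then have "0 < n" by (cases n) auto
    then have "l div n < n" "l mod n < n" using kl by (simp_all add: less_mult_imp_div_less)
    then show ?thesis using kl(2) k matrix_edges_iff[OF assms]
      by (simp add: enc encode_matrix_def nth_append kl(1) del: upt_Suc)
  qed
qed

lemma graph_is_matrix:
  fixes n :: nat
  assumes "finite_simple_graph {..<n} E"
  shows "simple_matrix n (\<lambda>i j. {i, j} \<in> E)" "matrix_edges n (\<lambda>i j. {i, j} \<in> E) = E"
proof -
  show "simple_matrix n (\<lambda>i j. {i, j} \<in> E)"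
    using assms by (auto simp: simple_matrix_def finite_simple_graph_def insert_commute)
  have "e \<in> matrix_edges n (\<lambda>i j. {i, j} \<in> E)" if e: "e \<in> E" for e
  proof -
    obtain i j where "e = {i, j}" "e \<subseteq> {..<n}"
      using assms e by (auto simp: finite_simple_graph_def card_2_iff)
    then show ?thesis using e by (auto simp: matrix_edges_def)
  qed
  then show "matrix_edges n (\<lambda>i j. {i, j} \<in> E) = E"
    by (auto simp: matrix_edges_def)
qed

lemma two_FLIP_matrix:
  "two_FLIP = {encode_matrix n adj | n adj. simple_matrix n adj \<and>
     (\<exists>c. flip_coloring {..<n} (matrix_edges n adj) c)}"
proof (intro equalityI subsetI)
  fix x assume "x \<in> two_FLIP"
  then obtain n E c where x: "x = encode_graph n E" and E: "finite_simple_graph {..<n} E"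
    and c: "flip_coloring {..<n} E c" unfolding two_FLIP_def mem_Collect_eq by (elim exE conjE)
  have "x = encode_matrix n (\<lambda>i j. {i, j} \<in> E)"
    using encode_graph_matrix[OF graph_is_matrix(1)[OF E]] graph_is_matrix(2)[OF E] x by simp
  then show "x \<in> {encode_matrix n adj | n adj. simple_matrix n adj \<and>
      (\<exists>c. flip_coloring {..<n} (matrix_edges n adj) c)}"
    unfolding mem_Collect_eq using c graph_is_matrix[OF E]
    by (intro exI[of _ n] exI[of _ "\<lambda>i j. {i, j} \<in> E"] conjI exI[of _ c]) simp_all
next
  fix x assume "x \<in> {encode_matrix n adj | n adj. simple_matrix n adj \<and>
      (\<exists>c. flip_coloring {..<n} (matrix_edges n adj) c)}"
  then obtain n adj c where x: "x = encode_matrix n adj" and adj: "simple_matrix n adj"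
    and c: "flip_coloring {..<n} (matrix_edges n adj) c" unfolding mem_Collect_eq by (elim exE conjE)
  then show "x \<in> two_FLIP"
    unfolding two_FLIP_def mem_Collect_eq using graph_matrix[OF adj] encode_graph_matrix[OF adj]
    by (intro exI[of _ n] exI[of _ "matrix_edges n adj"] conjI exI[of _ c]) simp_all
qed

section \<open>Membership in NP\<close>

text \<open>The restriction to \<open>i < j\<close> counts an undirected edge once and means that a
  color matrix is read above its diagonal only.\<close>

definition count :: "nat \<Rightarrow> (nat \<Rightarrow> nat \<Rightarrow> bool) \<Rightarrow> nat" where
  "count n Q = (\<Sum>i<n. \<Sum>j<n. of_bool (i < j \<and> Q i j))"

definition flip_matrix :: "nat \<Rightarrow> (nat \<Rightarrow> nat \<Rightarrow> bool) \<Rightarrow> (nat \<Rightarrow> nat \<Rightarrow> bool) \<Rightarrow> bool" where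
  "flip_matrix n adj red \<longleftrightarrow> (\<forall>v<n.
     count n (\<lambda>i j. adj i j \<and> (v = i \<or> v = j) \<and> red i j)
       < count n (\<lambda>i j. adj i j \<and> (v = i \<or> v = j) \<and> \<not> red i j) \<and>
     count n (\<lambda>i j. adj i j \<and> (i = v \<or> adj i v) \<and> (j = v \<or> adj j v) \<and> \<not> red i j)
       < count n (\<lambda>i j. adj i j \<and> (i = v \<or> adj i v) \<and> (j = v \<or> adj j v) \<and> red i j))"

lemma count_cong: "(\<And>i j. i < j \<Longrightarrow> j < n \<Longrightarrow> Q i j \<longleftrightarrow> Q' i j) \<Longrightarrow> count n Q = count n Q'"
  unfolding count_def by (intro sum.cong refl arg_cong[where f = of_bool]) auto

lemma flip_matrix_cong:
  assumes "\<And>i j. i < n \<Longrightarrow> j < n \<Longrightarrow> adj i j \<longleftrightarrow> adj' i j"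
    "\<And>i j. i < j \<Longrightarrow> j < n \<Longrightarrow> red i j \<longleftrightarrow> red' i j"
  shows "flip_matrix n adj red \<longleftrightarrow> flip_matrix n adj' red'"
proof -
  have "flip_matrix n adj red" if "flip_matrix n adj' red'"
    and eq: "\<And>i j. i < n \<Longrightarrow> j < n \<Longrightarrow> adj i j \<longleftrightarrow> adj' i j"
      "\<And>i j. i < j \<Longrightarrow> j < n \<Longrightarrow> red i j \<longleftrightarrow> red' i j" for adj red adj' red'
    unfolding flip_matrix_def
  proof (intro allI impI)
    fix v assume v: "v < n"
    have "count n (\<lambda>i j. adj i j \<and> (v = i \<or> v = j) \<and> red i j)
        = count n (\<lambda>i j. adj' i j \<and> (v = i \<or> v = j) \<and> red' i j)"
      "count n (\<lambda>i j. adj i j \<and> (v = i \<or> v = j) \<and> \<not> red i j)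
        = count n (\<lambda>i j. adj' i j \<and> (v = i \<or> v = j) \<and> \<not> red' i j)"
      "count n (\<lambda>i j. adj i j \<and> (i = v \<or> adj i v) \<and> (j = v \<or> adj j v) \<and> \<not> red i j)
        = count n (\<lambda>i j. adj' i j \<and> (i = v \<or> adj' i v) \<and> (j = v \<or> adj' j v) \<and> \<not> red' i j)"
      "count n (\<lambda>i j. adj i j \<and> (i = v \<or> adj i v) \<and> (j = v \<or> adj j v) \<and> red i j)
        = count n (\<lambda>i j. adj' i j \<and> (i = v \<or> adj' i v) \<and> (j = v \<or> adj' j v) \<and> red' i j)"
      using v by (auto intro!: count_cong simp: eq)
    then show "count n (\<lambda>i j. adj i j \<and> (v = i \<or> v = j) \<and> red i j)
        < count n (\<lambda>i j. adj i j \<and> (v = i \<or> v = j) \<and> \<not> red i j) \<and>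
      count n (\<lambda>i j. adj i j \<and> (i = v \<or> adj i v) \<and> (j = v \<or> adj j v) \<and> \<not> red i j)
        < count n (\<lambda>i j. adj i j \<and> (i = v \<or> adj i v) \<and> (j = v \<or> adj j v) \<and> red i j)"
      using that(1) v by (simp add: flip_matrix_def)
  qed
  from this[of adj' red' adj red] this[of adj red adj' red'] show ?thesis using assms by blast
qed

lemma card_matrix_edges:
  assumes "simple_matrix n adj"
  shows "card {e \<in> matrix_edges n adj. Q e} = count n (\<lambda>i j. adj i j \<and> Q {i, j})"
proof -
  let ?A = "{(i, j). i < j \<and> j < n \<and> adj i j \<and> Q {i, j}}"
  have "{e \<in> matrix_edges n adj. Q e} = (\<lambda>(i, j). {i, j}) ` ?A"
  proof (intro equalityI subsetI)
    fix e assume "e \<in> {e \<in> matrix_edges n adj. Q e}"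
    then obtain i j where e: "e = {i, j}" "i < n" "j < n" "adj i j" "Q e"
      by (auto simp: matrix_edges_def)
    then have "adj j i" "i \<noteq> j" using assms unfolding simple_matrix_def by blast+
    show "e \<in> (\<lambda>(i, j). {i, j}) ` ?A"
    proof (cases "i < j")
      case True
      then have "(i, j) \<in> ?A" using e by simp
      then show ?thesis using e(1) by (rule_tac image_eqI[of _ _ "(i, j)"]) simp_all
    next
      case False
      then have "(j, i) \<in> ?A" using e \<open>adj j i\<close> \<open>i \<noteq> j\<close> by (simp add: insert_commute)
      then show ?thesis using e(1) by (rule_tac image_eqI[of _ _ "(j, i)"]) (simp_all add: insert_commute)
    qed
  next
    fix e assume "e \<in> (\<lambda>(i, j). {i, j}) ` ?A"
    then obtain i j where "e = {i, j}" "i < j" "j < n" "adj i j" "Q {i, j}" by auto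
    then show "e \<in> {e \<in> matrix_edges n adj. Q e}"
      unfolding matrix_edges_def using less_trans by blast
  qed
  moreover have "inj_on (\<lambda>(i, j). {i, j}) ?A"
    by (auto simp: inj_on_def doubleton_eq_iff)
  ultimately have "card {e \<in> matrix_edges n adj. Q e} = card ?A" by (simp add: card_image)
  also have "?A = {..<n} \<times> {..<n} \<inter> {p. fst p < snd p \<and> adj (fst p) (snd p) \<and> Q {fst p, snd p}}"
    by auto
  also have "card \<dots> = (\<Sum>p\<in>{..<n} \<times> {..<n}. of_bool (fst p < snd p \<and> adj (fst p) (snd p) \<and> Q {fst p, snd p}))"
    by (simp add: sum_of_bool_eq)
  also have "\<dots> = count n (\<lambda>i j. adj i j \<and> Q {i, j})"
    by (simp only: count_def sum.cartesian_product) (rule sum.cong, simp_all only: case_prod_beta)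
  finally show ?thesis .
qed

lemma flip_coloring_matrix:
  assumes "simple_matrix n adj"
  shows "flip_coloring {..<n} (matrix_edges n adj) c \<longleftrightarrow> flip_matrix n adj (\<lambda>i j. c {i, j} = Red)"
proof -
  let ?E = "matrix_edges n adj"
  have blue: "c e = Blue \<longleftrightarrow> c e \<noteq> Red" for e by (cases "c e") auto
  have nb: "i \<in> closed_neighborhood ?E v \<longleftrightarrow> i = v \<or> adj i v" if "i < n" "v < n" for i v
    using matrix_edges_iff[OF assms that] by (auto simp: closed_neighborhood_def)
  have "count n (\<lambda>i j. adj i j \<and> {i, j} \<subseteq> closed_neighborhood ?E v \<and> P i j)
      = count n (\<lambda>i j. adj i j \<and> (i = v \<or> adj i v) \<and> (j = v \<or> adj j v) \<and> P i j)" if "v < n" for v P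
    by (intro count_cong) (use that nb in auto)
  then show ?thesis
    unfolding flip_coloring_def flip_matrix_def card_matrix_edges[OF assms] blue by auto
qed

lemma two_FLIP_flip_matrix:
  "two_FLIP = {encode_matrix n adj | n adj. simple_matrix n adj \<and> (\<exists>red. flip_matrix n adj red)}"
proof -
  have "(\<exists>c. flip_coloring {..<n} (matrix_edges n adj) c) \<longleftrightarrow> (\<exists>red. flip_matrix n adj red)"
    if "simple_matrix n adj" for n adj
  proof
    assume "\<exists>red. flip_matrix n adj red"
    then obtain red where red: "flip_matrix n adj red" ..
    \<comment> \<open>Only entries with the smaller index in front are read, so \<open>Min\<close>
      and \<open>Max\<close> recover the relevant entry from an edge.\<close>
    define c where "c e = (if red (Min e) (Max e) then Red else Blue)" for e
    have "flip_matrix n adj (\<lambda>i j. c {i, j} = Red)"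
      using red by (subst flip_matrix_cong[where adj' = adj and red' = red]) (auto simp: c_def)
    then show "\<exists>c. flip_coloring {..<n} (matrix_edges n adj) c"
      using flip_coloring_matrix[OF that] by blast
  qed (use flip_coloring_matrix[OF that] in blast)
  then show ?thesis unfolding two_FLIP_matrix by blast
qed

subsection \<open>The verifier\<close>

text \<open>The bits of the first word are doubled and the separator is the first pair with unequal
  bits. The inner quantifier stops the count there, although later pairs may be equal again.\<close>

definition fst_len :: "bool list \<Rightarrow> nat" where
  "fst_len z = (\<Sum>k<length z. of_bool (\<forall>i<k + 1. tape_of z (int (2 * i)) = tape_of z (int (2 * i + 1))))"

definition fst_bit :: "bool list \<Rightarrow> nat \<Rightarrow> bool" where
  "fst_bit z k \<longleftrightarrow> tape_of z (int (2 * k)) = 2"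

definition snd_bit :: "bool list \<Rightarrow> nat \<Rightarrow> bool" where
  "snd_bit z k \<longleftrightarrow> tape_of z (int (2 * fst_len z + 2 + k)) = 2"

text \<open>The length of the leading run of ones of the first word, that is, the number written in
  unary.\<close>

definition num_vertices :: "bool list \<Rightarrow> nat" where
  "num_vertices z = (\<Sum>k<length z. of_bool (\<forall>i<k + 1. i < fst_len z \<and> fst_bit z i))"

definition matrix_bit :: "bool list \<Rightarrow> nat \<Rightarrow> nat \<Rightarrow> bool" where
  "matrix_bit z i j \<longleftrightarrow> fst_bit z (num_vertices z + 1 + i * num_vertices z + j)"

definition color_bit :: "bool list \<Rightarrow> nat \<Rightarrow> nat \<Rightarrow> bool" where
  "color_bit z i j \<longleftrightarrow> snd_bit z (i * num_vertices z + j)"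

definition verifies :: "bool list \<Rightarrow> bool" where
  "verifies z \<longleftrightarrow> fst_len z = num_vertices z + 1 + num_vertices z * num_vertices z \<and>
     simple_matrix (num_vertices z) (matrix_bit z) \<and>
     flip_matrix (num_vertices z) (matrix_bit z) (color_bit z)"

lemma expressible_fst_len: "expressible (\<lambda>x v. fst_len x)"
  unfolding fst_len_def by (intro expressible_intros)

lemma expressible_num_vertices: "expressible (\<lambda>x v. num_vertices x)"
  unfolding num_vertices_def fst_bit_def by (intro expressible_intros expressible_fst_len)

lemma decidable_verifies: "decidable (\<lambda>x v. verifies x)"
  unfolding verifies_def simple_matrix_def flip_matrix_def count_def matrix_bit_def color_bit_def
    fst_bit_def snd_bit_def
  by (intro expressible_intros expressible_fst_len expressible_num_vertices)

lemma nth_doubled: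
  "i < length x \<Longrightarrow> concat (map (\<lambda>b. [b, b]) x) ! (2 * i) = x ! i \<and>
     concat (map (\<lambda>b. [b, b]) x) ! Suc (2 * i) = x ! i"
proof (induction x arbitrary: i)
  case (Cons a x)
  then show ?case by (cases i) auto
qed simp

lemma length_doubled [simp]: "length (concat (map (\<lambda>b. [b, b]) x)) = 2 * length x"
  by (induction x) auto

lemma length_pair_word: "length (pair_word x y) = 2 * length x + 2 + length y"
  by (simp add: pair_word_def)

lemma tape_pair_word:
  "i < length x \<Longrightarrow> tape_of (pair_word x y) (int (2 * i)) = (if x ! i then 2 else 1)"
  "i < length x \<Longrightarrow> tape_of (pair_word x y) (int (2 * i + 1)) = (if x ! i then 2 else 1)"
  "tape_of (pair_word x y) (int (2 * length x)) = 1"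
  "tape_of (pair_word x y) (int (2 * length x + 1)) = 2"
  "tape_of (pair_word x y) (int (2 * length x + 2 + k)) = tape_of y (int k)"
  using nth_doubled[of i x]
  by (simp_all add: tape_of_def length_pair_word nat_add_distrib nat_mult_distrib)
    (auto simp: pair_word_def nth_append nat_add_distrib nat_mult_distrib)

text \<open>A downward closed set of numbers is an initial segment, and a bounded sum measures its
  length.\<close>

lemma sum_of_bool_initial:
  fixes P :: "nat \<Rightarrow> bool"
  assumes mono: "\<And>i j. P j \<Longrightarrow> i \<le> j \<Longrightarrow> P i" and N: "\<not> P N"
  shows "P k \<longleftrightarrow> k < (\<Sum>k<N. of_bool (P k))"
proof -
  define m where "m = (LEAST k. \<not> P k)"
  have m: "\<not> P m" "m \<le> N"
    unfolding m_def by (rule LeastI[of "\<lambda>k. \<not> P k", OF N], rule Least_le[of "\<lambda>k. \<not> P k", OF N])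
  have P: "P k \<longleftrightarrow> k < m" for k
  proof (cases "k < m")
    case True
    then show ?thesis using not_less_Least[of k "\<lambda>k. \<not> P k"] by (simp add: m_def)
  next
    case False
    then have "\<not> P k" using m(1) mono[of k m] by linarith
    then show ?thesis using False by simp
  qed
  have "(\<Sum>k<N. of_bool (P k)) = card ({..<N} \<inter> {k. P k})" by (simp add: sum_of_bool_eq)
  also have "{..<N} \<inter> {k. P k} = {..<m}" unfolding P using m(2) by auto
  finally show ?thesis unfolding P by simp
qed

lemma fst_len_pair: "fst_len (pair_word x y) = length x"
proof -
  let ?z = "pair_word x y"
  let ?P = "\<lambda>k. \<forall>i<k + 1. tape_of ?z (int (2 * i)) = tape_of ?z (int (2 * i + 1))"
  have *: "?P k \<longleftrightarrow> k < length x" for k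
  proof
    assume "?P k"
    then have "\<not> length x < k + 1" using tape_pair_word(3,4)[of x y] by fastforce
    then show "k < length x" by simp
  next
    assume "k < length x"
    then show "?P k" using tape_pair_word(1,2)[of _ x y] by simp
  qed
  have "fst_len ?z = (\<Sum>k<length ?z. of_bool (k < length x))" unfolding fst_len_def * ..
  also have "\<dots> = card ({..<length ?z} \<inter> {k. k < length x})" by (simp add: sum_of_bool_eq)
  also have "{..<length ?z} \<inter> {k. k < length x} = {..<length x}" by (auto simp: length_pair_word)
  finally show ?thesis by simp
qed

lemma fst_bit_pair: "k < length x \<Longrightarrow> fst_bit (pair_word x y) k \<longleftrightarrow> x ! k"
  unfolding fst_bit_def using tape_pair_word(1)[of k x y] by simp

lemma snd_bit_pair: "snd_bit (pair_word x y) k \<longleftrightarrow> k < length y \<and> y ! k"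
  unfolding snd_bit_def fst_len_pair tape_pair_word(5) by (simp add: tape_of_def)

lemma num_vertices_pair:
  "k < num_vertices (pair_word x y) \<longleftrightarrow> (\<forall>i\<le>k. i < length x \<and> x ! i)"
proof -
  let ?P = "\<lambda>k. \<forall>i<k + 1. i < fst_len (pair_word x y) \<and> fst_bit (pair_word x y) i"
  have "?P k \<longleftrightarrow> k < (\<Sum>k<length (pair_word x y). of_bool (?P k))"
    by (rule sum_of_bool_initial) (auto simp: fst_len_pair length_pair_word)
  then have "k < num_vertices (pair_word x y) \<longleftrightarrow> ?P k" unfolding num_vertices_def by simp
  then show ?thesis by (auto simp: fst_len_pair fst_bit_pair less_Suc_eq_le)
qed

text \<open>The certificate is the color matrix, row by row. It has \<open>n * n\<close> bits and is
  thus no longer than the encoded graph; missing bits of a shorter certificate are read as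
  blue.\<close>

lemma two_FLIP_verifies:
  "x \<in> two_FLIP \<longleftrightarrow> (\<exists>y. length y \<le> length x \<and> verifies (pair_word x y))"
proof
  assume "x \<in> two_FLIP"
  then obtain n adj red where x: "x = encode_matrix n adj" and sm: "simple_matrix n adj"
    and red: "flip_matrix n adj red" unfolding two_FLIP_flip_matrix by blast
  define y where "y = map (\<lambda>k. red (k div n) (k mod n)) [0..<n * n]"
  let ?z = "pair_word x y"
  have lx: "length x = n + 1 + n * n" by (simp add: x encode_matrix_def)
  have xk: "k < n \<Longrightarrow> x ! k" "\<not> x ! n" for k
    by (simp_all add: x encode_matrix_def nth_append del: upt_Suc)
  have num: "k < num_vertices ?z \<longleftrightarrow> k < n" for k
  proof
    assume "k < num_vertices ?z"
    then have "\<not> n \<le> k" unfolding num_vertices_pair using xk(2) by blast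
    then show "k < n" by simp
  next
    assume "k < n"
    then show "k < num_vertices ?z" unfolding num_vertices_pair using xk(1) lx by simp
  qed
  have n: "num_vertices ?z = n"
    using num[of n] num[of "num_vertices ?z"] by simp
  have ij: "i * n + j < n * n" if "i < n" "j < n" for i j
  proof -
    have "i * n + j < Suc i * n" using that by simp
    also have "\<dots> \<le> n * n" using that by (intro mult_le_mono1) simp
    finally show ?thesis .
  qed
  have adj: "matrix_bit ?z i j \<longleftrightarrow> adj i j" if "i < n" "j < n" for i j
  proof -
    have "n + 1 + i * n + j < length x" using ij[OF that] lx by simp
    then have "matrix_bit ?z i j \<longleftrightarrow> x ! (n + 1 + i * n + j)"
      unfolding matrix_bit_def n by (rule fst_bit_pair)
    also have "\<dots> \<longleftrightarrow> adj i j"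
      using ij[OF that] that by (simp add: x encode_matrix_def del: upt_Suc)
    finally show ?thesis .
  qed
  have red': "color_bit ?z i j \<longleftrightarrow> red i j" if "i < n" "j < n" for i j
    unfolding color_bit_def n snd_bit_pair using ij[OF that] that by (simp add: y_def)
  have "simple_matrix n (matrix_bit ?z)"
    using sm adj unfolding simple_matrix_def by simp
  moreover have "flip_matrix n (matrix_bit ?z) (color_bit ?z) \<longleftrightarrow> flip_matrix n adj red"
    by (rule flip_matrix_cong) (use adj red' in auto)
  ultimately have "verifies ?z"
    unfolding verifies_def n fst_len_pair using lx red by simp
  moreover have "length y \<le> length x" by (simp add: y_def lx)
  ultimately show "\<exists>y. length y \<le> length x \<and> verifies (pair_word x y)" by blast
next
  assume "\<exists>y. length y \<le> length x \<and> verifies (pair_word x y)"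
  then obtain y where y: "verifies (pair_word x y)" by blast
  let ?z = "pair_word x y"
  define n where "n = num_vertices ?z"
  have lx: "length x = n + 1 + n * n" and sm: "simple_matrix n (matrix_bit ?z)"
    and fm: "flip_matrix n (matrix_bit ?z) (color_bit ?z)"
    using y by (auto simp: verifies_def n_def fst_len_pair)
  have "x = encode_matrix n (matrix_bit ?z)"
  proof (rule nth_equalityI)
    show "length x = length (encode_matrix n (matrix_bit ?z))" by (simp add: lx encode_matrix_def)
    fix k assume k: "k < length x"
    have lt: "k < n \<longleftrightarrow> (\<forall>i\<le>k. i < length x \<and> x ! i)" for k
      unfolding n_def by (rule num_vertices_pair)
    consider "k < n" | "k = n" | l where "k = n + 1 + l"
      using less_imp_Suc_add[of n k] by fastforce
    then show "x ! k = encode_matrix n (matrix_bit ?z) ! k"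
    proof cases
      case 1
      then show ?thesis using lt[of k] k lx by (simp add: encode_matrix_def del: upt_Suc)
    next
      case 2
      have "x ! i" if "i < n" for i using that lt[of i] by blast
      then have "\<not> x ! n" using lt[of n] lx by (auto simp: le_less)
      then show ?thesis using 2 by (simp add: encode_matrix_def nth_append del: upt_Suc)
    next
      case 3
      then have "l < n * n" using k lx by simp
      then have "l div n * n + l mod n = l" by simp
      then have "matrix_bit ?z (l div n) (l mod n) \<longleftrightarrow> fst_bit ?z k"
        unfolding matrix_bit_def n_def[symmetric] 3 by (simp add: add.assoc)
      also have "\<dots> \<longleftrightarrow> x ! k" using k by (rule fst_bit_pair)
      finally show ?thesis using k lx by (simp add: encode_matrix_def 3 del: upt_Suc)
    qed
  qed
  then show "x \<in> two_FLIP" unfolding two_FLIP_flip_matrix using sm fm by blast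
qed

lemma two_FLIP_NP: "two_FLIP \<in> NP_class"
proof -
  have "{z. verifies z} \<in> P_class" by (rule P_classI[OF decidable_verifies])
  moreover have "\<forall>x. x \<in> two_FLIP \<longleftrightarrow>
      (\<exists>y. length y \<le> poly [:0, 1:] (length x) \<and> pair_word x y \<in> {z. verifies z})"
    using two_FLIP_verifies by simp
  ultimately show ?thesis unfolding NP_class_def by blast
qed

section \<open>Formulas for nondeterministic computations\<close>

subsection \<open>Tapes relative to the heads\<close>

text \<open>The state is treated as the symbol under the fixed head of one more tape.\<close>

fun cell :: "tm \<Rightarrow> config \<Rightarrow> nat \<Rightarrow> int \<Rightarrow> nat" where
  "cell M (q, ts) k d =
     (if k < ntapes M then fst (ts ! k) (snd (ts ! k) + d) else if d = 0 then q else 0)"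

definition reads :: "tm \<Rightarrow> config \<Rightarrow> nat list" where
  "reads M cf = map (\<lambda>k. cell M cf k 0) [0..<Suc (ntapes M)]"

text \<open>On tape number \<open>ntapes M\<close> the symbol written is the next state. A halted
  configuration is reproduced, in accordance with \<open>step\<close>, so the computation can be
  followed up to a fixed time.\<close>

definition writes :: "tm \<Rightarrow> nat list \<Rightarrow> nat \<Rightarrow> nat" where
  "writes M gs k = (let q = gs ! ntapes M; (q', as) = delta M q (take (ntapes M) gs) in
     if q < nstates M then (if k < ntapes M then fst (as ! k) else q') else gs ! k)"

definition shift :: "tm \<Rightarrow> nat list \<Rightarrow> nat \<Rightarrow> int" where
  "shift M gs k = (let q = gs ! ntapes M; (q', as) = delta M q (take (ntapes M) gs) in
     if q < nstates M \<and> k < ntapes M then offset (snd (as ! k)) else 0)"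

lemma offset_bounds: "-1 \<le> offset m" "offset m \<le> 1"
  by (cases m; simp)+

lemma shift_bounds: "-1 \<le> shift M gs k" "shift M gs k \<le> 1"
  using offset_bounds by (auto simp: shift_def Let_def case_prod_beta)

definition valid_config :: "tm \<Rightarrow> config \<Rightarrow> bool" where
  "valid_config M cf \<longleftrightarrow> fst cf \<le> nstates M \<and> length (snd cf) = ntapes M \<and>
     (\<forall>k < ntapes M. \<forall>i. fst (snd cf ! k) i < nsyms M)"

lemma read_fst_snd: "read p = fst p (snd p)"
  by (cases p) simp

lemma act_fst: "fst (act a p) = (fst p)(snd p := fst a)" and act_snd: "snd (act a p) = snd p + offset (snd a)"
  by (cases a; cases p; simp)+

lemma take_reads:
  assumes "length ts = ntapes M"
  shows "take (ntapes M) (reads M (q, ts)) = map read ts" "reads M (q, ts) ! ntapes M = q"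
proof -
  show "take (ntapes M) (reads M (q, ts)) = map read ts"
    using assms by (intro nth_equalityI) (simp_all add: reads_def read_fst_snd del: upt_Suc)
  show "reads M (q, ts) ! ntapes M = q"
    unfolding reads_def by (simp add: nth_append)
qed

lemma step_cases:
  assumes "turing_machine M" "valid_config M (q, ts)" "q < nstates M"
  obtains q' as where "delta M q (map read ts) = (q', as)" "q' \<le> nstates M" "length as = ntapes M"
    "\<And>k. k < ntapes M \<Longrightarrow> fst (as ! k) < nsyms M" "step M (q, ts) = (q', map2 act as ts)"
proof -
  obtain q' as where d: "delta M q (map read ts) = (q', as)" by (cases "delta M q (map read ts)")
  have "length (map read ts) = ntapes M \<and> (\<forall>g \<in> set (map read ts). g < nsyms M)"
  proof (intro conjI ballI)
    fix g assume "g \<in> set (map read ts)"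
    then obtain i where "i < length ts" "g = read (ts ! i)" by (auto simp: in_set_conv_nth)
    then show "g < nsyms M" using assms(2) by (simp add: valid_config_def read_fst_snd)
  qed (use assms(2) in \<open>simp add: valid_config_def\<close>)
  then have "fst (delta M q (map read ts)) \<le> nstates M \<and> length (snd (delta M q (map read ts))) = ntapes M \<and>
      (\<forall>(w, m) \<in> set (snd (delta M q (map read ts))). w < nsyms M)"
    using assms(1,3) unfolding turing_machine_def by blast
  then have "q' \<le> nstates M" "length as = ntapes M" "\<forall>a \<in> set as. fst a < nsyms M"
    by (auto simp: d)
  then show thesis using that d assms(3) by simp
qed

lemma valid_step:
  assumes "turing_machine M" "valid_config M cf"
  shows "valid_config M (step M cf)"
proof (cases cf)
  case (Pair q ts)
  show ?thesis
  proof (cases "q < nstates M")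
    case True
    obtain q' as where "q' \<le> nstates M" "length as = ntapes M"
      "\<And>k. k < ntapes M \<Longrightarrow> fst (as ! k) < nsyms M" "step M (q, ts) = (q', map2 act as ts)"
      using step_cases[OF assms(1) assms(2)[unfolded Pair] True] by metis
    then show ?thesis using assms(2) by (simp add: Pair valid_config_def act_fst)
  qed (use assms(2) Pair in simp)
qed

lemma valid_start: "turing_machine M \<Longrightarrow> valid_config M (start_config M x)"
  by (auto simp: valid_config_def start_config_def turing_machine_def tape_of_def nth_Cons split: nat.split)

lemma valid_run: "turing_machine M \<Longrightarrow> valid_config M ((step M ^^ t) (start_config M x))"
  by (induction t) (auto simp: valid_start intro: valid_step)

text \<open>Offset \<open>d\<close> from the new head is offset \<open>d\<close> plus the movement
  from the old head, and the only cell that changes is the one at old offset 0. The state fits the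
  same formula, with a head that never moves.\<close>

lemma cell_step:
  assumes M: "turing_machine M" and v: "valid_config M cf" and k: "k \<le> ntapes M"
  shows "cell M (step M cf) k d = (if d + shift M (reads M cf) k = 0 then writes M (reads M cf) k
    else cell M cf k (d + shift M (reads M cf) k))"
proof (cases cf)
  case (Pair q ts)
  have len: "length ts = ntapes M" using v by (simp add: Pair valid_config_def)
  note rd = take_reads[OF len, of q]
  show ?thesis
  proof (cases "q < nstates M")
    case True
    obtain q' as where st: "delta M q (map read ts) = (q', as)" "length as = ntapes M"
      "step M (q, ts) = (q', map2 act as ts)"
      using step_cases[OF M v[unfolded Pair] True] by metis
    show ?thesis
    proof (cases "k < ntapes M")
      case True
      then show ?thesis using st len \<open>q < nstates M\<close>
        by (simp add: Pair shift_def writes_def rd act_fst act_snd algebra_simps)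
    next
      case False
      then show ?thesis using st \<open>q < nstates M\<close>
        by (simp add: Pair shift_def writes_def rd)
    qed
  next
    case False
    have "reads M (q, ts) ! k = cell M (q, ts) k 0"
      using k by (simp add: reads_def del: upt_Suc cell.simps)
    then show ?thesis using False
      by (simp add: Pair shift_def writes_def rd case_prod_beta)
  qed
qed

lemma cell_bound:
  assumes "valid_config M cf"
  shows "cell M cf k d < nsyms M + nstates M + 1"
proof (cases cf)
  case (Pair q ts)
  then have "k < ntapes M \<Longrightarrow> fst (ts ! k) (snd (ts ! k) + d) < nsyms M" "q \<le> nstates M"
    using assms by (auto simp: valid_config_def)
  then show ?thesis by (auto simp: Pair)
qed

text \<open>This keeps the output cell at absolute position 0 within reach of the window around the
  head.\<close>

lemma head_bound:
  assumes "turing_machine M" "k < ntapes M"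
  shows "\<bar>snd (snd ((step M ^^ t) (start_config M x)) ! k)\<bar> \<le> int t"
proof (induction t)
  case 0
  then show ?case using assms by (auto simp: start_config_def nth_Cons split: nat.split)
next
  case (Suc t)
  let ?cf = "(step M ^^ t) (start_config M x)"
  obtain q ts where cf: "?cf = (q, ts)" by (cases ?cf)
  have v: "valid_config M (q, ts)" using valid_run[OF assms(1), of t x] by (simp add: cf)
  show ?case
  proof (cases "q < nstates M")
    case True
    obtain q' as where st: "length as = ntapes M" "step M (q, ts) = (q', map2 act as ts)"
      using step_cases[OF assms(1) v True] by metis
    have "length ts = ntapes M" using v by (simp add: valid_config_def)
    then have "snd (snd (step M ?cf) ! k) = snd (ts ! k) + offset (snd (as ! k))"
      using st assms(2) by (simp add: cf act_snd)
    then show ?thesis using Suc offset_bounds[of "snd (as ! k)"] by (simp add: cf)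
  qed (use Suc cf in simp)
qed

subsection \<open>Numbers as tuples of digits\<close>

definition digit :: "nat \<Rightarrow> nat \<Rightarrow> nat \<Rightarrow> nat" where
  "digit y i v = v div y ^ i mod y"

lemma digit_0: "a < y \<Longrightarrow> digit y 0 (u * y + a) = a"
  by (simp add: digit_def)

lemma digit_pos: "a < y \<Longrightarrow> 0 < i \<Longrightarrow> digit y i (u * y + a) = digit y (i - 1) u"
  by (cases i) (simp_all add: digit_def div_mult2_eq)

lemma digit_single: "a < y \<Longrightarrow> digit y 0 a = a"
  by (simp add: digit_def)

lemma digit_less: "0 < y \<Longrightarrow> digit y i v < y"
  by (simp add: digit_def)

lemma append_digit_less:
  fixes y :: nat
  shows "a < y \<Longrightarrow> u < y ^ i \<Longrightarrow> u * y + a < y ^ Suc i"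
proof -
  assume "a < y" "u < y ^ i"
  then have "u * y + a < Suc u * y" "Suc u * y \<le> y ^ i * y" by (simp, intro mult_le_mono1) simp
  then show ?thesis by (simp add: mult.commute)
qed

lemma digits_4:
  assumes "t < y" "k < y" "d < y" "g < y"
  defines "v \<equiv> ((t * y + k) * y + d) * y + g"
  shows "v < y ^ 4" "digit y 3 v = t" "digit y 2 v = k" "digit y 1 v = d" "digit y 0 v = g"
proof -
  have "v < y ^ Suc (Suc (Suc (Suc 0)))"
    unfolding v_def using assms by (intro append_digit_less) simp_all
  also have "Suc (Suc (Suc (Suc 0))) = 4" by simp
  finally show "v < y ^ 4" .
  show "digit y 3 v = t" "digit y 2 v = k" "digit y 1 v = d" "digit y 0 v = g"
    unfolding v_def using assms by (simp_all add: digit_0 digit_pos digit_single)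
qed

lemma digits_4_inverse:
  assumes "v < y ^ 4"
  shows "((digit y 3 v * y + digit y 2 v) * y + digit y 1 v) * y + digit y 0 v = v"
proof -
  have "y ^ 4 = y * y ^ 3" using power_Suc[of y 3] by simp
  then have "v div y ^ 3 < y" using assms by (intro less_mult_imp_div_less) simp
  then have 3: "digit y 3 v = v div y ^ 3" by (simp add: digit_def)
  have s: "v div y ^ j * y + digit y i v = v div y ^ i" if "j = Suc i" for i j
    unfolding digit_def that by (simp only: power_Suc2 div_mult2_eq div_mult_mod_eq)
  have "v div y ^ 3 * y + digit y 2 v = v div y ^ 2" by (rule s) simp
  moreover have "v div y ^ 2 * y + digit y 1 v = v div y ^ 1" by (rule s) simp
  moreover have "v div y ^ 1 * y + digit y 0 v = v div y ^ 0" by (rule s) simp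
  moreover have "v div y ^ 0 = v" by simp
  ultimately show ?thesis unfolding 3 by (simp only:)
qed

lemma digits_6:
  assumes "c < y" "j < y" "t < y" "k < y" "d < y" "g < y"
  defines "v \<equiv> ((((c * y + j) * y + t) * y + k) * y + d) * y + g"
  shows "v < y ^ 6" "digit y 5 v = c" "digit y 4 v = j" "digit y 3 v = t" "digit y 2 v = k"
    "digit y 1 v = d" "digit y 0 v = g"
proof -
  have "v < y ^ Suc (Suc (Suc (Suc (Suc (Suc 0)))))"
    unfolding v_def using assms by (intro append_digit_less) simp_all
  also have "Suc (Suc (Suc (Suc (Suc (Suc 0))))) = 6" by simp
  finally show "v < y ^ 6" .
  show "digit y 5 v = c" "digit y 4 v = j" "digit y 3 v = t" "digit y 2 v = k"
    "digit y 1 v = d" "digit y 0 v = g"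
    unfolding v_def using assms by (simp_all add: digit_0 digit_pos digit_single)
qed

lemma ex4_lessI:
  fixes y :: nat
  shows "a < y \<Longrightarrow> b < y \<Longrightarrow> c < y \<Longrightarrow> d < y \<Longrightarrow> P a b c d \<Longrightarrow>
    \<exists>a'<y. \<exists>b'<y. \<exists>c'<y. \<exists>d'<y. P a' b' c' d'"
  by blast

text \<open>Clauses are 6-tuples and variables 4-tuples. \<open>satisfiable\<close> has one size for
  both, namely \<open>y ^ 6\<close>; numbers from \<open>y ^ 4\<close> on are variables that occur
  in no clause.\<close>

lemma satisfiable_digits:
  assumes y: "0 < y"
    and lit: "\<And>C v. lit C v = (if v < y ^ 4 then
      l (digit y 5 C) (digit y 4 C) (digit y 3 C) (digit y 2 C) (digit y 1 C) (digit y 0 C)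
        (digit y 3 v) (digit y 2 v) (digit y 1 v) (digit y 0 v) else 0)"
  shows "satisfiable (y ^ 6) lit \<longleftrightarrow> (\<exists>\<phi>. \<forall>c<y. \<forall>j<y. \<forall>t<y. \<forall>k<y. \<forall>d<y. \<forall>g<y.
    \<exists>t'<y. \<exists>k'<y. \<exists>d'<y. \<exists>g'<y.
      l c j t k d g t' k' d' g' = 1 \<and> \<phi> t' k' d' g' \<or> l c j t k d g t' k' d' g' = 2 \<and> \<not> \<phi> t' k' d' g')"
    (is "_ \<longleftrightarrow> (\<exists>\<phi>. ?sat \<phi>)")
proof
  assume "satisfiable (y ^ 6) lit"
  from this[unfolded satisfiable_def] obtain \<sigma> where \<sigma>: "\<forall>C<y ^ 6. \<exists>v<y ^ 6. lit C v = 1 \<and> \<sigma> v \<or> lit C v = 2 \<and> \<not> \<sigma> v"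
    by (rule exE)
  define \<phi> where "\<phi> t k d g = \<sigma> (((t * y + k) * y + d) * y + g)" for t k d g
  show "\<exists>\<phi>. ?sat \<phi>"
  proof (intro exI[of _ \<phi>] allI impI)
    fix c j t k d g assume "c < y" "j < y" "t < y" "k < y" "d < y" "g < y"
    note C = digits_6[OF this]
    obtain v where v: "lit (((((c * y + j) * y + t) * y + k) * y + d) * y + g) v = 1 \<and> \<sigma> v \<or>
        lit (((((c * y + j) * y + t) * y + k) * y + d) * y + g) v = 2 \<and> \<not> \<sigma> v"
      using \<sigma>[rule_format, OF C(1)] by (elim exE conjE)
    have less: "v < y ^ 4"
    proof (rule ccontr)
      assume "\<not> v < y ^ 4"
      then have "lit C v = 0" for C unfolding lit by (simp only: if_False)
      then show False using v by simp
    qed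
    have \<phi>v: "\<phi> (digit y 3 v) (digit y 2 v) (digit y 1 v) (digit y 0 v) = \<sigma> v"
      unfolding \<phi>_def digits_4_inverse[OF less] ..
    show "\<exists>t'<y. \<exists>k'<y. \<exists>d'<y. \<exists>g'<y.
      l c j t k d g t' k' d' g' = 1 \<and> \<phi> t' k' d' g' \<or> l c j t k d g t' k' d' g' = 2 \<and> \<not> \<phi> t' k' d' g'"
    proof (rule ex4_lessI)
      show "l c j t k d g (digit y 3 v) (digit y 2 v) (digit y 1 v) (digit y 0 v) = 1 \<and>
          \<phi> (digit y 3 v) (digit y 2 v) (digit y 1 v) (digit y 0 v) \<or>
        l c j t k d g (digit y 3 v) (digit y 2 v) (digit y 1 v) (digit y 0 v) = 2 \<and>
          \<not> \<phi> (digit y 3 v) (digit y 2 v) (digit y 1 v) (digit y 0 v)"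
        using v unfolding lit C if_P[OF less] \<phi>v .
    qed (rule digit_less[OF y])+
  qed
next
  assume "\<exists>\<phi>. ?sat \<phi>"
  then obtain \<phi> where \<phi>: "?sat \<phi>" by (rule exE)
  show "satisfiable (y ^ 6) lit"
    unfolding satisfiable_def
  proof (intro exI[of _ "\<lambda>v. \<phi> (digit y 3 v) (digit y 2 v) (digit y 1 v) (digit y 0 v)"] allI impI)
    fix C
    obtain t k d g where "t < y" "k < y" "d < y" "g < y" and
      h: "l (digit y 5 C) (digit y 4 C) (digit y 3 C) (digit y 2 C) (digit y 1 C) (digit y 0 C) t k d g = 1 \<and> \<phi> t k d g
        \<or> l (digit y 5 C) (digit y 4 C) (digit y 3 C) (digit y 2 C) (digit y 1 C) (digit y 0 C) t k d g = 2 \<and> \<not> \<phi> t k d g"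
      using \<phi>[rule_format, OF digit_less[OF y] digit_less[OF y] digit_less[OF y] digit_less[OF y]
          digit_less[OF y] digit_less[OF y], of 5 C 4 C 3 C 2 C 1 C 0 C] by (elim exE conjE)
    note v = digits_4[OF this(1-4)]
    have "y ^ 4 \<le> y ^ 6" using y by (intro power_increasing) simp_all
    then have "((t * y + k) * y + d) * y + g < y ^ 6" using v(1) by (rule less_le_trans[rotated])
    then show "\<exists>v<y ^ 6. lit C v = 1 \<and> \<phi> (digit y 3 v) (digit y 2 v) (digit y 1 v) (digit y 0 v) \<or>
       lit C v = 2 \<and> \<not> \<phi> (digit y 3 v) (digit y 2 v) (digit y 1 v) (digit y 0 v)"
      using h unfolding lit
      by (intro exI[of _ "((t * y + k) * y + d) * y + g"] conjI) (simp_all only: v if_True)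
  qed
qed

subsection \<open>The tableau\<close>

lemma poly_nat_mono:
  fixes p :: "nat poly"
  shows "a \<le> b \<Longrightarrow> poly p a \<le> poly p b"
  by (induction p) (auto intro!: add_mono mult_mono)

locale tableau =
  fixes M :: tm and R :: "bool list set" and pt pw :: "nat poly"
  assumes M: "turing_machine M"
    and time: "computes_in_time M (\<lambda>z. [z \<in> R]) (poly pt)"
begin

abbreviation K :: nat where
  "K \<equiv> ntapes M"

definition S :: nat where
  "S = nsyms M + nstates M + 1"

text \<open>All tuples of symbols, the state included, that the heads might read. The list depends
  on the machine only, so a clause can name a tuple by its index and the transition function becomes
  a constant table.\<close>

definition Gs :: "nat list list" where
  "Gs = List.n_lists (Suc K) [0..<S]"

text \<open>The inputs \<open>pair_word x y\<close> share their first \<open>prefix_len x\<close> bits and have length at most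
  \<open>input_len x\<close>. The computation is followed on a window of radius \<open>radius x - t\<close> around the heads
  at time \<open>t\<close>, so that no boundary conditions are needed.\<close>

definition prefix_len :: "bool list \<Rightarrow> nat" where
  "prefix_len x = 2 * length x + 2"

definition input_len :: "bool list \<Rightarrow> nat" where
  "input_len x = prefix_len x + poly pw (length x)"

definition end_time :: "bool list \<Rightarrow> nat" where
  "end_time x = poly pt (input_len x)"

definition radius :: "bool list \<Rightarrow> nat" where
  "radius x = input_len x + 2 * end_time x + 1"

text \<open>One bound for every component of clauses and variables. The summand 10 also makes room
  for the ten kinds of vertices of the graph.\<close>

definition range_bound :: "bool list \<Rightarrow> nat" where
  "range_bound x = end_time x + 2 * radius x + K + S + length Gs + 10"

definition prefix_sym :: "bool list \<Rightarrow> nat \<Rightarrow> nat" where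
  "prefix_sym x d = (if d < 2 * length x then tape_of x (int (d div 2)) else if d = 2 * length x then 1 else 2)"

definition allowed :: "bool list \<Rightarrow> nat \<Rightarrow> nat \<Rightarrow> nat \<Rightarrow> bool" where
  "allowed x k d g \<longleftrightarrow>
     (if k = 0 \<and> radius x \<le> d \<and> d < radius x + prefix_len x then g = prefix_sym x (d - radius x)
      else if k = 0 \<and> radius x \<le> d \<and> d < radius x + input_len x then g \<le> 2 else g = 0)"

definition read_sym :: "nat \<Rightarrow> nat \<Rightarrow> nat" where
  "read_sym j k = (if j < length Gs \<and> k < Suc K then Gs ! j ! k else 0)"

definition write_sym :: "nat \<Rightarrow> nat \<Rightarrow> nat" where
  "write_sym j k = (if j < length Gs \<and> k < Suc K then writes M (Gs ! j) k else 0)"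

text \<open>The movement is raised by 1 to be a natural number: 0 is left, 1 is no movement, 2 is
  right.\<close>

definition head_move :: "nat \<Rightarrow> nat \<Rightarrow> nat" where
  "head_move j k = (if j < length Gs \<and> k < Suc K then nat (shift M (Gs ! j) k + 1) else 0)"

text \<open>The variable \<open>(t, k, d, g)\<close> says that at time \<open>t\<close> the tape \<open>k\<close> carries the symbol \<open>g\<close> at
  position \<open>d - radius x\<close> relative to its head. The clauses \<open>(c, j, t, k, d, g)\<close> of type \<open>c = 0\<close> are
  implications that describe a step in which the heads read \<open>Gs ! j\<close>, those of types 1 and 2 describe the start,
  where in the guessed part blanks are followed by blanks, and those of type 3 exclude the
  output 0. All other numbers stand for a clause that says that the machine begins in state 0.\<close>

definition is_step :: "bool list \<Rightarrow> nat \<Rightarrow> nat \<Rightarrow> nat \<Rightarrow> nat \<Rightarrow> nat \<Rightarrow> bool" where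
  "is_step x c j t k d \<longleftrightarrow> c = 0 \<and> j < length Gs \<and> t < end_time x \<and> k \<le> K \<and> 1 \<le> d \<and> d \<le> 2 * radius x"

definition is_blank :: "bool list \<Rightarrow> nat \<Rightarrow> nat \<Rightarrow> bool" where
  "is_blank x c d \<longleftrightarrow> c = 2 \<and> radius x + prefix_len x \<le> d \<and> d \<le> 2 * radius x"

text \<open>In a step clause \<open>d' + head_move j k = d + 1\<close> expresses that the cell at
  \<open>d\<close> moves against the head; the condition \<open>1 \<le> d\<close> of
  \<open>is_step\<close> ensures a natural solution even for a move to the right. Type 3 has no
  positive literal, hence \<open>c \<noteq> 3\<close> in the last case.\<close>

definition pos :: "bool list \<Rightarrow> nat \<Rightarrow> nat \<Rightarrow> nat \<Rightarrow> nat \<Rightarrow> nat \<Rightarrow> nat \<Rightarrow> nat \<Rightarrow> nat \<Rightarrow> nat \<Rightarrow> nat \<Rightarrow> bool" where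
  "pos x c j t k d g t' k' d' g' \<longleftrightarrow>
     (if is_step x c j t k d then
        t' = t + 1 \<and> k' = k \<and> d' + head_move j k = d + 1 \<and> g' = (if d = radius x then write_sym j k else g)
      else if c = 1 \<and> k \<le> K then t' = 0 \<and> k' = k \<and> d' = d \<and> allowed x k d g'
      else if is_blank x c d then t' = 0 \<and> k' = 0 \<and> d' = d + 1 \<and> g' = 0
      else c \<noteq> 3 \<and> t' = 0 \<and> k' = K \<and> d' = radius x \<and> g' = 0)"

definition neg :: "bool list \<Rightarrow> nat \<Rightarrow> nat \<Rightarrow> nat \<Rightarrow> nat \<Rightarrow> nat \<Rightarrow> nat \<Rightarrow> nat \<Rightarrow> nat \<Rightarrow> nat \<Rightarrow> nat \<Rightarrow> bool" where
  "neg x c j t k d g t' k' d' g' \<longleftrightarrow>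
     (if is_step x c j t k d then
        t' = t \<and> (k' \<le> K \<and> d' = radius x \<and> g' = read_sym j k' \<or> k' = k \<and> d' = d \<and> g' = g)
      else if is_blank x c d then t' = 0 \<and> k' = 0 \<and> d' = d \<and> g' = 0
      else c = 3 \<and> t' = end_time x \<and> k' = 1 \<and> d' = d \<and> g' = 1)"

definition literal :: "bool list \<Rightarrow> nat \<Rightarrow> nat \<Rightarrow> nat \<Rightarrow> nat \<Rightarrow> nat \<Rightarrow> nat \<Rightarrow> nat \<Rightarrow> nat \<Rightarrow> nat \<Rightarrow> nat \<Rightarrow> nat" where
  "literal x c j t k d g t' k' d' g' = (if pos x c j t k d g t' k' d' g' then 1
     else if neg x c j t k d g t' k' d' g' then 2 else 0)"

definition satisfied :: "bool list \<Rightarrow> (nat \<Rightarrow> nat \<Rightarrow> nat \<Rightarrow> nat \<Rightarrow> bool) \<Rightarrow> bool" where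
  "satisfied x \<phi> \<longleftrightarrow> (let y = range_bound x in \<forall>c<y. \<forall>j<y. \<forall>t<y. \<forall>k<y. \<forall>d<y. \<forall>g<y.
    \<exists>t'<y. \<exists>k'<y. \<exists>d'<y. \<exists>g'<y.
      literal x c j t k d g t' k' d' g' = 1 \<and> \<phi> t' k' d' g' \<or>
      literal x c j t k d g t' k' d' g' = 2 \<and> \<not> \<phi> t' k' d' g')"

definition conf :: "bool list \<Rightarrow> nat \<Rightarrow> config" where
  "conf z t = (step M ^^ t) (start_config M z)"

lemma bounds:
  "end_time x < range_bound x" "2 * radius x + 9 < range_bound x" "K < range_bound x"
  "S < range_bound x" "length Gs < range_bound x" "input_len x + 2 * end_time x < radius x"
  "10 \<le> range_bound x"
  by (simp_all add: range_bound_def radius_def)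

lemma K2: "2 \<le> K"
  using M by (simp add: turing_machine_def)

lemma mem_Gs: "gs \<in> set Gs \<longleftrightarrow> length gs = Suc K \<and> set gs \<subseteq> {..<S}"
  unfolding Gs_def set_n_lists by auto

lemma reads_Gs:
  obtains j where "j < length Gs" "Gs ! j = reads M (conf z t)"
proof -
  have "reads M (conf z t) \<in> set Gs"
    using cell_bound[OF valid_run[OF M, of t z]]
    unfolding mem_Gs reads_def S_def conf_def by (auto simp del: upt_Suc)
  then show thesis using that unfolding in_set_conv_nth by (elim exE conjE)
qed

lemma nth_reads: "k \<le> K \<Longrightarrow> reads M cf ! k = cell M cf k 0"
  by (simp add: reads_def del: upt_Suc cell.simps)

lemma conf_Suc: "conf z (Suc t) = step M (conf z t)"
  by (simp add: conf_def)

lemma cell_conf_Suc: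
  assumes "k \<le> K" "j < length Gs" "Gs ! j = reads M (conf z t)"
  shows "cell M (conf z (Suc t)) k (d + 1 - int (head_move j k)) =
    (if d = 0 then write_sym j k else cell M (conf z t) k d)"
proof -
  have "int (head_move j k) = shift M (reads M (conf z t)) k + 1"
    using assms shift_bounds[of M "reads M (conf z t)" k] by (simp add: head_move_def)
  then show ?thesis
    using assms cell_step[OF M valid_run[OF M, of t z] assms(1)]
    by (simp add: conf_Suc write_sym_def conf_def)
qed

lemma head_move_le: "head_move j k \<le> 2"
  using shift_bounds[of M "Gs ! j" k] by (simp add: head_move_def nat_le_iff)

lemma cell_conf_less: "cell M (conf z t) k d < S"
  unfolding conf_def S_def by (rule cell_bound[OF valid_run[OF M]])

lemma cell_start:
  "k \<le> K \<Longrightarrow> cell M (conf z 0) k d = (if k = 0 then tape_of z d else 0)"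
  using K2 by (auto simp: conf_def start_config_def nth_Cons tape_of_def split: nat.split)

lemma conf_end:
  assumes "poly pt (length z) \<le> t"
  shows "fst (snd (conf z t) ! 1) = tape_of [z \<in> R]"
proof -
  obtain t0 ts where t0: "t0 \<le> poly pt (length z)" "(step M ^^ t0) (start_config M z) = (nstates M, ts)"
    "fst (ts ! 1) = tape_of [z \<in> R]"
    using time[unfolded computes_in_time_def, THEN spec[of _ z]] by (elim exE conjE)
  have halt: "(step M ^^ n) (nstates M, ts) = (nstates M, ts)" for n by (induction n) auto
  obtain n where "t = t0 + n" using le_Suc_ex[OF order_trans[OF t0(1) assms]] ..
  then have "conf z t = (nstates M, ts)"
    by (simp add: conf_def funpow_add_apply t0(2) halt)
  then show ?thesis using t0(3) by simp
qed

lemma tape_prefix: "d < prefix_len x \<Longrightarrow> tape_of (pair_word x y) (int d) = prefix_sym x d"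
proof -
  assume d: "d < prefix_len x"
  consider i where "i < length x" "d = 2 * i" | i where "i < length x" "d = 2 * i + 1"
    | "d = 2 * length x" | "d = 2 * length x + 1"
  proof -
    have "d = 2 * (d div 2) \<or> d = 2 * (d div 2) + 1" by presburger
    moreover have "d div 2 < length x \<or> d = 2 * length x \<or> d = 2 * length x + 1"
      using d unfolding prefix_len_def by linarith
    ultimately show thesis using that by blast
  qed
  then show ?thesis
  proof cases
    case (1 i)
    then show ?thesis using tape_pair_word(1)[of i x y] by (simp add: prefix_sym_def tape_of_def)
  next
    case (2 i)
    then show ?thesis using tape_pair_word(2)[of i x y] by (simp add: prefix_sym_def tape_of_def)
  next
    case 3
    then show ?thesis using tape_pair_word(3)[of x y] by (simp add: prefix_sym_def)
  next
    case 4
    then show ?thesis using tape_pair_word(4)[of x y] by (simp add: prefix_sym_def)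
  qed
qed

lemma tape_witness: "tape_of (pair_word x y) (int (prefix_len x + i)) = tape_of y (int i)"
  using tape_pair_word(5)[of x y i] by (simp add: prefix_len_def)

section \<open>Facts forced in every satisfying valuation\<close>

lemma satisfied_clause:
  assumes "satisfied x \<phi>" "c < range_bound x" "j < range_bound x" "t < range_bound x" "k < range_bound x"
    "d < range_bound x" "g < range_bound x"
  shows "\<exists>t' k' d' g'. pos x c j t k d g t' k' d' g' \<and> \<phi> t' k' d' g' \<or>
    neg x c j t k d g t' k' d' g' \<and> \<not> \<phi> t' k' d' g'"
proof -
  obtain t' k' d' g' where "literal x c j t k d g t' k' d' g' = 1 \<and> \<phi> t' k' d' g' \<or>
      literal x c j t k d g t' k' d' g' = 2 \<and> \<not> \<phi> t' k' d' g'"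
    using assms(1)[unfolded satisfied_def Let_def, rule_format, OF assms(2-7)] by (elim exE conjE)
  then have "pos x c j t k d g t' k' d' g' \<and> \<phi> t' k' d' g' \<or>
      neg x c j t k d g t' k' d' g' \<and> \<not> \<phi> t' k' d' g'"
    by (auto simp: literal_def split: if_splits)
  then show ?thesis by blast
qed

lemma start_clause:
  assumes "satisfied x \<phi>" "k \<le> K" "d \<le> 2 * radius x"
  shows "\<exists>g. allowed x k d g \<and> \<phi> 0 k d g"
proof -
  have "\<exists>t' k' d' g'. pos x 1 0 0 k d 0 t' k' d' g' \<and> \<phi> t' k' d' g' \<or>
      neg x 1 0 0 k d 0 t' k' d' g' \<and> \<not> \<phi> t' k' d' g'"
    by (rule satisfied_clause[OF assms(1)]) (use assms(2,3) bounds[of x] in linarith)+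
  then show ?thesis using assms(2) by (auto simp: pos_def neg_def is_step_def is_blank_def)
qed

lemma blank_clause:
  assumes "satisfied x \<phi>" "radius x + prefix_len x \<le> d" "d \<le> 2 * radius x" "\<phi> 0 0 d 0"
  shows "\<phi> 0 0 (d + 1) 0"
proof -
  have "\<exists>t' k' d' g'. pos x 2 0 0 0 d 0 t' k' d' g' \<and> \<phi> t' k' d' g' \<or>
      neg x 2 0 0 0 d 0 t' k' d' g' \<and> \<not> \<phi> t' k' d' g'"
    by (rule satisfied_clause[OF assms(1)]) (use assms(2,3) bounds[of x] in linarith)+
  then show ?thesis using assms(2-) by (auto simp: pos_def neg_def is_step_def is_blank_def)
qed

lemma final_clause:
  assumes "satisfied x \<phi>" "d \<le> 2 * radius x"
  shows "\<not> \<phi> (end_time x) 1 d 1"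
proof -
  have "\<exists>t' k' d' g'. pos x 3 0 0 0 d 0 t' k' d' g' \<and> \<phi> t' k' d' g' \<or>
      neg x 3 0 0 0 d 0 t' k' d' g' \<and> \<not> \<phi> t' k' d' g'"
    by (rule satisfied_clause[OF assms(1)]) (use assms(2) bounds[of x] in linarith)+
  then show ?thesis by (auto simp: pos_def neg_def is_step_def is_blank_def)
qed

lemma step_clause:
  assumes "satisfied x \<phi>" "is_step x 0 j t k d" "g < S"
    and rd: "\<And>k'. k' \<le> K \<Longrightarrow> \<phi> t k' (radius x) (read_sym j k')" and cell: "\<phi> t k d g"
  shows "\<exists>d'. d' + head_move j k = d + 1 \<and>
    \<phi> (t + 1) k d' (if d = radius x then write_sym j k else g)"
proof -
  have "j < length Gs" "t < end_time x" "k \<le> K" "d \<le> 2 * radius x"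
    using assms(2) by (auto simp: is_step_def)
  then have "\<exists>t' k' d' g'. pos x 0 j t k d g t' k' d' g' \<and> \<phi> t' k' d' g' \<or>
      neg x 0 j t k d g t' k' d' g' \<and> \<not> \<phi> t' k' d' g'"
    by (intro satisfied_clause[OF assms(1)]) (use assms(3) bounds[of x] in linarith)+
  then obtain t' k' d' g' where *: "pos x 0 j t k d g t' k' d' g' \<and> \<phi> t' k' d' g' \<or>
      neg x 0 j t k d g t' k' d' g' \<and> \<not> \<phi> t' k' d' g'" by (elim exE)
  have "\<not> (neg x 0 j t k d g t' k' d' g' \<and> \<not> \<phi> t' k' d' g')"
    using assms(2) rd cell by (auto simp: neg_def)
  then have "pos x 0 j t k d g t' k' d' g'" "\<phi> t' k' d' g'" using * by auto
  then show ?thesis using assms(2) by (intro exI[of _ d']) (auto simp: pos_def)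
qed

definition guessed :: "bool list \<Rightarrow> (nat \<Rightarrow> nat \<Rightarrow> nat \<Rightarrow> nat \<Rightarrow> bool) \<Rightarrow> nat \<Rightarrow> bool" where
  "guessed x \<phi> i \<longleftrightarrow> i < poly pw (length x) \<and>
     (\<phi> 0 0 (radius x + prefix_len x + i) 1 \<or> \<phi> 0 0 (radius x + prefix_len x + i) 2)"

text \<open>The word ends before the first cell that is not marked with a bit. A cell may be marked
  with both bits; the bit 1 is chosen then, and either choice agrees with a fact of the
  valuation.\<close>

definition witness :: "bool list \<Rightarrow> (nat \<Rightarrow> nat \<Rightarrow> nat \<Rightarrow> nat \<Rightarrow> bool) \<Rightarrow> bool list" where
  "witness x \<phi> = map (\<lambda>i. \<phi> 0 0 (radius x + prefix_len x + i) 2) [0..<LEAST i. \<not> guessed x \<phi> i]"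

lemma length_witness: "length (witness x \<phi>) \<le> poly pw (length x)"
  unfolding witness_def by (simp add: Least_le guessed_def)

text \<open>Outside the guessed part the start clauses allow a single symbol. In the guessed part
  the witness was read off the valuation, and behind it blanks are forced.\<close>

lemma start_facts:
  assumes sat: "satisfied x \<phi>" and k: "k \<le> K" and d: "d \<le> 2 * radius x"
  shows "\<phi> 0 k d (cell M (conf (pair_word x (witness x \<phi>)) 0) k (int d - int (radius x)))"
proof -
  let ?y = "witness x \<phi>" and ?p = "radius x + prefix_len x"
  define l where "l = (LEAST i. \<not> guessed x \<phi> i)"
  have ly: "length ?y = l" by (simp add: witness_def l_def)
  have ng: "\<not> guessed x \<phi> l"
    unfolding l_def by (rule LeastI[of _ "poly pw (length x)"]) (simp add: guessed_def)
  have g: "guessed x \<phi> i" if "i < l" for i using not_less_Least[of i "\<lambda>i. \<not> guessed x \<phi> i"] that l_def by blast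
  note st = start_clause[OF sat k d]
  have small: "input_len x < radius x" using bounds(6)[of x] by simp
  show ?thesis
  proof (cases "k = 0 \<and> radius x \<le> d")
    case False
    then have "allowed x k d g \<longleftrightarrow> g = 0" for g by (auto simp: allowed_def)
    moreover have "cell M (conf (pair_word x ?y) 0) k (int d - int (radius x)) = 0"
      using False by (auto simp: cell_start[OF k] tape_of_def)
    ultimately show ?thesis using st by auto
  next
    case True
    define i where "i = d - radius x"
    have di: "d = radius x + i" "int d - int (radius x) = int i" using True by (simp_all add: i_def)
    have cell: "cell M (conf (pair_word x ?y) 0) k (int d - int (radius x)) = tape_of (pair_word x ?y) (int i)"
      using True by (simp add: cell_start di)
    show ?thesis
    proof (cases "i < prefix_len x")
      case True
      then have "allowed x k d g \<longleftrightarrow> g = prefix_sym x i" for g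
        using \<open>k = 0 \<and> radius x \<le> d\<close> by (simp add: allowed_def di)
      then show ?thesis using st tape_prefix[OF True, of ?y] unfolding cell by auto
    next
      case False
      define j where "j = i - prefix_len x"
      have ij: "i = prefix_len x + j" "d = ?p + j" using False di by (simp_all add: j_def)
      have cell': "cell M (conf (pair_word x ?y) 0) k (int d - int (radius x)) = tape_of ?y (int j)"
        unfolding cell ij(1) by (rule tape_witness)
      show ?thesis
      proof (cases "j < l")
        case True
        then have "tape_of ?y (int j) = (if \<phi> 0 0 d 2 then 2 else 1)"
          by (simp add: tape_of_def ly) (simp add: witness_def ij l_def)
        moreover have "\<phi> 0 0 d 1 \<or> \<phi> 0 0 d 2" using g[OF True] by (simp add: guessed_def ij(2))
        ultimately show ?thesis using \<open>k = 0 \<and> radius x \<le> d\<close> unfolding cell' by auto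
      next
        case False
        \<comment> \<open>The cell at \<open>l\<close> has an allowed symbol which is neither bit,
          or lies beyond the guessed part; it is blank in both cases. The blank clauses pass this on
          to the right.\<close>
        have blank: "\<phi> 0 0 (?p + l + n) 0" if "?p + l + n \<le> 2 * radius x" for n
          using that
        proof (induction n)
          case 0
          obtain g where g: "allowed x 0 (?p + l) g" "\<phi> 0 0 (?p + l) g"
            using start_clause[OF sat, of 0 "?p + l"] 0 by auto
          have "g = 0"
          proof (cases "l < poly pw (length x)")
            case True
            then have "g \<le> 2" using g(1) by (auto simp: allowed_def input_len_def split: if_splits)
            moreover have "g \<noteq> 1" "g \<noteq> 2" using ng True g(2) by (auto simp: guessed_def)
            ultimately show ?thesis by linarith
          next
            case False
            then show ?thesis using g(1) by (auto simp: allowed_def input_len_def split: if_splits)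
          qed
          then show ?case using g(2) by simp
        next
          case (Suc n)
          then show ?case using blank_clause[OF sat, of "?p + l + n"] by simp
        qed
        have "\<phi> 0 0 d 0" using blank[of "j - l"] False d ij by (simp add: add.assoc)
        moreover have "tape_of ?y (int j) = 0" using False by (simp add: tape_of_def ly)
        ultimately show ?thesis using \<open>k = 0 \<and> radius x \<le> d\<close> unfolding cell' by simp
      qed
    qed
  qed
qed

text \<open>A cell at the next time depends on the symbols at the heads and on a cell at most one
  position away, so the window of reliable facts loses one position on each side per step.\<close>

lemma run_facts:
  assumes sat: "satisfied x \<phi>"
  shows "t \<le> end_time x \<Longrightarrow> k \<le> K \<Longrightarrow> \<bar>d\<bar> + int t < int (radius x) \<Longrightarrow>
    \<phi> t k (nat (d + int (radius x))) (cell M (conf (pair_word x (witness x \<phi>)) t) k d)"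
proof (induction t arbitrary: k d)
  case 0
  then have "nat (d + int (radius x)) \<le> 2 * radius x" by linarith
  moreover have "int (nat (d + int (radius x))) - int (radius x) = d" using 0(3) by linarith
  ultimately show ?case using start_facts[OF sat 0(2), of "nat (d + int (radius x))"] by simp
next
  case (Suc t)
  let ?z = "pair_word x (witness x \<phi>)"
  obtain j where j: "j < length Gs" "Gs ! j = reads M (conf ?z t)" by (rule reads_Gs)
  have rd: "\<phi> t k' (radius x) (read_sym j k')" if "k' \<le> K" for k'
    using Suc.IH[of k' 0] Suc.prems that j nth_reads[OF that] by (simp add: read_sym_def)
  \<comment> \<open>The same cell, as seen from the head before the step; the -1 cancels the shift
    in \<open>head_move\<close>.\<close>
  define e where "e = d + int (head_move j k) - 1"
  have e: "\<bar>e\<bar> + int t < int (radius x)"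
    using Suc.prems(3) head_move_le[of j k] unfolding e_def by linarith
  let ?n = "nat (e + int (radius x))"
  have n: "1 \<le> ?n" "?n \<le> 2 * radius x" "?n = radius x \<longleftrightarrow> e = 0"
    using e Suc.prems(3) by linarith+
  have "is_step x 0 j t k ?n" using Suc.prems j n by (simp add: is_step_def)
  from step_clause[OF sat this cell_conf_less rd Suc.IH[OF _ Suc.prems(2) e]] Suc.prems(1)
  obtain d' where d': "d' + head_move j k = ?n + 1"
    "\<phi> (t + 1) k d' (if ?n = radius x then write_sym j k else cell M (conf ?z t) k e)" by auto
  have "d' = nat (d + int (radius x))" using d'(1) e Suc.prems(3) unfolding e_def by linarith
  moreover have "cell M (conf ?z (Suc t)) k d = (if e = 0 then write_sym j k else cell M (conf ?z t) k e)"
    using cell_conf_Suc[OF Suc.prems(2) j, of e] by (simp add: e_def)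
  ultimately show ?case using d'(2) n(3) by simp
qed

text \<open>The valuation contains the true fact about the output cell, whose symbol is 1 or 2, and
  the final clauses forbid 1, the symbol of the bit 0. They do so at all offsets because the
  position of the output head is not known.\<close>

lemma accepted_if_satisfied:
  assumes sat: "satisfied x \<phi>"
  shows "pair_word x (witness x \<phi>) \<in> R"
proof -
  let ?z = "pair_word x (witness x \<phi>)" and ?T = "end_time x"
  have "length ?z \<le> input_len x"
    using length_witness[of x \<phi>] by (simp add: length_pair_word input_len_def prefix_len_def)
  then have "fst (snd (conf ?z ?T) ! 1) = tape_of [?z \<in> R]"
    by (intro conf_end) (simp add: end_time_def poly_nat_mono)
  moreover define h where "h = snd (snd (conf ?z ?T) ! 1)"
  ultimately have c: "cell M (conf ?z ?T) 1 (- h) = tape_of [?z \<in> R] 0"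
    using K2 by (cases "conf ?z ?T") simp
  \<comment> \<open>The head is at most \<open>end_time x\<close> away from the origin and the
    window has shrunk by \<open>end_time x\<close>; this is the reason for the factor 2 in
    \<open>radius\<close>.\<close>
  have h: "\<bar>- h\<bar> + int ?T < int (radius x)"
    using head_bound[OF M, of 1 ?T ?z] K2 bounds(6)[of x] by (simp add: h_def conf_def)
  have "\<phi> ?T 1 (nat (- h + int (radius x))) (tape_of [?z \<in> R] 0)"
    using run_facts[OF sat le_refl _ h, of 1] K2 c by simp
  moreover have "nat (- h + int (radius x)) \<le> 2 * radius x" using h by linarith
  ultimately have "tape_of [?z \<in> R] 0 \<noteq> 1" using final_clause[OF sat] by metis
  then show ?thesis by (auto simp: tape_of_def split: if_splits)
qed

text \<open>The valuation that contains exactly the true facts satisfies every clause, as all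
  clauses are true statements about this accepting computation.\<close>

lemma satisfied_if_accepted:
  assumes y: "length y \<le> poly pw (length x)" and R: "pair_word x y \<in> R"
  shows "satisfied x (\<lambda>t k d g. cell M (conf (pair_word x y) t) k (int d - int (radius x)) = g)"
    (is "satisfied x ?\<phi>")
  unfolding satisfied_def Let_def
proof (intro allI impI)
  let ?z = "pair_word x y" and ?Y = "range_bound x"
  fix c j t k d g
  assume b: "c < ?Y" "j < ?Y" "t < ?Y" "k < ?Y" "d < ?Y" "g < ?Y"
  have goal: "\<exists>t'<?Y. \<exists>k'<?Y. \<exists>d'<?Y. \<exists>g'<?Y.
      literal x c j t k d g t' k' d' g' = 1 \<and> ?\<phi> t' k' d' g' \<or>
      literal x c j t k d g t' k' d' g' = 2 \<and> \<not> ?\<phi> t' k' d' g'"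
    if "t' < ?Y" "k' < ?Y" "d' < ?Y" "g' < ?Y" "pos x c j t k d g t' k' d' g' \<and> ?\<phi> t' k' d' g' \<or>
      neg x c j t k d g t' k' d' g' \<and> \<not> pos x c j t k d g t' k' d' g' \<and> \<not> ?\<phi> t' k' d' g'" for t' k' d' g'
    using that(5) by (intro ex4_lessI[OF that(1-4)]) (auto simp: literal_def)
  have SY: "n < S \<Longrightarrow> n < ?Y" for n using bounds(4)[of x] by simp
  consider "is_step x c j t k d" | "c = 1" "k \<le> K" | "is_blank x c d" | "c = 3"
    | "\<not> is_step x c j t k d" "\<not> (c = 1 \<and> k \<le> K)" "\<not> is_blank x c d" "c \<noteq> 3" by blast
  then show "\<exists>t'<?Y. \<exists>k'<?Y. \<exists>d'<?Y. \<exists>g'<?Y.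
      literal x c j t k d g t' k' d' g' = 1 \<and> ?\<phi> t' k' d' g' \<or>
      literal x c j t k d g t' k' d' g' = 2 \<and> \<not> ?\<phi> t' k' d' g'"
  proof cases
    case 1
    then have s: "j < length Gs" "t < end_time x" "k \<le> K" "1 \<le> d" "d \<le> 2 * radius x" by (auto simp: is_step_def)
    show ?thesis
    \<comment> \<open>If all premises hold, then \<open>Gs ! j\<close> is the tuple actually read
      and the conclusion is the next configuration. Otherwise a false premise satisfies the
      clause.\<close>
    proof (cases "(\<forall>k'\<le>K. ?\<phi> t k' (radius x) (read_sym j k')) \<and> ?\<phi> t k d g")
      case True
      have lenj: "length (Gs ! j) = Suc K"
        using nth_mem[OF s(1)] by (simp only: mem_Gs)
      have "Gs ! j = reads M (conf ?z t)"
      proof (rule nth_equalityI)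
        show "length (Gs ! j) = length (reads M (conf ?z t))" by (simp add: lenj reads_def)
        fix i assume "i < length (Gs ! j)"
        then have i: "i \<le> K" by (simp add: lenj)
        then show "Gs ! j ! i = reads M (conf ?z t) ! i"
          using True s(1) nth_reads[OF i] by (auto simp: read_sym_def)
      qed
      note cell_next = cell_conf_Suc[OF s(3,1) this, of "int d - int (radius x)"]
      let ?d = "d + 1 - head_move j k" and ?g = "if d = radius x then write_sym j k else g"
      have d': "?d + head_move j k = d + 1" using s(4) head_move_le[of j k] by simp
      then have eq: "int ?d - int (radius x) = int d - int (radius x) + 1 - int (head_move j k)" by linarith
      have c: "cell M (conf ?z (Suc t)) k (int ?d - int (radius x)) = ?g"
        unfolding eq cell_next using True by auto
      have "t + 1 < ?Y" "k < ?Y" "?d < ?Y" using s bounds[of x] by simp_all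
      moreover have "?g < ?Y" using c cell_conf_less SY by metis
      ultimately show ?thesis
        using goal[of "t + 1" k ?d ?g] c d' 1 by (simp add: pos_def)
    next
      case False
      then consider k' where "k' \<le> K" "\<not> ?\<phi> t k' (radius x) (read_sym j k')" | "\<not> ?\<phi> t k d g" by blast
      then show ?thesis
      proof cases
        case (1 k')
        have "Gs ! j ! k' < S"
        proof -
          have "Gs ! j \<in> set Gs" using s(1) by simp
          then have "length (Gs ! j) = Suc K" "set (Gs ! j) \<subseteq> {..<S}" by (simp_all only: mem_Gs)
          then show ?thesis using nth_mem[of k' "Gs ! j"] 1(1) by force
        qed
        then have "read_sym j k' < ?Y" using s(1) 1(1) SY by (simp add: read_sym_def)
        then show ?thesis
          using goal[of t k' "radius x" "read_sym j k'"] 1 \<open>is_step x c j t k d\<close> b bounds[of x]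
          by (simp add: neg_def pos_def)
      next
        case 2
        then show ?thesis
          using goal[of t k d g] \<open>is_step x c j t k d\<close> b by (simp add: neg_def pos_def)
      qed
    qed
  next
    case 2
    let ?g = "cell M (conf ?z 0) k (int d - int (radius x))"
    have g: "?g = (if k = 0 then tape_of ?z (int d - int (radius x)) else 0)" by (rule cell_start[OF 2(2)])
    have "allowed x k d ?g"
    proof (cases "k = 0 \<and> radius x \<le> d")
      case True
      define i where "i = d - radius x"
      have di: "d = radius x + i" "int d - int (radius x) = int i" using True by (simp_all add: i_def)
      have gi: "?g = tape_of ?z (int i)" unfolding g using True di(2) by simp
      show ?thesis unfolding gi
      proof (cases "i < input_len x")
        case False
        then have "tape_of ?z (int i) = 0" using y
          by (simp add: tape_of_def length_pair_word input_len_def prefix_len_def)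
        then show "allowed x k d (tape_of ?z (int i))"
          using True False by (simp add: allowed_def di input_len_def)
      next
        case inp: True
        then show "allowed x k d (tape_of ?z (int i))"
          using True tape_prefix[of i x y] tape_of_le_2[of ?z "int i"] by (simp add: allowed_def di)
      qed
    next
      case False
      then show ?thesis unfolding g by (auto simp: allowed_def tape_of_def)
    qed
    then show ?thesis
      using goal[of 0 k d ?g] 2 b SY[OF cell_conf_less] by (simp add: pos_def is_step_def)
  next
    case 3
    then have d: "radius x + prefix_len x \<le> d" "d \<le> 2 * radius x" "c = 2" by (auto simp: is_blank_def)
    define i where "i = d - (radius x + prefix_len x)"
    have di: "d = radius x + prefix_len x + i" using d(1) by (simp add: i_def)
    have cell: "cell M (conf ?z 0) 0 (int (radius x + prefix_len x + n) - int (radius x)) = tape_of y (int n)" for n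
      using tape_witness[of x y n] by (simp add: cell_start)
    have less: "d + 1 < ?Y" "0 < ?Y" using d(2) bounds[of x] by simp_all
    show ?thesis
    proof (cases "tape_of y (int i) = 0")
      case True
      then have "tape_of y (int (i + 1)) = 0" by (auto simp: tape_of_def split: if_splits)
      then have "?\<phi> 0 0 (d + 1) 0" using cell[of "i + 1"] by (simp add: di algebra_simps)
      then show ?thesis
        using goal[of 0 0 "d + 1" 0] 3 less d(3) by (simp add: pos_def is_step_def)
    next
      case False
      then have "\<not> ?\<phi> 0 0 d 0" using cell[of i] by (simp add: di)
      then show ?thesis
        using goal[of 0 0 d 0] 3 less d(3) by (simp add: pos_def neg_def is_step_def)
    qed
  next
    case 4
    have "length ?z \<le> input_len x"
      using y by (simp add: length_pair_word input_len_def prefix_len_def)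
    then have "fst (snd (conf ?z (end_time x)) ! 1) = tape_of [?z \<in> R]"
      by (intro conf_end) (simp add: end_time_def poly_nat_mono)
    then have "cell M (conf ?z (end_time x)) 1 e \<noteq> 1" for e
      using K2 R by (cases "conf ?z (end_time x)") (simp add: tape_of_def)
    then have "\<not> ?\<phi> (end_time x) 1 d 1" by blast
    then show ?thesis
      using goal[of "end_time x" 1 d 1] 4 b bounds[of x] by (simp add: pos_def neg_def is_step_def is_blank_def)
  next
    case 5
    have "?\<phi> 0 K (radius x) 0" using cell_start[of K] K2 by simp
    moreover have "pos x c j t k d g 0 K (radius x) 0" using 5 unfolding pos_def by argo
    moreover have "0 < ?Y" "radius x < ?Y" using bounds[of x] by linarith+
    ultimately show ?thesis using goal[of 0 K "radius x" 0] bounds(3)[of x] by blast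
  qed
qed

theorem satisfied_iff_accepted:
  "(\<exists>\<phi>. satisfied x \<phi>) \<longleftrightarrow> (\<exists>y. length y \<le> poly pw (length x) \<and> pair_word x y \<in> R)"
proof
  assume "\<exists>\<phi>. satisfied x \<phi>"
  then obtain \<phi> where "satisfied x \<phi>" ..
  from length_witness accepted_if_satisfied[OF this]
  show "\<exists>y. length y \<le> poly pw (length x) \<and> pair_word x y \<in> R" by blast
next
  assume "\<exists>y. length y \<le> poly pw (length x) \<and> pair_word x y \<in> R"
  then obtain y where "length y \<le> poly pw (length x)" "pair_word x y \<in> R" by blast
  from satisfied_if_accepted[OF this] show "\<exists>\<phi>. satisfied x \<phi>"
    by (rule exI[where P = "satisfied x"])
qed

end

section \<open>The reduction\<close>

text \<open>A word encodes at most one graph, so membership can be tested on the graph from which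
  the word was made.\<close>

lemma two_FLIP_iff:
  assumes "simple_matrix n adj"
  shows "encode_matrix n adj \<in> two_FLIP \<longleftrightarrow> (\<exists>c. flip_coloring {..<n} (matrix_edges n adj) c)"
proof
  assume "encode_matrix n adj \<in> two_FLIP"
  then obtain m E c where E: "encode_graph n (matrix_edges n adj) = encode_graph m E"
    "finite_simple_graph {..<m} E" "flip_coloring {..<m} E c"
    unfolding two_FLIP_def mem_Collect_eq encode_graph_matrix[OF assms] by (elim exE conjE)
  from encode_graph_inject[OF graph_matrix[OF assms] E(2,1)] E(3)
  show "\<exists>c. flip_coloring {..<n} (matrix_edges n adj) c" by auto
next
  assume "\<exists>c. flip_coloring {..<n} (matrix_edges n adj) c"
  then show "encode_matrix n adj \<in> two_FLIP" unfolding two_FLIP_matrix using assms by blast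
qed

section \<open>Renaming vertices along an injection\<close>

lemma flips_at_image:
  assumes f: "inj_on f U" and E: "E \<subseteq> Pow U" and v: "v \<in> U"
  shows "flips_at ((`) f ` E) c (f v) \<longleftrightarrow> flips_at E (\<lambda>e. c (f ` e)) v"
proof -
  have inj: "inj_on ((`) f) (Pow U)" using f by (rule inj_on_image_Pow)
  have card: "card ((`) f ` A) = card A" if "A \<subseteq> E" for A
    using inj_on_subset[OF inj, of A] that E by (intro card_image) auto
  have mem: "f w \<in> f ` e \<longleftrightarrow> w \<in> e" if "e \<in> E" "w \<in> U" for e w
    using f E that by (auto simp: inj_on_def)
  have nb: "closed_neighborhood ((`) f ` E) (f v) = f ` closed_neighborhood E v"
  proof -
    have "{u, f v} \<in> (`) f ` E \<longleftrightarrow> u \<in> f ` {w. {w, v} \<in> E}" for u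
    proof
      assume "{u, f v} \<in> (`) f ` E"
      then obtain e where e: "e \<in> E" "{u, f v} = f ` e" by (rule imageE)
      have "u \<in> f ` e" by (simp flip: e(2))
      then obtain w where w: "w \<in> e" "u = f w" by auto
      then have "f ` {w, v} = f ` e" using e(2) by simp
      moreover have "{w, v} \<subseteq> U" "e \<subseteq> U" using E e(1) w(1) v by auto
      ultimately have "{w, v} = e" using inj_on_image_eq_iff[OF f] by blast
      then show "u \<in> f ` {w. {w, v} \<in> E}" using e(1) w(2) by simp
    next
      assume "u \<in> f ` {w. {w, v} \<in> E}"
      then obtain w where w: "{w, v} \<in> E" "u = f w" by auto
      then have "{u, f v} = f ` {w, v}" by simp
      then show "{u, f v} \<in> (`) f ` E" using w(1) by (rule image_eqI)
    qed
    then show ?thesis by (auto simp: closed_neighborhood_def)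
  qed
  have N: "closed_neighborhood E v \<subseteq> U"
    using E v by (auto simp: closed_neighborhood_def)
  have "{e \<in> (`) f ` E. f v \<in> e \<and> c e = a} = (`) f ` {e \<in> E. v \<in> e \<and> c (f ` e) = a}" for a
    using mem[OF _ v] by auto
  moreover have "{e \<in> (`) f ` E. e \<subseteq> f ` closed_neighborhood E v \<and> c e = a}
      = (`) f ` {e \<in> E. e \<subseteq> closed_neighborhood E v \<and> c (f ` e) = a}" for a
  proof -
    have "f ` e \<subseteq> f ` closed_neighborhood E v \<longleftrightarrow> e \<subseteq> closed_neighborhood E v" if "e \<in> E" for e
    proof
      assume sub: "f ` e \<subseteq> f ` closed_neighborhood E v"
      show "e \<subseteq> closed_neighborhood E v"
      proof
        fix w assume "w \<in> e"
        then have "w \<in> U" "f w \<in> f ` closed_neighborhood E v" using E that sub by auto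
        then show "w \<in> closed_neighborhood E v" using inj_on_image_mem_iff[OF f _ N] by simp
      qed
    qed (rule image_mono)
    then show ?thesis by auto
  qed
  ultimately show ?thesis unfolding flips_at_def nb by (simp add: card)
qed

lemma flip_coloring_image:
  assumes f: "inj_on f U" and E: "E \<subseteq> Pow U"
  shows "(\<exists>c. flip_coloring (f ` U) ((`) f ` E) c) \<longleftrightarrow> (\<exists>c. flip_coloring U E c)"
proof
  assume "\<exists>c. flip_coloring (f ` U) ((`) f ` E) c"
  then obtain c where "flip_coloring (f ` U) ((`) f ` E) c" ..
  then have "flip_coloring U E (\<lambda>e. c (f ` e))"
    using flips_at_image[OF f E] by (simp add: flip_coloring_iff)
  then show "\<exists>c. flip_coloring U E c" by (rule exI[where P = "flip_coloring U E"])
next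
  assume "\<exists>c. flip_coloring U E c"
  then obtain c where c: "flip_coloring U E c" ..
  \<comment> \<open>An edge of the image is colored like its preimage in \<open>U\<close>.\<close>
  define c' where "c' e = c {v \<in> U. f v \<in> e}" for e
  have "c' (f ` e) = c e" if "e \<in> E" for e
  proof -
    have "e \<subseteq> U" using E that by blast
    then have "{v \<in> U. f v \<in> f ` e} = e" using inj_on_image_mem_iff[OF f, of _ e] by auto
    then show ?thesis by (simp add: c'_def)
  qed
  then have "flips_at E (\<lambda>e. c' (f ` e)) v \<longleftrightarrow> flips_at E c v" for v
    unfolding flips_at_def by (auto cong: conj_cong)
  then have "flip_coloring (f ` U) ((`) f ` E) c'"
    using c flips_at_image[OF f E, of _ c'] by (auto simp: flip_coloring_iff)
  then show "\<exists>c. flip_coloring (f ` U) ((`) f ` E) c"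
    by (rule exI[where P = "flip_coloring (f ` U) ((`) f ` E)"])
qed

text \<open>Adjacency as a condition on components, in the form that \<open>adjacent\<close>
  expresses in terms of vertex numbers.\<close>

lemma (in slack) mem_E_iff:
  assumes "(z, i, k) \<in> V" "(z', j, l) \<in> V"
  shows "{(z, i, k), (z', j, l)} \<in> E \<longleftrightarrow>
    i = 0 \<and> k = 0 \<and> j = 0 \<and> l = 0 \<and> {z, z'} \<in> F \<or>
    z = z' \<and> \<not> (z \<in> T \<and> i = 0 \<and> k = 0) \<and> \<not> (z' \<in> T \<and> j = 0 \<and> l = 0) \<and>
      (k = l \<and> i \<noteq> j \<or> i = j \<and> (k < b \<and> b \<le> l \<or> l < b \<and> b \<le> k))"
proof -
  let ?e = "{(z, i, k), (z', j, l)}"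
  have base: "(w, m, n) \<in> base ` T \<longleftrightarrow> w \<in> T \<and> m = 0 \<and> n = 0" for w m n
    by (auto simp: base_def)
  have core: "?e \<in> (`) base ` F \<longleftrightarrow> i = 0 \<and> k = 0 \<and> j = 0 \<and> l = 0 \<and> {z, z'} \<in> F"
  proof
    assume "?e \<in> (`) base ` F"
    then obtain f where f: "f \<in> F" "?e = base ` f" by (rule imageE)
    have "fst ` ?e = fst ` base ` f" by (simp only: f(2))
    then have "{z, z'} = f" by (simp add: image_image base_def)
    moreover have "?e \<subseteq> range base" unfolding f(2) by blast
    ultimately show "i = 0 \<and> k = 0 \<and> j = 0 \<and> l = 0 \<and> {z, z'} \<in> F"
      using f(1) by (auto simp: base_def)
  next
    assume "i = 0 \<and> k = 0 \<and> j = 0 \<and> l = 0 \<and> {z, z'} \<in> F"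
    then have "?e = base ` {z, z'}" "{z, z'} \<in> F" by (simp_all add: base_def)
    then show "?e \<in> (`) base ` F" by (rule image_eqI)
  qed
  have red: "?e \<in> reds \<longleftrightarrow> z = z' \<and> \<not> (z \<in> T \<and> i = 0 \<and> k = 0) \<and> \<not> (z' \<in> T \<and> j = 0 \<and> l = 0) \<and> k = l \<and> i \<noteq> j"
    using assms by (auto simp: reds_def doubleton_eq_iff base)
  have blue: "?e \<in> blues \<longleftrightarrow> z = z' \<and> \<not> (z \<in> T \<and> i = 0 \<and> k = 0) \<and> \<not> (z' \<in> T \<and> j = 0 \<and> l = 0) \<and> i = j \<and> (k < b \<and> b \<le> l \<or> l < b \<and> b \<le> k)"
    using assms by (auto simp: blues_def doubleton_eq_iff base)
  show ?thesis unfolding E_iff core red blue by blast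
qed

text \<open>Division with remainder in a mixed radix system; the leading component is the remaining
  quotient.\<close>

definition decode :: "nat \<Rightarrow> nat \<Rightarrow> nat \<Rightarrow> nat \<Rightarrow> (nat \<times> nat \<times> nat) \<times> nat \<times> nat" where
  "decode y s b v = ((v div b div s div y div y, v div b div s div y mod y, v div b div s mod y),
     v div b mod s, v mod b)"

lemma decode_bij:
  fixes y s b :: nat
  assumes "0 < y" "0 < s" "0 < b"
  shows "inj_on (decode y s b) {..<y * y * y * s * b}"
    "decode y s b ` {..<y * y * y * s * b} = ({..<y} \<times> {..<y} \<times> {..<y}) \<times> {..<s} \<times> {..<b}"
proof -
  have pair: "v = w" if "v div m = w div m" "v mod m = w mod m" for v w m :: nat
    using that by (metis div_mult_mod_eq)
  show inj: "inj_on (decode y s b) {..<y * y * y * s * b}"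
  proof (rule inj_onI)
    fix v w assume "decode y s b v = decode y s b w"
    then have *: "(v div b div s div y div y = w div b div s div y div y \<and>
        v div b div s div y mod y = w div b div s div y mod y \<and> v div b div s mod y = w div b div s mod y) \<and>
      v div b mod s = w div b mod s \<and> v mod b = w mod b"
      unfolding decode_def prod.inject .
    have "v div b div s div y = w div b div s div y" by (rule pair[of _ y]) (use * in simp_all)
    then have "v div b div s = w div b div s" by (rule pair[of _ y]) (use * in simp)
    then have "v div b = w div b" by (rule pair[of _ s]) (use * in simp)
    then show "v = w" by (rule pair[of _ b]) (use * in simp)
  qed
  have sub: "decode y s b ` {..<y * y * y * s * b} \<subseteq> ({..<y} \<times> {..<y} \<times> {..<y}) \<times> {..<s} \<times> {..<b}"
    using assms by (auto simp: decode_def less_mult_imp_div_less)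
  have "card (decode y s b ` {..<y * y * y * s * b}) = y * y * y * s * b"
    using card_image[OF inj] by simp
  then show "decode y s b ` {..<y * y * y * s * b} = ({..<y} \<times> {..<y} \<times> {..<y}) \<times> {..<s} \<times> {..<b}"
    using sub by (intro card_subset_eq) (simp_all add: card_cartesian_product mult.assoc)
qed

section \<open>Numbering the vertices of the constructed graph\<close>

context tableau
begin

definition size_cnf :: "bool list \<Rightarrow> nat" where
  "size_cnf x = range_bound x ^ 6"

definition lit :: "bool list \<Rightarrow> nat \<Rightarrow> nat \<Rightarrow> nat" where
  "lit x C v = (if v < range_bound x ^ 4 then
      literal x (digit (range_bound x) 5 C) (digit (range_bound x) 4 C) (digit (range_bound x) 3 C)
        (digit (range_bound x) 2 C) (digit (range_bound x) 1 C) (digit (range_bound x) 0 C)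
        (digit (range_bound x) 3 v) (digit (range_bound x) 2 v) (digit (range_bound x) 1 v)
        (digit (range_bound x) 0 v) else 0)"

lemma satisfiable_lit:
  "satisfiable (size_cnf x) (lit x) \<longleftrightarrow>
     (\<exists>y. length y \<le> poly pw (length x) \<and> pair_word x y \<in> R)"
proof -
  have "0 < range_bound x" using bounds(7)[of x] by linarith
  from satisfiable_digits[OF this, of "lit x" "literal x", OF lit_def]
  have "satisfiable (size_cnf x) (lit x) \<longleftrightarrow> (\<exists>\<phi>. satisfied x \<phi>)"
    unfolding satisfied_def Let_def size_cnf_def .
  then show ?thesis unfolding satisfied_iff_accepted .
qed

definition clique_size :: "bool list \<Rightarrow> nat" where
  "clique_size x = 2 * (size_cnf x * size_cnf x * size_cnf x) + 7"

definition side_size :: "bool list \<Rightarrow> nat" where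
  "side_size x = 3 * (size_cnf x * size_cnf x * size_cnf x) + 8"

text \<open>A full cube, so that vertices are numbered by plain division. Triples without a meaning
  are isolated in the core graph and not tight, so their gadgets satisfy them.\<close>

definition kinds :: "bool list \<Rightarrow> (nat \<times> nat \<times> nat) set" where
  "kinds x = {..<size_cnf x} \<times> {..<size_cnf x} \<times> {..<size_cnf x}"

lemma size_cnf_ge: "10 \<le> size_cnf x"
proof -
  have "10 ^ 1 \<le> (range_bound x) ^ 6"
    using bounds(7)[of x] by (intro order_trans[OF power_mono power_increasing]) simp_all
  then show ?thesis by (simp add: size_cnf_def)
qed

lemma slack_cnf:
  "slack (kinds x) (oriented.edges (cnf.arcs (size_cnf x) (lit x))) (cnf.tight (size_cnf x) (lit x))
     (size_cnf x * size_cnf x * size_cnf x) (clique_size x) (side_size x)"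
proof
  interpret cnf "size_cnf x" "lit x" .
  have "arcs \<subseteq> kinds x \<times> kinds x"
  proof clarify
    fix t C u t' C' u' assume "((t, C, u), (t', C', u')) \<in> arcs"
    then show "(t, C, u) \<in> kinds x \<and> (t', C', u') \<in> kinds x"
      using size_cnf_ge[of x] lit_neq(2)[of C u'] occ_less[of C u] occ_less[of C u']
      unfolding arc_iff by (elim disjE conjE) (simp_all add: kinds_def)
  qed
  then have "e \<subseteq> kinds x \<and> card e = 2" if "e \<in> edges" for e
    using that irrefl by (auto simp: edges_def card_insert_if simp del: arc_iff)
  then show "finite_simple_graph (kinds x) edges"
    by (simp add: finite_simple_graph_def kinds_def)
  show "tight \<subseteq> kinds x"
    using size_cnf_ge[of x] by (auto simp: tight_def kinds_def occ_def)
  show "card (kinds x) \<le> size_cnf x * size_cnf x * size_cnf x"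
    by (simp add: kinds_def card_cartesian_product)
qed (simp_all add: clique_size_def side_size_def)

definition graph_size :: "bool list \<Rightarrow> nat" where
  "graph_size x = size_cnf x * size_cnf x * size_cnf x * clique_size x * (2 * side_size x)"

definition side_pos :: "bool list \<Rightarrow> nat \<Rightarrow> nat" where
  "side_pos x v = v mod (2 * side_size x)"

definition clique_pos :: "bool list \<Rightarrow> nat \<Rightarrow> nat" where
  "clique_pos x v = v div (2 * side_size x) mod clique_size x"

definition var_of :: "bool list \<Rightarrow> nat \<Rightarrow> nat" where
  "var_of x v = v div (2 * side_size x) div clique_size x mod size_cnf x"

definition clause_of :: "bool list \<Rightarrow> nat \<Rightarrow> nat" where
  "clause_of x v = v div (2 * side_size x) div clique_size x div size_cnf x mod size_cnf x"

definition kind_of :: "bool list \<Rightarrow> nat \<Rightarrow> nat" where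
  "kind_of x v = v div (2 * side_size x) div clique_size x div size_cnf x div size_cnf x"

definition occurs :: "bool list \<Rightarrow> nat \<Rightarrow> nat \<Rightarrow> bool" where
  "occurs x C u \<longleftrightarrow> C < size_cnf x \<and> u < size_cnf x \<and> (lit x C u = 1 \<or> lit x C u = 2)"

definition is_arc :: "bool list \<Rightarrow> nat \<Rightarrow> nat \<Rightarrow> nat \<Rightarrow> nat \<Rightarrow> nat \<Rightarrow> nat \<Rightarrow> bool" where
  "is_arc x t C u t' C' u' \<longleftrightarrow>
     t = 0 \<and> C = 0 \<and> C' = 0 \<and> u' = u \<and> u < size_cnf x \<and> (t' = 1 \<or> t' = 2 \<or> t' = 3) \<or>
     (t = 1 \<and> t' = 2 \<or> t = 1 \<and> t' = 3 \<or> t = 2 \<and> t' = 3) \<and> C = 0 \<and> C' = 0 \<and> u' = u \<and> u < size_cnf x \<or>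
     t = 4 \<and> u = 0 \<and> C' = C \<and> u' = 0 \<and> C < size_cnf x \<and> (t' = 5 \<or> t' = 6 \<or> t' = 7) \<or>
     t = 4 \<and> u = 0 \<and> C' = 0 \<and> occurs x C u' \<and> (t' = 0 \<or> t' = lit x C u') \<or>
     t = 4 \<and> u = 0 \<and> C' = C \<and> occurs x C u' \<and> (t' = 8 \<or> t' = 9) \<or>
     t = 8 \<and> C' = 0 \<and> u' = u \<and> occurs x C u \<and> t' = 0 \<or>
     (t = 8 \<or> t = 9) \<and> C' = C \<and> u' = 0 \<and> occurs x C u \<and> t' = 5"

definition is_tight :: "bool list \<Rightarrow> nat \<Rightarrow> nat \<Rightarrow> nat \<Rightarrow> bool" where
  "is_tight x t C u \<longleftrightarrow> t = 0 \<and> C = 0 \<and> u < size_cnf x \<or> t = 4 \<and> u = 0 \<and> C < size_cnf x \<or>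
     t = 8 \<and> occurs x C u"

definition tight_base :: "bool list \<Rightarrow> nat \<Rightarrow> bool" where
  "tight_base x v \<longleftrightarrow> is_tight x (kind_of x v) (clause_of x v) (var_of x v) \<and>
     clique_pos x v = 0 \<and> side_pos x v = 0"

definition core_arc :: "bool list \<Rightarrow> nat \<Rightarrow> nat \<Rightarrow> bool" where
  "core_arc x v w \<longleftrightarrow> is_arc x (kind_of x v) (clause_of x v) (var_of x v)
     (kind_of x w) (clause_of x w) (var_of x w)"

definition adjacent :: "bool list \<Rightarrow> nat \<Rightarrow> nat \<Rightarrow> bool" where
  "adjacent x v w \<longleftrightarrow>
     clique_pos x v = 0 \<and> side_pos x v = 0 \<and> clique_pos x w = 0 \<and> side_pos x w = 0 \<and>
       (core_arc x v w \<or> core_arc x w v) \<or>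
     (kind_of x v = kind_of x w \<and> clause_of x v = clause_of x w \<and> var_of x v = var_of x w) \<and>
       \<not> tight_base x v \<and> \<not> tight_base x w \<and>
       (side_pos x v = side_pos x w \<and> clique_pos x v \<noteq> clique_pos x w \<or>
        clique_pos x v = clique_pos x w \<and>
          (side_pos x v < side_size x \<and> side_size x \<le> side_pos x w \<or>
           side_pos x w < side_size x \<and> side_size x \<le> side_pos x v))"

lemma reduction_correct:
  "encode_matrix (graph_size x) (adjacent x) \<in> two_FLIP \<longleftrightarrow>
     (\<exists>y. length y \<le> poly pw (length x) \<and> pair_word x y \<in> R)"
proof -
  interpret cnf "size_cnf x" "lit x" .
  interpret slack "kinds x" edges tight "size_cnf x * size_cnf x * size_cnf x" "clique_size x" "side_size x"
    by (rule slack_cnf)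
  let ?f = "decode (size_cnf x) (clique_size x) (2 * side_size x)" and ?n = "graph_size x"
  have "0 < size_cnf x" "0 < clique_size x" "0 < 2 * side_size x"
    using size_cnf_ge[of x] by (simp_all add: clique_size_def side_size_def)
  note f = decode_bij[OF this, folded graph_size_def kinds_def, folded V_def]
  have occ: "(C, u) \<in> occ \<longleftrightarrow> occurs x C u" for C u
    by (simp add: occ_def occurs_def)
  have arcs: "((t, C, u), (t', C', u')) \<in> arcs \<longleftrightarrow> is_arc x t C u t' C' u'" for t C u t' C' u'
    unfolding arc_iff is_arc_def occ ..
  have tight: "(t, C, u) \<in> tight \<longleftrightarrow> is_tight x t C u" for t C u
    by (auto simp: tight_def is_tight_def occ)
  have fv: "?f v = ((kind_of x v, clause_of x v, var_of x v), clique_pos x v, side_pos x v)" for v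
    by (simp add: decode_def kind_of_def clause_of_def var_of_def clique_pos_def side_pos_def)
  have adj: "{?f v, ?f w} \<in> E \<longleftrightarrow> adjacent x v w" if "v < ?n" "w < ?n" for v w
  proof -
    have "?f v \<in> V" "?f w \<in> V" using f(2) that by blast+
    from mem_E_iff[OF this[unfolded fv]] show ?thesis
      unfolding fv edge_iff arcs tight adjacent_def core_arc_def tight_base_def by auto
  qed
  have E2: "e \<subseteq> V \<and> card e = 2" if "e \<in> E" for e
    using graph_E that by (simp add: finite_simple_graph_def)
  have sm: "simple_matrix ?n (adjacent x)"
    unfolding simple_matrix_def
  proof (intro conjI allI impI)
    fix v w assume vw: "v < ?n" "w < ?n" "adjacent x v w"
    then have "{?f v, ?f w} \<in> E" by (simp only: adj)
    then have "{?f w, ?f v} \<in> E" by (simp only: insert_commute[of "?f w"])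
    then show "adjacent x w v" by (simp only: adj vw)
  next
    fix v assume v: "v < ?n"
    show "\<not> adjacent x v v"
    proof
      assume "adjacent x v v"
      then have "{?f v, ?f v} \<in> E" using v by (simp only: adj)
      then have "card {?f v, ?f v} = 2" using E2 by blast
      then show False by simp
    qed
  qed
  have im: "(`) ?f ` matrix_edges ?n (adjacent x) = E"
  proof (intro equalityI subsetI)
    fix e assume "e \<in> (`) ?f ` matrix_edges ?n (adjacent x)"
    then obtain d where d: "d \<in> matrix_edges ?n (adjacent x)" "e = ?f ` d" by (elim imageE)
    then obtain v w where vw: "d = {v, w}" "v < ?n" "w < ?n" "adjacent x v w"
      unfolding matrix_edges_def mem_Collect_eq by (elim exE conjE)
    have "{?f v, ?f w} \<in> E" using vw(4) by (simp only: adj[OF vw(2,3)])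
    then show "e \<in> E" unfolding d(2) vw(1) by simp
  next
    fix e assume e: "e \<in> E"
    obtain p q where "e = {p, q}" using E2[OF e] unfolding card_2_iff by (elim exE conjE)
    moreover from this have "p \<in> V" "q \<in> V" using E2[OF e] by simp_all
    ultimately have pq: "e = {p, q}" "p \<in> V" "q \<in> V" .
    from pq(2) obtain v where v: "p = ?f v" "v < ?n" unfolding f(2)[symmetric] by (elim imageE) simp
    from pq(3) obtain w where w: "q = ?f w" "w < ?n" unfolding f(2)[symmetric] by (elim imageE) simp
    have "adjacent x v w" using adj[OF v(2) w(2)] e by (simp only: pq(1) v(1) w(1))
    then have "{v, w} \<in> matrix_edges ?n (adjacent x)"
      unfolding matrix_edges_def using v(2) w(2) by blast
    moreover have "e = ?f ` {v, w}" by (simp add: pq(1) v(1) w(1))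
    ultimately show "e \<in> (`) ?f ` matrix_edges ?n (adjacent x)" by (rule rev_image_eqI)
  qed
  have sub: "matrix_edges ?n (adjacent x) \<subseteq> Pow {..<?n}"
    by (auto simp: matrix_edges_def)
  have "encode_matrix ?n (adjacent x) \<in> two_FLIP \<longleftrightarrow>
      (\<exists>c. flip_coloring {..<?n} (matrix_edges ?n (adjacent x)) c)"
    by (rule two_FLIP_iff[OF sm])
  also have "\<dots> \<longleftrightarrow> (\<exists>c. flip_coloring V E c)"
    by (rule flip_coloring_image[OF f(1) sub, unfolded f(2) im, symmetric])
  also have "\<dots> \<longleftrightarrow> (\<exists>c. \<forall>v \<in> tight. flips_at edges c v)" by (rule flip_coloring_slack)
  also have "\<dots> \<longleftrightarrow> satisfiable (size_cnf x) (lit x)" by (rule flips_iff_satisfiable)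
  also have "\<dots> \<longleftrightarrow> (\<exists>y. length y \<le> poly pw (length x) \<and> pair_word x y \<in> R)" by (rule satisfiable_lit)
  finally show ?thesis .
qed

subsection \<open>Computing the reduction\<close>

lemma expressible_lengths:
  "expressible (\<lambda>x v. prefix_len x)" "expressible (\<lambda>x v. input_len x)"
  "expressible (\<lambda>x v. end_time x)" "expressible (\<lambda>x v. radius x)" "expressible (\<lambda>x v. range_bound x)"
  "expressible (\<lambda>x v. size_cnf x)" "expressible (\<lambda>x v. clique_size x)" "expressible (\<lambda>x v. side_size x)"
  "expressible (\<lambda>x v. graph_size x)"
  unfolding graph_size_def clique_size_def side_size_def size_cnf_def range_bound_def radius_def
    end_time_def input_len_def prefix_len_def
  by (intro expressible_intros)+

lemma expressible_tables:
  assumes "expressible F" "expressible G"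
  shows "expressible (\<lambda>x v. read_sym (F x v) (G x v))" "expressible (\<lambda>x v. write_sym (F x v) (G x v))"
    "expressible (\<lambda>x v. head_move (F x v) (G x v))"
  unfolding read_sym_def write_sym_def head_move_def
  by (rule expressible_table2[OF assms])+

lemma expressible_lit:
  assumes "expressible F" "expressible G"
  shows "expressible (\<lambda>x v. lit x (F x v) (G x v))"
proof (rule expressible_comp2[OF _ assms])
  show "expressible (\<lambda>x v. lit x (v 0) (v 1))"
    unfolding lit_def literal_def pos_def neg_def is_step_def is_blank_def allowed_def prefix_sym_def digit_def
    by (intro expressible_intros expressible_lengths expressible_tables)
qed

lemma decidable_occurs:
  "expressible F \<Longrightarrow> expressible G \<Longrightarrow> decidable (\<lambda>x v. occurs x (F x v) (G x v))"
  unfolding occurs_def by (intro expressible_intros expressible_lengths expressible_lit)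

lemma decidable_tight_base:
  assumes "expressible F"
  shows "decidable (\<lambda>x v. tight_base x (F x v))"
proof (rule expressible_comp1[where f = "\<lambda>x u. of_bool (tight_base x u)", OF _ assms])
  show "decidable (\<lambda>x v. tight_base x (v 0))"
    unfolding tight_base_def is_tight_def kind_of_def clause_of_def var_of_def clique_pos_def side_pos_def
    by (intro expressible_intros expressible_lengths decidable_occurs)
qed

lemma decidable_core_arc:
  assumes "expressible F" "expressible G"
  shows "decidable (\<lambda>x v. core_arc x (F x v) (G x v))"
proof (rule expressible_comp2[where f = "\<lambda>x u w. of_bool (core_arc x u w)", OF _ assms])
  show "decidable (\<lambda>x v. core_arc x (v 0) (v 1))"
    unfolding core_arc_def is_arc_def kind_of_def clause_of_def var_of_def
    by (intro expressible_intros expressible_lengths decidable_occurs expressible_lit)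
qed

lemma decidable_adjacent:
  assumes "expressible F" "expressible G"
  shows "decidable (\<lambda>x v. adjacent x (F x v) (G x v))"
proof (rule expressible_comp2[where f = "\<lambda>x u w. of_bool (adjacent x u w)", OF _ assms])
  show "decidable (\<lambda>x v. adjacent x (v 0) (v 1))"
    unfolding adjacent_def kind_of_def clause_of_def var_of_def clique_pos_def side_pos_def
    by (intro expressible_intros expressible_lengths decidable_core_arc decidable_tight_base)
qed

lemma polytime_reduction: "polytime_computable (\<lambda>x. encode_matrix (graph_size x) (adjacent x))"
  unfolding encode_matrix_def
proof (rule polytime_computable_expressible)
  show "expressible (\<lambda>x v. graph_size x + 1 + graph_size x * graph_size x)"
    by (intro expressible_intros expressible_lengths)
  have "decidable (\<lambda>x v. v 0 < graph_size x \<or> v 0 \<noteq> graph_size x \<and>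
      adjacent x ((v 0 - graph_size x - 1) div graph_size x) ((v 0 - graph_size x - 1) mod graph_size x))"
    by (intro expressible_intros expressible_lengths decidable_adjacent)
  then show "decidable (\<lambda>x v. if v 0 < graph_size x then True else if v 0 = graph_size x then False
      else adjacent x ((v 0 - graph_size x - 1) div graph_size x) ((v 0 - graph_size x - 1) mod graph_size x))"
    by (rule expressible_cong) auto
qed

end

lemma two_FLIP_hard:
  assumes "L \<in> NP_class"
  shows "L \<le>\<^sub>p two_FLIP"
proof -
  obtain R pw where R: "R \<in> P_class"
    and L: "\<And>x. x \<in> L \<longleftrightarrow> (\<exists>y. length y \<le> poly pw (length x) \<and> pair_word x y \<in> R)"
    using assms unfolding NP_class_def by blast
  obtain M pt where "turing_machine M" "computes_in_time M (\<lambda>z. [z \<in> R]) (poly pt)"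
    using R unfolding P_class_def polytime_computable_def by blast
  then interpret tableau M R pt pw by unfold_locales
  show ?thesis
    unfolding polytime_reducible_def using polytime_reduction reduction_correct L by blast
qed

theorem theorem6p2: "NP_complete two_FLIP"
  unfolding NP_complete_def using two_FLIP_NP two_FLIP_hard by blast

end
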